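(* Let $\varepsilon>0$. Let $M$ be an integer, $N$ a natural number, and suppose $1\le Q\le N^{1/2}$. Let $(a_n)_{M<n\le M+N}$ be arbitrary complex numbers, $Z:=\sum_{n=M+1}^{M+N}|a_n|^2$ and $e(x):=e^{2\pi i x}$. Then $$\sum_{q\le Q}\ \sum_{\substack{a=1\\(a,q)=1}}^{q^3}\left|\sum_{n=M+1}^{M+N} a_n\, e\!\left(\frac{a}{q^3}n\right)\right|^2 \ll \begin{cases} N^{\varepsilon}\left(Q^4+N^{9/10}Q^{6/5}\right)Z, & \text{if } N^{7/24}\le Q\le N^{1/2},\\[4pt] NQ^{6/7+\varepsilon}Z, & \text{if } 1\le Q< N^{7/24},\end{cases}$$ where the implied constants depend only on $\varepsilon$.
   Context: Here $q$ runs over natural numbers $q\le Q$. *)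

theory Defs
  imports Complex_Main
begin

definition e :: "real \<Rightarrow> complex" where
  "e x = exp (2 * complex_of_real pi * \<i> * complex_of_real x)"

end

theory Submission
  imports Defs "HOL-Analysis.Analysis" "HOL-Number_Theory.Number_Theory"
begin

text \<open>
  By duality and a Fejer kernel the sum is at most \<open>9 * K * N * Z\<close>, where \<open>K\<close> is the largest number
  of reduced fractions \<open>a / q ^ 3\<close>, \<open>q \<le> Q\<close>, within \<open>1 / N\<close> of a real \<open>\<alpha>\<close>. It turns out that
  \<open>K\<close> is at most a constant times \<open>N powr \<epsilon> * (Q powr (3/4) + Q ^ 4 / N)\<close>, which is more than is
  needed in both ranges. If \<open>8 * Q ^ 3 > N\<close> this is trivial. Otherwise choose by Dirichlet
  \<open>b / r\<close> with \<open>r \<le> N / Q\<close> and \<open>\<bar>\<alpha> - b / r\<bar>\<close> at most about \<open>Q / (r * N)\<close>.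

  If \<open>r > Q\<close>, each \<open>q\<close> is such that \<open>\<alpha> * q ^ 3\<close> is within \<open>Q ^ 3 / N\<close> of an integer, and
  Weyl's inequality for cubic sums, averaged over about \<open>N / Q ^ 3\<close> frequencies, bounds their number.
  If \<open>r \<le> Q\<close>, put \<open>m = a * r - b * q ^ 3\<close>. At most one fraction has \<open>m = 0\<close>. For fixed
  \<open>m \<noteq> 0\<close> the admissible \<open>q\<close> lie in an interval of length at least \<open>r\<close> and satisfy
  \<open>b * q ^ 3 + m \<equiv> 0\<close> modulo \<open>r\<close>; such a congruence has few solutions on average over \<open>m\<close>.

  For \<open>Q ^ 6 > N\<close> a small power of \<open>N\<close> is bounded by a small power of \<open>Q\<close>; for \<open>Q ^ 6 \<le> N\<close> the
  fractions are separated by \<open>1 / N\<close>, so \<open>K \<le> 3\<close>.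
\<close>

section \<open>Divisors and cube roots modulo n\<close>

text \<open>The cutoff \<open>N / Q\<close> for the denominators serves both branches. In the Weyl
  branch, averaging over about \<open>H = N / (8 * Q ^ 3)\<close> frequencies stretches the slopes
  \<open>6 * h * u * v\<close> to length \<open>6 * H * Q ^ 2\<close>. For \<open>r > Q\<close> the
  fourth moment of the cubic sums is then, up to small powers of \<open>N\<close>, at most
  \<open>H * Q ^ 3 + r * Q\<close>: the first term is at most \<open>N\<close> by the choice of
  \<open>H\<close>, the second by \<open>r \<le> N / Q\<close>. As \<open>N\<close> has the size of
  \<open>H * Q ^ 3\<close>, a typical sum is at most \<open>Q powr (3/4)\<close>, hence that
  exponent. In the other branch put \<open>z = \<alpha> - b / r\<close>. For \<open>z\<close> larger
  than \<open>1 / N\<close> there are about \<open>\<bar>z\<bar> * r * Q ^ 3\<close> values of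
  \<open>m\<close>, each with a window for \<open>q\<close> of length about
  \<open>Q / (N * \<bar>z\<bar>)\<close>. So \<open>z\<close> cancels and \<open>Q ^ 4 / N\<close>
  remains, provided the window covers a period \<open>r\<close>, which Dirichlet's error
  \<open>Q / (r * N)\<close> guarantees. The obstacle is a common factor of \<open>q\<close> and
  \<open>r\<close>: for a single \<open>m\<close> it can produce many solutions, but only if
  \<open>m\<close> shares in it. Hence the average over \<open>m\<close>, and hence the exception of
  \<open>m = 0\<close>, which is divisible by everything.\<close>

lemma square_le_four_power: "(real k + 1)\<^sup>2 \<le> 4 ^ k"
proof (induction k)
  case (Suc k)
  have "(real (Suc k) + 1)\<^sup>2 \<le> 4 * (real k + 1)\<^sup>2"
    by (simp add: power2_eq_square algebra_simps)
  also have "\<dots> \<le> 4 * 4 ^ k" using Suc by simp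
  finally show ?case by simp
qed simp

text \<open>This pays for the small primes, where \<open>p powr (k * d)\<close> may lie below
  \<open>(k + 1)\<^sup>2\<close>. The inequality \<open>1 + x \<le> exp x\<close> at
  \<open>x = k * c\<close> gets squared, which is why \<open>c\<close> is half of
  \<open>d * ln 2\<close>.\<close>

lemma polynomial_le_exponential:
  fixes d :: real
  assumes "d > 0"
  obtains B where "B \<ge> 1" "\<And>k. (real k + 1)\<^sup>2 \<le> B * 2 powr (real k * d)"
proof -
  define c where "c = d * ln 2 / 2"
  have c: "c > 0" using assms by (simp add: c_def)
  define B where "B = (max 1 (1 / c))\<^sup>2"
  have "(real k + 1)\<^sup>2 \<le> B * 2 powr (real k * d)" for k
  proof -
    have "1 \<le> max 1 (1 / c)" "1 \<le> max 1 (1 / c) * c" using c by (auto simp: max_def field_simps)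
    then have "real k + 1 \<le> max 1 (1 / c) + max 1 (1 / c) * c * real k"
      using mult_right_mono[of 1 "max 1 (1 / c) * c" "real k"] by simp
    also have "\<dots> = max 1 (1 / c) * (1 + real k * c)" by (simp add: algebra_simps)
    also have "\<dots> \<le> max 1 (1 / c) * exp (real k * c)" by (intro mult_left_mono) (auto intro: exp_ge_add_one_self)
    finally have "(real k + 1)\<^sup>2 \<le> (max 1 (1 / c) * exp (real k * c))\<^sup>2"
      by (intro power_mono) auto
    also have "\<dots> = B * exp (2 * (real k * c))" by (simp add: B_def power_mult_distrib exp_double)
    also have "2 * (real k * c) = (real k * d) * ln 2" by (simp add: c_def)
    also have "exp ((real k * d) * ln 2) = 2 powr (real k * d)" by (simp add: powr_def)
    finally show ?thesis .
  qed
  moreover have "B \<ge> 1" by (simp add: B_def)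
  ultimately show ?thesis using that by blast
qed

text \<open>The parameter \<open>c\<close> is a residue class in the application to cube roots; the step may change
  it.\<close>

lemma prime_power_recursion_bound:
  fixes f :: "nat \<Rightarrow> 'c \<Rightarrow> real"
  assumes eps: "\<epsilon> > 0"
    and one: "\<And>c. f 1 c \<le> 1"
    and step: "\<And>p k s c. prime p \<Longrightarrow> k > 0 \<Longrightarrow> s > 0 \<Longrightarrow> \<not> p dvd s \<Longrightarrow>
      \<exists>c'. f (p ^ k * s) c \<le> (real k + 1)\<^sup>2 * f s c'"
  shows "\<exists>C\<ge>1. \<forall>n>0. \<forall>c. f n c \<le> C * real n powr \<epsilon>"
proof -
  obtain B where B1: "B \<ge> 1" and B: "\<And>k. (real k + 1)\<^sup>2 \<le> B * 2 powr (real k * \<epsilon>)"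
    using polynomial_le_exponential[OF eps] by blast
  obtain P :: nat where P: "4 powr (1/\<epsilon>) \<le> real P"
    using real_arch_simple by blast
  \<comment> \<open>The exponent of \<open>B\<close> counts only primes below \<open>P\<close>. A
    prime \<open>p \<ge> P\<close> has \<open>p powr \<epsilon> \<ge> 4\<close>, so its factor
    \<open>(k + 1)\<^sup>2 \<le> 4 ^ k\<close> is absorbed by its own part of
    \<open>n powr \<epsilon>\<close>; a smaller prime costs one \<open>B\<close>. There are at most
    \<open>P\<close> of these, so \<open>B ^ P\<close> is independent of \<open>n\<close>.\<close>
  have main: "f n c \<le> B ^ card {p. prime p \<and> p < P \<and> p dvd n} * real n powr \<epsilon>" if "n > 0" for n c
    using that
  proof (induction n arbitrary: c rule: less_induct)
    case (less n)
    show ?case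
    proof (cases "n = 1")
      case True
      have "{p::nat. prime p \<and> p < P \<and> p dvd n} = {}" using True by auto
      then have "card {p::nat. prime p \<and> p < P \<and> p dvd n} = 0" by (metis card.empty)
      with True one[of c] show ?thesis by (simp only: power_0 of_nat_1 powr_one_eq_one mult_1)
    next
      case False
      then obtain p where p: "prime p" "p dvd n" using prime_factor_nat by blast
      have fin: "finite {q. prime q \<and> q < P \<and> q dvd m}" for m by simp
      obtain s where ns: "n = p ^ multiplicity p n * s" and ps: "\<not> p dvd s"
        using multiplicity_decompose'[of n p] less.prems p by (metis not_prime_unit not_gr_zero)
      define k where "k = multiplicity p n"
      have k: "k > 0" using p less.prems k_def by (simp add: prime_multiplicity_gt_zero_iff)
      have s: "s > 0" using ns less.prems by (auto intro: Nat.gr0I)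
      have p1: "p ^ k > 1" using p(1) k one_less_power prime_gt_1_nat by metis
      have nks: "n = p ^ k * s" using ns k_def by simp
      then have "s < n" using p1 s by simp
      obtain c' where c': "f n c \<le> (real k + 1)\<^sup>2 * f s c'"
        using step[OF p(1) k s ps] nks by metis
      have IH: "f s c' \<le> B ^ card {q. prime q \<and> q < P \<and> q dvd s} * real s powr \<epsilon>"
        using less.IH[OF \<open>s < n\<close> s] .
      have npow: "real n powr \<epsilon> = real p powr (real k * \<epsilon>) * real s powr \<epsilon>"
        using nks prime_gt_0_nat[OF p(1)]
        by (simp add: powr_mult powr_powr powr_realpow[symmetric])
      have sub: "{q. prime q \<and> q < P \<and> q dvd s} \<subseteq> {q. prime q \<and> q < P \<and> q dvd n}"
        using nks by auto
      have key: "(real k + 1)\<^sup>2 * B ^ card {q. prime q \<and> q < P \<and> q dvd s}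
          \<le> B ^ card {q. prime q \<and> q < P \<and> q dvd n} * real p powr (real k * \<epsilon>)"
      proof (cases "p < P")
        case True
        have "insert p {q. prime q \<and> q < P \<and> q dvd s} \<subseteq> {q. prime q \<and> q < P \<and> q dvd n}"
          using sub True p by auto
        then have "card (insert p {q. prime q \<and> q < P \<and> q dvd s}) \<le> card {q. prime q \<and> q < P \<and> q dvd n}"
          using fin card_mono by blast
        then have "Suc (card {q. prime q \<and> q < P \<and> q dvd s}) \<le> card {q. prime q \<and> q < P \<and> q dvd n}"
          using ps by simp
        then have "B ^ Suc (card {q. prime q \<and> q < P \<and> q dvd s}) \<le> B ^ card {q. prime q \<and> q < P \<and> q dvd n}"
          using B1 power_increasing by blast
        moreover have "(real k + 1)\<^sup>2 \<le> B * real p powr (real k * \<epsilon>)"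
        proof -
          have "2 powr (real k * \<epsilon>) \<le> real p powr (real k * \<epsilon>)"
            using prime_ge_2_nat[OF p(1)] eps by (intro powr_mono2) auto
          then show ?thesis using B[of k] B1 by (meson mult_left_mono order_trans zero_le_one)
        qed
        moreover have "B ^ Suc (card {q. prime q \<and> q < P \<and> q dvd s}) * real p powr (real k * \<epsilon>)
            \<le> B ^ card {q. prime q \<and> q < P \<and> q dvd n} * real p powr (real k * \<epsilon>)"
          by (rule mult_right_mono) (use calculation in simp_all)
        ultimately have "(B * real p powr (real k * \<epsilon>)) * B ^ card {q. prime q \<and> q < P \<and> q dvd s}
            \<le> B ^ card {q. prime q \<and> q < P \<and> q dvd n} * real p powr (real k * \<epsilon>)"
          by (simp add: mult_ac)
        moreover have "(real k + 1)\<^sup>2 * B ^ card {q. prime q \<and> q < P \<and> q dvd s}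
           \<le> (B * real p powr (real k * \<epsilon>)) * B ^ card {q. prime q \<and> q < P \<and> q dvd s}"
          using \<open>(real k + 1)\<^sup>2 \<le> B * real p powr (real k * \<epsilon>)\<close> B1 by (intro mult_right_mono) auto
        ultimately show ?thesis by linarith
      next
        case False
        have "4 powr (1/\<epsilon>) \<le> real p" using P False by linarith
        then have "(4 powr (1/\<epsilon>)) powr (real k * \<epsilon>) \<le> real p powr (real k * \<epsilon>)"
          using eps by (intro powr_mono2) auto
        then have "4 ^ k \<le> real p powr (real k * \<epsilon>)" using eps by (simp add: powr_powr powr_realpow)
        then have "(real k + 1)\<^sup>2 \<le> real p powr (real k * \<epsilon>)" using square_le_four_power[of k] by linarith
        moreover have "B ^ card {q. prime q \<and> q < P \<and> q dvd s} \<le> B ^ card {q. prime q \<and> q < P \<and> q dvd n}"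
          using B1 card_mono[OF fin sub] power_increasing by blast
        ultimately have "(real k + 1)\<^sup>2 * B ^ card {q. prime q \<and> q < P \<and> q dvd s}
            \<le> real p powr (real k * \<epsilon>) * B ^ card {q. prime q \<and> q < P \<and> q dvd n}"
          using B1 by (intro mult_mono) auto
        then show ?thesis by (simp add: mult_ac)
      qed
      have "f n c \<le> (real k + 1)\<^sup>2 * (B ^ card {q. prime q \<and> q < P \<and> q dvd s} * real s powr \<epsilon>)"
        using c' IH by (meson mult_left_mono order_trans zero_le_power2)
      also have "\<dots> \<le> B ^ card {q. prime q \<and> q < P \<and> q dvd n} * real p powr (real k * \<epsilon>) * real s powr \<epsilon>"
        using mult_right_mono[OF key, of "real s powr \<epsilon>"] by (simp add: mult_ac)
      finally show ?thesis using npow by (simp add: mult_ac)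
    qed
  qed
  have "f n c \<le> B ^ P * real n powr \<epsilon>" if "n > 0" for n c
  proof -
    have "card {p. prime p \<and> p < P \<and> p dvd n} \<le> card {..<P}" by (intro card_mono) auto
    then have "B ^ card {p. prime p \<and> p < P \<and> p dvd n} \<le> B ^ P" using B1 power_increasing by fastforce
    then show ?thesis using main[OF that, of c] by (meson mult_right_mono order_trans powr_ge_zero)
  qed
  moreover have "B ^ P \<ge> 1" using B1 by simp
  ultimately show ?thesis by blast
qed

lemma divisor_bound:
  assumes "\<epsilon> > 0"
  shows "\<exists>C\<ge>1. \<forall>n>0. real (card {d::nat. d dvd n}) \<le> C * real n powr \<epsilon>"
proof -
  have step: "real (card {d. d dvd p ^ k * s}) \<le> (real k + 1)\<^sup>2 * real (card {d. d dvd s})"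
    if p: "prime p" and "k > 0" "s > 0" "\<not> p dvd s" for p k s :: nat
  proof -
    have fin: "finite {d. d dvd s}" using that by simp
    have "{d. d dvd p ^ k * s} \<subseteq> (\<lambda>(i, d). p ^ i * d) ` ({..k} \<times> {d. d dvd s})"
    proof
      fix d assume "d \<in> {d. d dvd p ^ k * s}"
      then obtain a b where "d = a * b" "a dvd p ^ k" "b dvd s"
        using division_decomp[of d "p ^ k" s] by auto
      moreover from \<open>a dvd p ^ k\<close> obtain i where "i \<le> k" "a = p ^ i"
        using divides_primepow_nat[OF p] by blast
      ultimately show "d \<in> (\<lambda>(i, d). p ^ i * d) ` ({..k} \<times> {d. d dvd s})" by auto
    qed
    then have "card {d. d dvd p ^ k * s} \<le> card ({..k} \<times> {d. d dvd s})"
      using fin by (meson card_image_le card_mono finite_SigmaI finite_atMost finite_imageI order_trans)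
    then have "card {d. d dvd p ^ k * s} \<le> (k + 1) * card {d. d dvd s}"
      by (simp add: card_cartesian_product)
    then have "real (card {d. d dvd p ^ k * s}) \<le> real ((k + 1) * card {d. d dvd s})"
      by (rule of_nat_mono)
    also have "\<dots> = (real k + 1) * real (card {d. d dvd s})"
      by (simp only: of_nat_mult of_nat_add of_nat_1)
    also have "\<dots> \<le> (real k + 1)\<^sup>2 * real (card {d. d dvd s})"
      by (intro mult_right_mono) (auto simp: power2_eq_square)
    finally show ?thesis .
  qed
  have "{d::nat. d dvd 1} = {1}" by auto
  then have one: "real (card {d::nat. d dvd 1}) \<le> 1" by simp
  \<comment> \<open>Divisor counts depend on \<open>n\<close> alone, so the parameter of the
    recursion gets the unit type.\<close>
  define f where "f n (c::unit) = real (card {d::nat. d dvd n})" for n c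
  have "\<exists>C\<ge>1. \<forall>n>0. \<forall>c. f n c \<le> C * real n powr \<epsilon>"
  proof (rule prime_power_recursion_bound[OF assms])
    show "f 1 c \<le> 1" for c unfolding f_def by (rule one)
    show "\<exists>c'. f (p ^ k * s) c \<le> (real k + 1)\<^sup>2 * f s c'"
      if "prime p" "k > 0" "s > 0" "\<not> p dvd s" for p k s :: nat and c
      unfolding f_def using step[OF that] by (rule exI)
  qed
  then show ?thesis unfolding f_def by blast
qed

section \<open>Cube roots among the units modulo prime powers and modulo \<open>n\<close>\<close>

lemma prime_power_dvd_of_not_common:
  fixes p :: int
  assumes "prime p" "p ^ k dvd a * b" "\<not> (p dvd a \<and> p dvd b)"
  shows "p ^ k dvd a \<or> p ^ k dvd b"
proof (cases "p dvd a")
  case True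
  then have "coprime (p ^ k) b" using assms prime_imp_coprime by (metis coprime_power_left_iff)
  then show ?thesis using assms(2) by (metis coprime_dvd_mult_left_iff)
next
  case False
  then have "coprime (p ^ k) a" using assms prime_imp_coprime by (metis coprime_power_left_iff)
  then show ?thesis using assms(2) by (metis coprime_dvd_mult_right_iff)
qed

text \<open>The restriction to units keeps the count small: modulo \<open>p ^ (3 * j)\<close> the
  class of 0 alone has \<open>p ^ (2 * j)\<close> cube roots. Roots that share a factor with the
  modulus are treated later by fixing their gcd with it.\<close>

definition cube_roots :: "nat \<Rightarrow> int \<Rightarrow> int set" where
  "cube_roots n c = {x \<in> {0..<int n}. coprime x (int n) \<and> int n dvd x ^ 3 - c}"

lemma finite_cube_roots [simp]: "finite (cube_roots n c)"
  by (rule finite_subset[of _ "{0..<int n}"]) (auto simp: cube_roots_def)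

lemma mod_eq_of_dvd_diff: "x \<in> {0..<m} \<Longrightarrow> m dvd x - (y::int) \<Longrightarrow> x = y mod m"
  by (metis atLeastLessThan_iff mod_eq_dvd_iff mod_pos_pos_trivial)

text \<open>Every root \<open>x\<close> is compared with one root \<open>y\<close> through
  \<open>x ^ 3 - y ^ 3 = (x - y) * (x\<^sup>2 + x * y + y\<^sup>2)\<close>. For
  \<open>p \<noteq> 3\<close> the prime cannot divide both factors, so all of \<open>p ^ k\<close>
  goes into one of them, which takes the place of Hensel lifting; a root \<open>w\<close> of the
  quadratic factor splits that factor again. For \<open>p = 3\<close> both factors are divisible by
  3, and losing one power of 3 leaves three lifts.\<close>

lemma card_cube_roots_prime_power:
  assumes p: "prime p" and k: "k > 0"
  shows "card (cube_roots (p ^ k) c) \<le> 3"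
proof (cases "cube_roots (p ^ k) c = {}")
  case False
  then obtain y where y: "y \<in> cube_roots (p ^ k) c" by blast
  let ?p = "int p"
  have pp: "prime ?p" using p by simp
  have rootD: "x \<in> {0..<?p^k}" "\<not> ?p dvd x" "?p ^ k dvd (x - y) * (x^2 + x*y + y^2)"
    if "x \<in> cube_roots (p ^ k) c" for x
  proof -
    show "x \<in> {0..<?p^k}" using that by (simp add: cube_roots_def)
    have "coprime x ?p" using that k by (simp add: cube_roots_def)
    then show "\<not> ?p dvd x" using pp by (metis coprime_absorb_right not_prime_unit)
    have "?p ^ k dvd x ^ 3 - c" "?p ^ k dvd y ^ 3 - c" using that y by (simp_all add: cube_roots_def)
    then have "?p ^ k dvd (x ^ 3 - c) - (y ^ 3 - c)" by (rule dvd_diff)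
    then show "?p ^ k dvd (x - y) * (x^2 + x*y + y^2)"
      by (simp add: algebra_simps power2_eq_square power3_eq_cube)
  qed
  have p_dvd: "?p dvd z" if "?p ^ k dvd z" for z
    using that k by (meson dvd_power dvd_trans)
  have three: "\<not> ?p dvd 3 * y^2" if "p \<noteq> 3"
  proof
    assume "?p dvd 3 * y^2"
    then have "?p dvd 3" using pp rootD(2)[OF y] by (metis prime_dvd_mult_iff prime_dvd_power_iff pos2)
    then have "p dvd 3" by presburger
    then show False using that p using that p dvd_imp_le[of p 3] prime_ge_2_nat[OF p] by (cases "p = 2") auto
  qed
  show ?thesis
  proof (cases "p = 3")
    case False
    have 1: "?p ^ k dvd x - y \<or> ?p ^ k dvd x^2 + x*y + y^2" if "x \<in> cube_roots (p ^ k) c" for x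
    proof (rule prime_power_dvd_of_not_common[OF pp rootD(3)[OF that]])
      show "\<not> (?p dvd x - y \<and> ?p dvd x^2 + x*y + y^2)"
      proof
        assume *: "?p dvd x - y \<and> ?p dvd x^2 + x*y + y^2"
        then have "?p dvd (x^2 + x*y + y^2) - (x - y) * (x + 2 * y)" by (meson dvd_diff dvd_mult2)
        also have "(x^2 + x*y + y^2) - (x - y) * (x + 2 * y) = 3 * y^2"
          by (simp add: algebra_simps power2_eq_square)
        finally show False using three[OF False] by simp
      qed
    qed
    show ?thesis
    proof (cases "\<exists>w \<in> cube_roots (p ^ k) c. ?p ^ k dvd w^2 + w*y + y^2")
      case True
      then obtain w where w: "w \<in> cube_roots (p ^ k) c" "?p ^ k dvd w^2 + w*y + y^2" by blast
      have "cube_roots (p ^ k) c \<subseteq> {y mod ?p^k, w mod ?p^k, (- w - y) mod ?p^k}"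
      proof
        fix x assume x: "x \<in> cube_roots (p ^ k) c"
        consider "?p ^ k dvd x - y" | "?p ^ k dvd x^2 + x*y + y^2" using 1[OF x] by blast
        then show "x \<in> {y mod ?p^k, w mod ?p^k, (- w - y) mod ?p^k}"
        proof cases
          case 1
          then show ?thesis using mod_eq_of_dvd_diff[OF rootD(1)[OF x]] by blast
        next
          case 2
          have "?p ^ k dvd (x^2 + x*y + y^2) - (w^2 + w*y + y^2)" using 2 w(2) by (rule dvd_diff)
          also have "(x^2 + x*y + y^2) - (w^2 + w*y + y^2) = (x - w) * (x - (- w - y))"
            by (simp add: algebra_simps power2_eq_square)
          finally have "?p ^ k dvd x - w \<or> ?p ^ k dvd x - (- w - y)"
          proof (rule prime_power_dvd_of_not_common[OF pp])
            show "\<not> (?p dvd x - w \<and> ?p dvd x - (- w - y))"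
            proof
              assume *: "?p dvd x - w \<and> ?p dvd x - (- w - y)"
              then have "?p dvd (x - w) + (x - (- w - y))" by (intro dvd_add) auto
              then have "?p dvd 2 * x + y" by (simp add: algebra_simps)
              \<comment> \<open>\<open>2 * x + y\<close> is the derivative of the quadratic factor
                in \<open>x\<close>, and \<open>- 3 * y\<^sup>2\<close> is its discriminant: a
                double root modulo \<open>p\<close> would make \<open>p\<close> divide
                \<open>3 * y\<^sup>2\<close>.\<close>
              then have "?p dvd 4 * (x^2 + x*y + y^2) - (2 * x + y) * (2 * x + y)"
                using p_dvd[OF 2] by (meson dvd_diff dvd_mult dvd_mult2)
              also have "4 * (x^2 + x*y + y^2) - (2 * x + y) * (2 * x + y) = 3 * y^2"
          by (simp add: algebra_simps power2_eq_square)
              finally show False using three[OF False] by simp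
            qed
          qed
          then show ?thesis using mod_eq_of_dvd_diff[OF rootD(1)[OF x]] by blast
        qed
      qed
      then have "card (cube_roots (p ^ k) c) \<le> card {y mod ?p^k, w mod ?p^k, (- w - y) mod ?p^k}"
        by (intro card_mono) auto
      also have "\<dots> \<le> 3" by (simp add: card_insert_if)
      finally show ?thesis .
    next
      case False
      then have "cube_roots (p ^ k) c \<subseteq> {y mod ?p^k}"
        using 1 mod_eq_of_dvd_diff[OF rootD(1)] by blast
      then have "card (cube_roots (p ^ k) c) \<le> card {y mod ?p^k}" by (intro card_mono) auto
      then show ?thesis by simp
    qed
  next
    case True
    define m :: int where "m = 3 ^ (k - 1)"
    have m: "?p ^ k = 3 * m" using True k by (simp add: m_def power_eq_if)
    have "cube_roots (p ^ k) c \<subseteq> (\<lambda>j. (y + m * j) mod ?p^k) ` {0..<3}"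
    proof
      fix x assume x: "x \<in> cube_roots (p ^ k) c"
      have "3 dvd x ^ 3 - y ^ 3"
        using p_dvd[OF rootD(3)[OF x]] True by (simp add: algebra_simps power2_eq_square power3_eq_cube)
      \<comment> \<open>Fermat modulo 3 turns \<open>x ^ 3 - y ^ 3\<close> into
        \<open>x - y\<close>. With \<open>x = y + 3 * t\<close> the quadratic factor is then 3 times
        a number prime to 3.\<close>
      moreover have "3 dvd z ^ 3 - z" for z :: int
      proof -
        have "z ^ 3 - z = z * (z - 1) * (z + 1)" by (simp add: algebra_simps power3_eq_cube)
        moreover have "3 dvd z \<or> 3 dvd z - 1 \<or> 3 dvd z + 1" by presburger
        ultimately show ?thesis by (metis dvd_mult dvd_mult2)
      qed
      ultimately have "3 dvd (x ^ 3 - y ^ 3) - (x ^ 3 - x) + (y ^ 3 - y)" by (meson dvd_add dvd_diff)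
      then have "3 dvd x - y" by simp
      then obtain t where t: "x = y + 3 * t" by (metis add.commute diff_add_cancel dvd_def)
      have "(x - y) * (x^2 + x*y + y^2) = (3 * (x - y)) * (y^2 + 3 * (t * y + t^2))"
        unfolding t by (simp add: algebra_simps power2_eq_square)
      then have d: "?p ^ k dvd (3 * (x - y)) * (y^2 + 3 * (t * y + t^2))" using rootD(3)[OF x] by simp
      have "\<not> 3 dvd y^2" using rootD(2)[OF y] True pp by (metis of_nat_numeral prime_dvd_power)
      then have "\<not> 3 dvd y^2 + 3 * (t * y + t^2)" by (simp add: dvd_add_left_iff)
      then have "?p ^ k dvd 3 * (x - y)"
        using prime_power_dvd_of_not_common[OF pp d] p_dvd True by auto
      then have "m dvd x - y" unfolding m by (simp only: dvd_mult_cancel_left) simp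
      then obtain j where j: "x - y = m * j" by (auto simp: dvd_def)
      have "x = (y + m * (j mod 3)) mod ?p ^ k"
      proof (rule mod_eq_of_dvd_diff[OF rootD(1)[OF x]])
        have "x - (y + m * (j mod 3)) = m * (j - j mod 3)" using j by (simp add: algebra_simps)
        also have "\<dots> = 3 * m * (j div 3)" by (simp add: minus_mod_eq_mult_div)
        finally show "?p ^ k dvd x - (y + m * (j mod 3))" unfolding m by simp
      qed
      then show "x \<in> (\<lambda>j. (y + m * j) mod ?p^k) ` {0..<3}" by auto
    qed
    then have "card (cube_roots (p ^ k) c) \<le> card ((\<lambda>j. (y + m * j) mod ?p^k) ` {0..<3::int})"
      by (intro card_mono) auto
    also have "\<dots> \<le> card {0..<3::int}" by (rule card_image_le) simp
    finally show ?thesis by simp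
  qed
qed simp

lemma card_cube_roots_mult_le:
  assumes "coprime m n" "m > 0" "n > 0"
  shows "card (cube_roots (m * n) c) \<le> card (cube_roots m c) * card (cube_roots n c)"
proof -
  let ?f = "\<lambda>x. (x mod int m, x mod int n)"
  have inj: "inj_on ?f (cube_roots (m * n) c)"
  proof (rule inj_onI)
    fix x y assume x: "x \<in> cube_roots (m * n) c" and y: "y \<in> cube_roots (m * n) c" and e: "?f x = ?f y"
    then have "int m dvd x - y" "int n dvd x - y" by (auto simp: mod_eq_dvd_iff)
    moreover have "coprime (int m) (int n)" using assms by simp
    ultimately have "int (m * n) dvd x - y" by (simp add: divides_mult)
    moreover have "x \<in> {0..<int (m * n)}" "y \<in> {0..<int (m * n)}" using x y by (auto simp: cube_roots_def)
    ultimately show "x = y" by (metis mod_eq_of_dvd_diff mod_pos_pos_trivial atLeastLessThan_iff)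
  qed
  have img: "x mod int d \<in> cube_roots d c" if "d > 0" "d dvd m * n" "x \<in> cube_roots (m * n) c" for d x
  proof -
    have d: "int d dvd int (m * n)" using that by presburger
    have "coprime x (int d)" using that d by (auto simp: cube_roots_def intro: coprime_divisors[of x x "int d"] )
    moreover have "int d dvd x ^ 3 - c" using that d by (auto simp: cube_roots_def intro: dvd_trans)
    then have "int d dvd (x mod int d) ^ 3 - c" by (simp add: mod_eq_dvd_iff[symmetric] power_mod)
    ultimately show ?thesis using that by (simp add: cube_roots_def)
  qed
  have "?f ` cube_roots (m * n) c \<subseteq> cube_roots m c \<times> cube_roots n c"
    using img[of m] img[of n] assms by auto
  then have "card (?f ` cube_roots (m * n) c) \<le> card (cube_roots m c \<times> cube_roots n c)"
    by (intro card_mono) auto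
  then show ?thesis using inj by (simp add: card_image card_cartesian_product)
qed

lemma cube_roots_bound:
  assumes "\<epsilon> > 0"
  shows "\<exists>C\<ge>1. \<forall>n>0. \<forall>c. real (card (cube_roots n c)) \<le> C * real n powr \<epsilon>"
proof (rule prime_power_recursion_bound[OF assms])
  fix c :: int
  have "cube_roots 1 c \<subseteq> {0}" by (auto simp: cube_roots_def)
  then have "card (cube_roots 1 c) \<le> card {0::int}" by (intro card_mono) auto
  then show "real (card (cube_roots 1 c)) \<le> 1" by simp
next
  fix p k s :: nat and c :: int
  assume a: "prime p" "k > 0" "s > 0" "\<not> p dvd s"
  have "coprime (p ^ k) s" using a by (simp add: prime_imp_coprime)
  then have "card (cube_roots (p ^ k * s) c) \<le> card (cube_roots (p ^ k) c) * card (cube_roots s c)"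
    using a prime_gt_0_nat by (intro card_cube_roots_mult_le) auto
  also have "\<dots> \<le> (k + 1)\<^sup>2 * card (cube_roots s c)"
  proof (intro mult_right_mono)
    \<comment> \<open>As \<open>k > 0\<close>, the square that the recursion allows is at least 4
      and covers the three roots.\<close>
    have "(2::nat)\<^sup>2 \<le> (k + 1)\<^sup>2" using a by (intro power_mono) auto
    then show "card (cube_roots (p ^ k) c) \<le> (k + 1)\<^sup>2"
      using card_cube_roots_prime_power[OF a(1,2), of c] by simp
  qed simp
  finally have "real (card (cube_roots (p ^ k * s) c)) \<le> real ((k + 1)\<^sup>2 * card (cube_roots s c))"
    using of_nat_le_iff by blast
  then show "\<exists>c'. real (card (cube_roots (p ^ k * s) c)) \<le> (real k + 1)\<^sup>2 * real (card (cube_roots s c'))"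
    by (intro exI[of _ c]) (simp add: algebra_simps)
qed

section \<open>The large sieve with multiplicity\<close>

definition int_dist :: "real \<Rightarrow> real" where
  "int_dist x = \<bar>x - of_int (round x)\<bar>"

lemma int_dist_nonneg [simp]: "int_dist x \<ge> 0"
  by (simp add: int_dist_def)

lemma int_dist_le_half: "int_dist x \<le> 1/2"
  using of_int_round_abs_le[of x] by (simp add: int_dist_def abs_minus_commute)

lemma int_dist_le: "int_dist x \<le> \<bar>x - of_int k\<bar>"
  unfolding int_dist_def by (rule round_diff_minimal)

lemma int_dist_obtain: obtains k :: int where "int_dist x = \<bar>x - of_int k\<bar>"
  by (simp add: int_dist_def)

lemma int_dist_minus [simp]: "int_dist (- x) = int_dist x"
proof -
  have le: "int_dist (- x) \<le> int_dist x" for x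
  proof -
    obtain k where "int_dist x = \<bar>x - of_int k\<bar>" by (rule int_dist_obtain)
    then show ?thesis using int_dist_le[of "- x" "- k"] by simp
  qed
  show ?thesis using le[of x] le[of "- x"] by simp
qed

lemma e_add: "e (x + y) = e x * e y"
  by (simp add: e_def exp_add[symmetric] algebra_simps)

lemma e_0 [simp]: "e 0 = 1"
  by (simp add: e_def)

lemma e_eq_cis: "e x = cis (2 * pi * x)"
  by (simp add: e_def cis_conv_exp mult_ac)

lemma norm_e [simp]: "norm (e x) = 1"
  by (simp add: e_eq_cis)

lemma cnj_e: "cnj (e x) = e (- x)"
  by (simp add: e_eq_cis cis_cnj)

lemma e_of_int [simp]: "e (of_int k) = 1"
  by (simp add: e_eq_cis cis_multiple_2pi)

lemma e_power: "e x ^ n = e (x * real n)"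
  by (induction n) (simp_all add: e_add algebra_simps)

lemma sin_ge_linear:
  assumes "0 \<le> t" "t \<le> 1/2"
  shows "sin (pi * t) \<ge> 2 * t"
proof -
  have "concave_on {0..pi/2} sin"
    by (rule f''_le0_imp_concave[where f' = cos and f'' = "\<lambda>x. - sin x"])
       (auto intro!: derivative_eq_intros sin_ge_zero)
  then have "(1 - 2 * t) * sin 0 + (2 * t) * sin (pi/2) \<le> sin ((1 - 2 * t) *\<^sub>R 0 + (2 * t) *\<^sub>R (pi/2))"
    using assms by (intro concave_onD) auto
  then show ?thesis by (simp add: mult_ac)
qed

text \<open>The left side is \<open>2 * \<bar>sin (pi * x)\<bar>\<close>, and by concavity the sine
  lies above its chord on \<open>[0, pi / 2]\<close>.\<close>

lemma norm_e_diff_1_ge: "norm (e x - 1) \<ge> 4 * int_dist x"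
proof -
  obtain k where k: "int_dist x = \<bar>x - of_int k\<bar>" by (rule int_dist_obtain)
  have "e x = e (x - of_int k)" using e_add[of "x - of_int k" "of_int k"] by simp
  moreover have "norm (e (x - of_int k) - 1) = 2 * \<bar>sin (pi * (x - of_int k))\<bar>"
  proof -
    have "e (x - of_int k) = exp (\<i> * of_real (2 * pi * (x - of_int k)))"
      by (simp add: e_def mult_ac)
    moreover have "2 * pi * (x - of_int k) / 2 = pi * (x - of_int k)" by simp
    ultimately show ?thesis using dist_exp_i_1[of "2 * pi * (x - of_int k)"] by metis
  qed
  moreover have "\<bar>sin (pi * (x - of_int k))\<bar> = \<bar>sin (pi * \<bar>x - of_int k\<bar>)\<bar>"
    using sin_minus[of "pi * (x - of_int k)"]
    by (cases "x - of_int k \<ge> 0") (simp_all add: algebra_simps)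
  moreover have "sin (pi * \<bar>x - of_int k\<bar>) \<ge> 2 * int_dist x"
    using sin_ge_linear[of "int_dist x"] int_dist_le_half[of x] k by simp
  ultimately show ?thesis by simp
qed

text \<open>The product form avoids dividing by a distance that may vanish, and it is the form in
  which \<open>sum_le_by_distance\<close> takes its decay hypothesis.\<close>

lemma norm_geometric_e: "norm (\<Sum>k<n. e (b * real k)) * int_dist b \<le> 1/2"
proof (cases "e b = 1")
  case True
  then have "int_dist b = 0" using norm_e_diff_1_ge[of b] int_dist_nonneg[of b] by simp
  then show ?thesis by simp
next
  case False
  have "(\<Sum>k<n. e (b * real k)) = (\<Sum>k<n. e b ^ k)" by (simp add: e_power)
  also have "\<dots> = (e b ^ n - 1) / (e b - 1)" using False by (rule geometric_sum)
  finally have "norm (\<Sum>k<n. e (b * real k)) * norm (e b - 1) = norm (e b ^ n - 1)"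
    using False by (simp add: norm_divide)
  also have "\<dots> \<le> norm (e b ^ n) + norm (1::complex)" by (rule norm_triangle_ineq4)
  finally have "norm (\<Sum>k<n. e (b * real k)) * norm (e b - 1) \<le> 2" by (simp add: norm_power)
  moreover have "norm (\<Sum>k<n. e (b * real k)) * (4 * int_dist b)
      \<le> norm (\<Sum>k<n. e (b * real k)) * norm (e b - 1)"
    by (intro mult_left_mono norm_e_diff_1_ge) simp
  ultimately show ?thesis by simp
qed

lemma norm_geometric_e_int: "norm (\<Sum>n\<in>{u..v}. e (b * of_int n)) * int_dist b \<le> 1/2"
proof -
  have "{u..v} = (\<lambda>k. u + int k) ` {..<nat (v - u + 1)}"
  proof -
    have "x \<in> (\<lambda>k. u + int k) ` {..<nat (v - u + 1)}" if "x \<in> {u..v}" for x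
      using that by (intro image_eqI[of _ _ "nat (x - u)"]) auto
    then show ?thesis by auto
  qed
  then have "(\<Sum>n\<in>{u..v}. e (b * of_int n)) = (\<Sum>k<nat (v - u + 1). e (b * of_int (u + int k)))"
    by (simp add: sum.reindex inj_on_def)
  also have "\<dots> = e (b * of_int u) * (\<Sum>k<nat (v - u + 1). e (b * real k))"
    by (simp add: sum_distrib_left e_add[symmetric] algebra_simps)
  finally show ?thesis using norm_geometric_e[of b] by (simp add: norm_mult)
qed

text \<open>The hypothesis \<open>F x * d x ^ p \<le> A\<close> encodes \<open>F x \<le> A / d x ^ p\<close> without
  committing to a value at \<open>d x = 0\<close>.\<close>

lemma sum_le_by_distance:
  fixes F d :: "'a \<Rightarrow> real"
  assumes fin: "finite X" and \<delta>: "\<delta> > 0"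
    and d: "\<And>x. x \<in> X \<Longrightarrow> 0 \<le> d x \<and> d x \<le> 1/2"
    and card: "\<And>k::nat. real (card {x\<in>X. real k * \<delta> \<le> d x \<and> d x < (real k + 1) * \<delta>}) \<le> C"
    and L: "\<And>x. x \<in> X \<Longrightarrow> F x \<le> L" "L \<ge> 0"
    and A: "\<And>x. x \<in> X \<Longrightarrow> F x * d x ^ p \<le> A" "A \<ge> 0"
  shows "sum F X \<le> C * (L + A / \<delta> ^ p * (\<Sum>k=1..nat \<lfloor>1 / \<delta>\<rfloor>. 1 / real k ^ p))"
proof -
  define K where "K = nat \<lfloor>1 / \<delta>\<rfloor>"
  define g where "g x = nat \<lfloor>d x / \<delta>\<rfloor>" for x
  \<comment> \<open>Points are grouped into shells of width \<open>\<delta>\<close>. The innermost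
    shell gets the trivial bound \<open>L\<close>; in shell \<open>k\<close> the distance is at
    least \<open>k * \<delta>\<close>. Distances at most 1/2 leave only shells up to
    \<open>1 / \<delta>\<close>.\<close>
  define B where "B k = (if k = 0 then L else A / \<delta> ^ p * (1 / real k ^ p))" for k
  have B0: "B k \<ge> 0" for k using L A \<delta> by (simp add: B_def)
  have g: "real (g x) * \<delta> \<le> d x \<and> d x < (real (g x) + 1) * \<delta>" if "x \<in> X" for x
  proof -
    have "real (g x) = of_int \<lfloor>d x / \<delta>\<rfloor>" using d[OF that] \<delta> by (simp add: g_def)
    then have "real (g x) \<le> d x / \<delta>" "d x / \<delta> < real (g x) + 1" by linarith+
    then show ?thesis using \<delta> by (simp add: field_simps)
  qed
  have gK: "g ` X \<subseteq> {0..K}"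
  proof
    fix k assume "k \<in> g ` X"
    then obtain x where x: "x \<in> X" "k = g x" by blast
    have "d x / \<delta> \<le> 1 / \<delta>" using d[OF x(1)] \<delta> by (intro divide_right_mono) auto
    then show "k \<in> {0..K}" unfolding x g_def K_def by (simp add: floor_mono nat_mono)
  qed
  have FB: "F x \<le> B (g x)" if "x \<in> X" for x
  proof (cases "g x = 0")
    case False
    have p0: "(real (g x) * \<delta>) ^ p > 0" using False \<delta> by simp
    have le: "(real (g x) * \<delta>) ^ p \<le> d x ^ p" using g[OF that] \<delta> by (intro power_mono) auto
    have "F x * (real (g x) * \<delta>) ^ p \<le> A"
    proof (cases "F x \<ge> 0")
      case True
      then show ?thesis using mult_left_mono[OF le True] A(1)[OF that] by linarith
    next
      case False
      then have "F x * (real (g x) * \<delta>) ^ p \<le> 0" using p0 by (simp add: mult_nonpos_nonneg)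
      then show ?thesis using A(2) by linarith
    qed
    then have "F x \<le> A / (real (g x) * \<delta>) ^ p" using p0 by (simp add: le_divide_eq)
    then show ?thesis using False by (simp add: B_def power_mult_distrib mult_ac)
  qed (use L that in \<open>simp add: B_def\<close>)
  have "sum F X = (\<Sum>k\<in>{0..K}. sum F {x. x \<in> X \<and> g x = k})"
    using sum.group[OF fin _ gK, of F] by simp
  also have "\<dots> \<le> (\<Sum>k\<in>{0..K}. C * B k)"
  proof (rule sum_mono)
    fix k assume "k \<in> {0..K}"
    have "sum F {x. x \<in> X \<and> g x = k} \<le> real (card {x. x \<in> X \<and> g x = k}) * B k"
      using FB by (intro sum_bounded_above) auto
    also have "\<dots> \<le> C * B k"
    proof (rule mult_right_mono[OF _ B0])
      have "card {x. x \<in> X \<and> g x = k} \<le> card {x\<in>X. real k * \<delta> \<le> d x \<and> d x < (real k + 1) * \<delta>}"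
        using g fin by (intro card_mono) auto
      then show "real (card {x. x \<in> X \<and> g x = k}) \<le> C" using card[of k] by linarith
    qed
    finally show "sum F {x. x \<in> X \<and> g x = k} \<le> C * B k" .
  qed
  also have "\<dots> = C * (B 0 + (\<Sum>k=1..K. B k))"
    by (simp add: sum_distrib_left[symmetric] sum.atLeast_Suc_atMost)
  also have "(\<Sum>k=1..K. B k) = A / \<delta> ^ p * (\<Sum>k=1..K. 1 / real k ^ p)"
    unfolding sum_distrib_left by (rule sum.cong) (auto simp: B_def)
  finally show ?thesis by (simp add: B_def K_def)
qed

section \<open>Row sums, the dual inequality and the sieve itself\<close>

lemma sum_inverse_squares_le: "(\<Sum>k=1..n. 1 / real k ^ 2) \<le> 2"
proof -
  have "(\<Sum>k=1..n. 1 / real k ^ 2) \<le> 2 - 1 / real n" if "n > 0" for n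
    using that
  proof (induction n rule: nat_induct_non_zero)
    case (Suc n)
    have "1 / real (Suc n) ^ 2 \<le> 1 / real n - 1 / real (Suc n)"
    proof -
      have "1 / real (Suc n) ^ 2 \<le> 1 / (real n * real (Suc n))"
        using Suc.hyps by (intro frac_le) (auto simp: power2_eq_square)
      also have "\<dots> = 1 / real n - 1 / real (Suc n)" using Suc.hyps by (simp add: field_simps)
      finally show ?thesis .
    qed
    then show ?case using Suc.IH by simp
  qed simp
  then have "(\<Sum>k=1..n. 1 / real k ^ 2) \<le> 2 - 1 / real n" if "n > 0" using that .
  moreover have "2 - 1 / real n \<le> 2" by simp
  ultimately show ?thesis by (cases "n = 0") (simp, linarith)
qed

lemma sum_inverses_le:
  assumes "n > 0"
  shows "(\<Sum>k=1..n. 1 / real k) \<le> 1 + ln (real n)"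
  using assms
proof (induction n rule: nat_induct_non_zero)
  case (Suc n)
  have "ln (real n / real (Suc n)) \<le> real n / real (Suc n) - 1"
    using Suc.hyps by (intro ln_le_minus_one) auto
  also have "\<dots> = - 1 / real (Suc n)" by (simp add: field_simps)
  finally have "1 / real (Suc n) \<le> ln (real (Suc n)) - ln (real n)"
    using Suc.hyps by (simp add: ln_div)
  then show ?case using Suc.IH by simp
qed simp

text \<open>Modulo 1 a shell around \<open>\<beta>\<close> has one arc on each side, and these lie
  within \<open>\<delta>\<close> of \<open>\<beta> + t\<close> and of \<open>\<beta> - t\<close>.
  This is why \<open>K\<close> must be uniform in the centre, and where the factor 2 comes
  from.\<close>

lemma card_distance_annulus_le:
  assumes fin: "finite X" and K: "\<And>\<beta>. card {i\<in>X. int_dist (\<theta> i - \<beta>) \<le> \<delta>} \<le> K"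
  shows "card {i\<in>X. t \<le> int_dist (\<theta> i - \<beta>) \<and> int_dist (\<theta> i - \<beta>) < t + \<delta>} \<le> 2 * K"
proof -
  let ?A = "{i\<in>X. t \<le> int_dist (\<theta> i - \<beta>) \<and> int_dist (\<theta> i - \<beta>) < t + \<delta>}"
  let ?B = "\<lambda>\<gamma>. {i\<in>X. int_dist (\<theta> i - \<gamma>) \<le> \<delta>}"
  have "?A \<subseteq> ?B (\<beta> + t) \<union> ?B (\<beta> - t)"
  proof
    fix i assume i: "i \<in> ?A"
    obtain k where k: "int_dist (\<theta> i - \<beta>) = \<bar>\<theta> i - \<beta> - of_int k\<bar>" by (rule int_dist_obtain)
    have "\<bar>\<theta> i - (\<beta> + t) - of_int k\<bar> \<le> \<delta> \<or> \<bar>\<theta> i - (\<beta> - t) - of_int k\<bar> \<le> \<delta>"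
      using i k by auto
    then show "i \<in> ?B (\<beta> + t) \<union> ?B (\<beta> - t)" using i int_dist_le order_trans by blast
  qed
  then have "card ?A \<le> card (?B (\<beta> + t) \<union> ?B (\<beta> - t))" using fin by (intro card_mono) auto
  also have "\<dots> \<le> card (?B (\<beta> + t)) + card (?B (\<beta> - t))" by (rule card_Un_le)
  finally show ?thesis using K[of "\<beta> + t"] K[of "\<beta> - t"] by linarith
qed

text \<open>Schur's test: \<open>2 * c i * c j \<le> (c i)\<^sup>2 + (c j)\<^sup>2\<close> splits
  the form into two halves that agree by symmetry of \<open>g\<close>.\<close>

lemma sum_products_le_diagonal:
  fixes g :: "'a \<Rightarrow> 'a \<Rightarrow> real" and c :: "'a \<Rightarrow> real"
  assumes sym: "\<And>i j. g i j = g j i" and g0: "\<And>i j. g i j \<ge> 0"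
    and R: "\<And>i. i \<in> X \<Longrightarrow> (\<Sum>j\<in>X. g i j) \<le> R"
  shows "(\<Sum>i\<in>X. \<Sum>j\<in>X. c i * c j * g i j) \<le> R * (\<Sum>i\<in>X. (c i)\<^sup>2)"
proof -
  have "(\<Sum>i\<in>X. \<Sum>j\<in>X. c i * c j * g i j) \<le> (\<Sum>i\<in>X. \<Sum>j\<in>X. ((c i)\<^sup>2 * g i j + (c j)\<^sup>2 * g i j) / 2)"
  proof (intro sum_mono)
    fix i j
    have "c i * c j \<le> ((c i)\<^sup>2 + (c j)\<^sup>2) / 2" using sum_squares_bound[of "c i" "c j"] by simp
    then have "c i * c j * g i j \<le> ((c i)\<^sup>2 + (c j)\<^sup>2) / 2 * g i j" using g0 by (rule mult_right_mono)
    then show "c i * c j * g i j \<le> ((c i)\<^sup>2 * g i j + (c j)\<^sup>2 * g i j) / 2" by (simp add: algebra_simps add_divide_distrib)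
  qed
  also have "\<dots> = ((\<Sum>i\<in>X. \<Sum>j\<in>X. (c i)\<^sup>2 * g i j) + (\<Sum>i\<in>X. \<Sum>j\<in>X. (c j)\<^sup>2 * g i j)) / 2"
    by (simp add: sum.distrib sum_divide_distrib[symmetric])
  also have "(\<Sum>i\<in>X. \<Sum>j\<in>X. (c j)\<^sup>2 * g i j) = (\<Sum>i\<in>X. \<Sum>j\<in>X. (c i)\<^sup>2 * g i j)"
    by (subst sum.swap) (simp add: sym)
  also have "((\<Sum>i\<in>X. \<Sum>j\<in>X. (c i)\<^sup>2 * g i j) + (\<Sum>i\<in>X. \<Sum>j\<in>X. (c i)\<^sup>2 * g i j)) / 2
      = (\<Sum>i\<in>X. (c i)\<^sup>2 * (\<Sum>j\<in>X. g i j))"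
    by (simp add: sum_distrib_left[symmetric])
  also have "\<dots> \<le> (\<Sum>i\<in>X. (c i)\<^sup>2 * R)"
    using R by (intro sum_mono mult_left_mono) auto
  finally show ?thesis by (simp add: sum_distrib_left mult.commute)
qed

text \<open>Each of the \<open>N\<close> integers \<open>n\<close> on the left has at least \<open>N\<close> representations
  \<open>n = M + k - l\<close>.\<close>

lemma sum_le_Fejer_weighted:
  fixes G :: "int \<Rightarrow> real"
  assumes "\<And>n. G n \<ge> 0"
  shows "real N * (\<Sum>n=M+1..M+int N. G n) \<le> (\<Sum>k<2*N. \<Sum>l<2*N. G (M + int k - int l))"
proof -
  have "real N * (\<Sum>n=M+1..M+int N. G n) = (\<Sum>(n,l)\<in>{M+1..M+int N} \<times> {..<N}. G n)"
    by (simp add: sum.cartesian_product[symmetric] sum_distrib_left)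
  also have "\<dots> = (\<Sum>(k,l)\<in>(\<lambda>(n,l). (nat (n - M) + l, l)) ` ({M+1..M+int N} \<times> {..<N}). G (M + int k - int l))"
    by (subst sum.reindex) (auto simp: inj_on_def intro!: sum.cong)
  also have "\<dots> \<le> (\<Sum>(k,l)\<in>{..<2*N} \<times> {..<2*N}. G (M + int k - int l))"
    by (rule sum_mono2) (auto simp: assms)
  finally show ?thesis by (simp add: sum.cartesian_product)
qed

lemma sum_swap_pairs:
  "(\<Sum>k\<in>A. \<Sum>l\<in>B. \<Sum>i\<in>X. \<Sum>j\<in>Y. f k l i j) = (\<Sum>i\<in>X. \<Sum>j\<in>Y. \<Sum>k\<in>A. \<Sum>l\<in>B. f k l i j)"
proof -
  have "(\<Sum>k\<in>A. \<Sum>l\<in>B. \<Sum>i\<in>X. \<Sum>j\<in>Y. f k l i j) = (\<Sum>k\<in>A. \<Sum>i\<in>X. \<Sum>l\<in>B. \<Sum>j\<in>Y. f k l i j)"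
    by (intro sum.cong refl sum.swap)
  also have "\<dots> = (\<Sum>i\<in>X. \<Sum>k\<in>A. \<Sum>l\<in>B. \<Sum>j\<in>Y. f k l i j)" by (rule sum.swap)
  also have "\<dots> = (\<Sum>i\<in>X. \<Sum>k\<in>A. \<Sum>j\<in>Y. \<Sum>l\<in>B. f k l i j)" by (intro sum.cong refl sum.swap)
  also have "\<dots> = (\<Sum>i\<in>X. \<Sum>j\<in>Y. \<Sum>k\<in>A. \<Sum>l\<in>B. f k l i j)" by (intro sum.cong refl sum.swap)
  finally show ?thesis .
qed

text \<open>With the Fejer weights the left side becomes a Hermitian form whose coefficients have
  modulus \<open>(norm (D (\<theta> i - \<theta> j)))\<^sup>2\<close>. Such squares decay
  quadratically in the distance, so the row sums converge without the logarithm that a sharp cutoff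
  would bring.\<close>

lemma dual_large_sieve:
  fixes \<theta> :: "'a \<Rightarrow> real" and c :: "'a \<Rightarrow> complex"
  assumes fin: "finite X" and N: "N > 0"
    and K: "\<And>\<beta>. card {i\<in>X. int_dist (\<theta> i - \<beta>) \<le> 1 / real N} \<le> K"
  shows "(\<Sum>n=M+1..M+int N. (norm (\<Sum>i\<in>X. c i * e (\<theta> i * of_int n)))\<^sup>2)
    \<le> 9 * real K * real N * (\<Sum>i\<in>X. (norm (c i))\<^sup>2)"
proof -
  define D where "D b = (\<Sum>k<2*N. e (b * real k))" for b
  define B where "B n = (\<Sum>i\<in>X. c i * e (\<theta> i * of_int n))" for n :: int
  have Dcnj: "(\<Sum>l<2*N. e (- (b * real l))) = cnj (D b)" for b
    by (simp add: D_def cnj_e)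
  have DD: "(norm (D b))\<^sup>2 \<le> (2 * real N)\<^sup>2" "(norm (D b))\<^sup>2 * (int_dist b)\<^sup>2 \<le> 1/4" for b
  proof -
    have "norm (D b) \<le> (\<Sum>k<2*N. norm (e (b * real k)))" unfolding D_def by (rule norm_sum)
    then show "(norm (D b))\<^sup>2 \<le> (2 * real N)\<^sup>2" by (intro power_mono) auto
    have "(norm (D b) * int_dist b)\<^sup>2 \<le> (1/2)\<^sup>2"
      using norm_geometric_e[of b "2*N"] by (intro power_mono) (auto simp: D_def)
    then show "(norm (D b))\<^sup>2 * (int_dist b)\<^sup>2 \<le> 1/4" by (simp add: power2_eq_square mult_ac)
  qed
  have row: "(\<Sum>j\<in>X. (norm (D (\<theta> i - \<theta> j)))\<^sup>2) \<le> 9 * real K * (real N)\<^sup>2" for i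
  proof -
    have sw: "int_dist (\<theta> i - \<theta> j) = int_dist (\<theta> j - \<theta> i)" for j
      using int_dist_minus[of "\<theta> j - \<theta> i"] by simp
    \<comment> \<open>Each shell of width \<open>1 / N\<close> holds at most \<open>2 * K\<close>
      points. The innermost contributes \<open>4 * N\<^sup>2\<close> per point, the others together
      \<open>(1/4) * N\<^sup>2 * 2\<close>; this makes
      \<open>2 * K * (9/2) * N\<^sup>2\<close>.\<close>
    have "(\<Sum>j\<in>X. (norm (D (\<theta> i - \<theta> j)))\<^sup>2)
      \<le> (2 * real K) * ((2 * real N)\<^sup>2 + (1/4) / (1 / real N) ^ 2 * (\<Sum>k=1..nat \<lfloor>1 / (1 / real N)\<rfloor>. 1 / real k ^ 2))"
    proof (rule sum_le_by_distance[OF fin, where d = "\<lambda>j. int_dist (\<theta> i - \<theta> j)"])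
      show "real (card {j \<in> X. real k * (1 / real N) \<le> int_dist (\<theta> i - \<theta> j)
          \<and> int_dist (\<theta> i - \<theta> j) < (real k + 1) * (1 / real N)}) \<le> 2 * real K" for k :: nat
      proof -
        have "real k * (1 / real N) = real k / real N" "(real k + 1) * (1 / real N) = real k / real N + 1 / real N"
          by (simp_all add: add_divide_distrib)
        then show ?thesis
          using of_nat_mono[OF card_distance_annulus_le[OF fin K, of "real k / real N" "\<theta> i"], where 'a = real]
          unfolding sw by simp
      qed
    qed (use N DD int_dist_le_half in auto)
    also have "\<dots> \<le> (2 * real K) * ((2 * real N)\<^sup>2 + (1/4) / (1 / real N) ^ 2 * 2)"
      by (intro mult_left_mono add_left_mono sum_inverse_squares_le) auto
    also have "\<dots> = 9 * real K * (real N)\<^sup>2"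
      using N by (simp add: field_simps power2_eq_square)
    finally show ?thesis .
  qed
  have sq: "complex_of_real ((norm (B n))\<^sup>2)
      = (\<Sum>i\<in>X. \<Sum>j\<in>X. c i * cnj (c j) * e ((\<theta> i - \<theta> j) * of_int n))" for n
  proof -
    have "complex_of_real ((norm (B n))\<^sup>2) = B n * cnj (B n)" by (rule complex_norm_square)
    also have "\<dots> = (\<Sum>i\<in>X. \<Sum>j\<in>X. (c i * e (\<theta> i * of_int n)) * (cnj (c j) * e (- (\<theta> j * of_int n))))"
      by (simp add: B_def sum_product cnj_e)
    also have "\<dots> = (\<Sum>i\<in>X. \<Sum>j\<in>X. c i * cnj (c j) * e ((\<theta> i - \<theta> j) * of_int n))"
      by (intro sum.cong) (simp_all add: mult_ac e_add[symmetric] algebra_simps)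
    finally show ?thesis .
  qed
  have "complex_of_real (\<Sum>k<2*N. \<Sum>l<2*N. (norm (B (M + int k - int l)))\<^sup>2)
    = (\<Sum>k<2*N. \<Sum>l<2*N. \<Sum>i\<in>X. \<Sum>j\<in>X. c i * cnj (c j) * e ((\<theta> i - \<theta> j) * of_int (M + int k - int l)))"
    by (simp only: of_real_sum sq)
  also have "\<dots> = (\<Sum>i\<in>X. \<Sum>j\<in>X. \<Sum>k<2*N. \<Sum>l<2*N. c i * cnj (c j) * e ((\<theta> i - \<theta> j) * of_int (M + int k - int l)))"
    by (rule sum_swap_pairs)
  also have "\<dots> = (\<Sum>i\<in>X. \<Sum>j\<in>X. c i * cnj (c j) * e ((\<theta> i - \<theta> j) * of_int M) * (D (\<theta> i - \<theta> j) * cnj (D (\<theta> i - \<theta> j))))"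
  proof (intro sum.cong refl)
    fix i j
    have "(\<Sum>k<2*N. \<Sum>l<2*N. c i * cnj (c j) * e ((\<theta> i - \<theta> j) * of_int (M + int k - int l)))
      = (\<Sum>k<2*N. \<Sum>l<2*N. c i * cnj (c j) * e ((\<theta> i - \<theta> j) * of_int M) * (e ((\<theta> i - \<theta> j) * real k) * e (- ((\<theta> i - \<theta> j) * real l))))"
      by (intro sum.cong refl) (simp add: mult_ac e_add[symmetric] algebra_simps)
    also have "\<dots> = c i * cnj (c j) * e ((\<theta> i - \<theta> j) * of_int M) * (D (\<theta> i - \<theta> j) * cnj (D (\<theta> i - \<theta> j)))"
      unfolding Dcnj[symmetric] unfolding D_def sum_product by (simp add: sum_distrib_left)
    finally show "(\<Sum>k<2*N. \<Sum>l<2*N. c i * cnj (c j) * e ((\<theta> i - \<theta> j) * of_int (M + int k - int l)))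
      = c i * cnj (c j) * e ((\<theta> i - \<theta> j) * of_int M) * (D (\<theta> i - \<theta> j) * cnj (D (\<theta> i - \<theta> j)))" .
  qed
  finally have main: "complex_of_real (\<Sum>k<2*N. \<Sum>l<2*N. (norm (B (M + int k - int l)))\<^sup>2)
    = (\<Sum>i\<in>X. \<Sum>j\<in>X. c i * cnj (c j) * e ((\<theta> i - \<theta> j) * of_int M) * (D (\<theta> i - \<theta> j) * cnj (D (\<theta> i - \<theta> j))))" .
  have nn: "(\<Sum>k<2*N. \<Sum>l<2*N. (norm (B (M + int k - int l)))\<^sup>2) \<ge> 0" by (intro sum_nonneg) auto
  have "(\<Sum>k<2*N. \<Sum>l<2*N. (norm (B (M + int k - int l)))\<^sup>2)
    = norm (complex_of_real (\<Sum>k<2*N. \<Sum>l<2*N. (norm (B (M + int k - int l)))\<^sup>2))"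
    using nn by (simp only: norm_of_real abs_of_nonneg)
  also have "\<dots> \<le> (\<Sum>i\<in>X. \<Sum>j\<in>X. norm (c i) * norm (c j) * (norm (D (\<theta> i - \<theta> j)))\<^sup>2)"
    unfolding main by (intro sum_norm_le) (simp add: norm_mult power2_eq_square)
  also have "\<dots> \<le> 9 * real K * (real N)\<^sup>2 * (\<Sum>i\<in>X. (norm (c i))\<^sup>2)"
  proof (rule sum_products_le_diagonal)
    show "(norm (D (\<theta> i - \<theta> j)))\<^sup>2 = (norm (D (\<theta> j - \<theta> i)))\<^sup>2" for i j
    proof -
      have "D (\<theta> j - \<theta> i) = cnj (D (\<theta> i - \<theta> j))" unfolding D_def by (simp add: cnj_e algebra_simps)
      then show ?thesis by simp
    qed
  qed (use row in auto)
  finally have "real N * (\<Sum>n=M+1..M+int N. (norm (B n))\<^sup>2) \<le> 9 * real K * (real N)\<^sup>2 * (\<Sum>i\<in>X. (norm (c i))\<^sup>2)"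
    using sum_le_Fejer_weighted[of "\<lambda>n. (norm (B n))\<^sup>2" N M] by simp
  then have "real N * (\<Sum>n=M+1..M+int N. (norm (B n))\<^sup>2) \<le> real N * (9 * real K * real N * (\<Sum>i\<in>X. (norm (c i))\<^sup>2))"
    by (simp add: power2_eq_square mult_ac)
  then show ?thesis using N unfolding B_def by (simp only: mult_le_cancel_left_pos of_nat_0_less_iff)
qed

text \<open>Duality: with the conjugates of the sums \<open>S i\<close> themselves as coefficients,
  the left side \<open>T\<close> is a pairing of \<open>a\<close> with the dual sum
  \<open>B\<close>. Cauchy-Schwarz and the dual inequality give
  \<open>T\<^sup>2 \<le> 9 * K * N * Z * T\<close>, from which \<open>T\<close> cancels.\<close>

lemma large_sieve:
  fixes \<theta> :: "'a \<Rightarrow> real" and a :: "int \<Rightarrow> complex"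
  assumes fin: "finite X" and N: "N > 0"
    and K: "\<And>\<beta>. card {i\<in>X. int_dist (\<theta> i - \<beta>) \<le> 1 / real N} \<le> K"
  shows "(\<Sum>i\<in>X. (norm (\<Sum>n=M+1..M+int N. a n * e (\<theta> i * of_int n)))\<^sup>2)
    \<le> 9 * real K * real N * (\<Sum>n=M+1..M+int N. (norm (a n))\<^sup>2)"
proof -
  define S where "S i = (\<Sum>n=M+1..M+int N. a n * e (\<theta> i * of_int n))" for i
  define T where "T = (\<Sum>i\<in>X. (norm (S i))\<^sup>2)"
  define B where "B n = (\<Sum>i\<in>X. cnj (S i) * e (\<theta> i * of_int n))" for n :: int
  define Z where "Z = (\<Sum>n=M+1..M+int N. (norm (a n))\<^sup>2)"
  have T0: "T \<ge> 0" by (auto simp: T_def intro: sum_nonneg)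
  have "complex_of_real T = (\<Sum>i\<in>X. cnj (S i) * S i)"
    by (simp add: T_def complex_norm_square mult.commute del: of_real_power)
  also have "\<dots> = (\<Sum>i\<in>X. \<Sum>n=M+1..M+int N. cnj (S i) * (a n * e (\<theta> i * of_int n)))"
    by (subst (2) S_def) (simp add: sum_distrib_left)
  also have "\<dots> = (\<Sum>n=M+1..M+int N. \<Sum>i\<in>X. cnj (S i) * (a n * e (\<theta> i * of_int n)))"
    by (rule sum.swap)
  also have "\<dots> = (\<Sum>n=M+1..M+int N. a n * B n)"
    by (simp add: B_def sum_distrib_left mult_ac)
  finally have "T = norm (\<Sum>n=M+1..M+int N. a n * B n)" using T0 by (metis norm_of_real abs_of_nonneg)
  also have "\<dots> \<le> (\<Sum>n=M+1..M+int N. norm (a n) * norm (B n))"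
    by (intro sum_norm_le) (simp add: norm_mult)
  finally have "T\<^sup>2 \<le> (\<Sum>n=M+1..M+int N. norm (a n) * norm (B n))\<^sup>2" using T0 by (intro power_mono) auto
  also have "\<dots> \<le> Z * (\<Sum>n=M+1..M+int N. (norm (B n))\<^sup>2)"
    unfolding Z_def by (rule Cauchy_Schwarz_ineq_sum)
  also have "\<dots> \<le> Z * (9 * real K * real N * T)"
  proof (rule mult_left_mono)
    show "(\<Sum>n=M+1..M+int N. (norm (B n))\<^sup>2) \<le> 9 * real K * real N * T"
      using dual_large_sieve[OF fin N K, where c = "\<lambda>i. cnj (S i)" and M = M] by (simp add: B_def T_def)
  qed (auto simp: Z_def intro: sum_nonneg)
  finally have "T * T \<le> (9 * real K * real N * Z) * T" by (simp add: power2_eq_square mult_ac)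
  moreover have "9 * real K * real N * Z \<ge> 0" by (auto simp: Z_def intro!: sum_nonneg mult_nonneg_nonneg)
  ultimately have "T \<le> 9 * real K * real N * Z"
    using T0 by (cases "T = 0") (auto simp: mult_le_cancel_right)
  then show ?thesis by (simp add: T_def S_def Z_def)
qed

section \<open>Cubic Weyl sums and the minor arcs\<close>

lemma Weyl_differencing:
  fixes f :: "int \<Rightarrow> complex"
  assumes "b - a \<le> L"
  shows "(norm (\<Sum>x\<in>{a..b}. f x))\<^sup>2 \<le>
    (\<Sum>d\<in>{-L..L}. norm (\<Sum>x\<in>{max a (a - d)..min b (b - d)}. f (x + d) * cnj (f x)))"
proof -
  have "complex_of_real ((norm (\<Sum>x\<in>{a..b}. f x))\<^sup>2) = (\<Sum>y\<in>{a..b}. f y) * cnj (\<Sum>x\<in>{a..b}. f x)"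
    by (rule complex_norm_square)
  also have "\<dots> = (\<Sum>y\<in>{a..b}. \<Sum>x\<in>{a..b}. f y * cnj (f x))"
    by (simp add: sum_product)
  also have "\<dots> = (\<Sum>(y,x)\<in>{a..b} \<times> {a..b}. f y * cnj (f x))"
    by (simp add: sum.cartesian_product)
  also have "{a..b} \<times> {a..b} = (\<lambda>(d,x). (x + d, x)) ` (SIGMA d:{-L..L}. {max a (a - d)..min b (b - d)})"
  proof -
    have "(y, x) \<in> (\<lambda>(d,x). (x + d, x)) ` (SIGMA d:{-L..L}. {max a (a - d)..min b (b - d)})"
      if "y \<in> {a..b}" "x \<in> {a..b}" for x y
      using that assms by (intro image_eqI[of _ _ "(y - x, x)"]) auto
    then show ?thesis by auto
  qed
  also have "(\<Sum>(y,x)\<in>\<dots>. f y * cnj (f x))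
    = (\<Sum>(d,x)\<in>(SIGMA d:{-L..L}. {max a (a - d)..min b (b - d)}). f (x + d) * cnj (f x))"
    by (subst sum.reindex) (auto simp: inj_on_def intro!: sum.cong)
  also have "\<dots> = (\<Sum>d\<in>{-L..L}. \<Sum>x\<in>{max a (a - d)..min b (b - d)}. f (x + d) * cnj (f x))"
    by (rule sum.Sigma[symmetric]) auto
  finally have eq: "complex_of_real ((norm (\<Sum>x\<in>{a..b}. f x))\<^sup>2)
      = (\<Sum>d\<in>{-L..L}. \<Sum>x\<in>{max a (a - d)..min b (b - d)}. f (x + d) * cnj (f x))" .
  have "(norm (\<Sum>x\<in>{a..b}. f x))\<^sup>2 = norm (complex_of_real ((norm (\<Sum>x\<in>{a..b}. f x))\<^sup>2))"
    by (simp only: norm_of_real) simp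
  also have "\<dots> \<le> (\<Sum>d\<in>{-L..L}. norm (\<Sum>x\<in>{max a (a - d)..min b (b - d)}. f (x + d) * cnj (f x)))"
    unfolding eq by (rule norm_sum)
  finally show ?thesis .
qed

text \<open>The usual minimum of \<open>Q\<close> and \<open>1 / (2 * int_dist b)\<close>. The case
  split is essential: at an integer \<open>b\<close> division by zero would turn the minimum into 0
  instead of \<open>Q\<close>.\<close>

definition linear_sum_bound :: "nat \<Rightarrow> real \<Rightarrow> real" where
  "linear_sum_bound Q b = (if int_dist b = 0 then real Q else min (real Q) (1 / (2 * int_dist b)))"

lemma linear_sum_bound_nonneg: "linear_sum_bound Q b \<ge> 0"
  by (simp add: linear_sum_bound_def)

lemma linear_sum_bound_le: "linear_sum_bound Q b \<le> real Q"
  by (simp add: linear_sum_bound_def)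

lemma linear_sum_bound_mult_le: "linear_sum_bound Q b * int_dist b \<le> 1/2"
proof (cases "int_dist b = 0")
  case False
  then have p: "int_dist b > 0" using int_dist_nonneg[of b] by linarith
  have "linear_sum_bound Q b * int_dist b \<le> (1 / (2 * int_dist b)) * int_dist b"
    using p by (intro mult_right_mono) (auto simp: linear_sum_bound_def)
  also have "\<dots> = 1/2" using p by simp
  finally show ?thesis .
qed simp

lemma linear_sum_bound_abs: "linear_sum_bound Q (a * of_int n) = linear_sum_bound Q (a * real (nat \<bar>n\<bar>))"
proof (cases "n \<ge> 0")
  case False
  then have "a * of_int n = - (a * real (nat \<bar>n\<bar>))" by simp
  then show ?thesis by (simp only: linear_sum_bound_def int_dist_minus)
qed simp

lemma norm_linear_sum_le:
  fixes b :: real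
  assumes "v - u < int Q"
  shows "norm (\<Sum>x\<in>{u..v}. e (b * of_int x)) \<le> linear_sum_bound Q b"
proof -
  let ?s = "norm (\<Sum>x\<in>{u..v}. e (b * of_int x))"
  have "?s \<le> (\<Sum>x\<in>{u..v}. norm (e (b * of_int x)))" by (rule norm_sum)
  then have "?s \<le> real (nat (v - u + 1))" by simp
  then have 1: "?s \<le> real Q" using assms by linarith
  have 2: "?s \<le> 1 / (2 * int_dist b)" if "int_dist b \<noteq> 0"
  proof -
    have "int_dist b > 0" using that int_dist_nonneg[of b] by linarith
    then show ?thesis using norm_geometric_e_int[where b = b and u = u and v = v] by (simp add: field_simps)
  qed
  show ?thesis using 1 2 by (simp add: linear_sum_bound_def)
qed

text \<open>Two differencing steps reduce the cubic phase to a linear one in \<open>x\<close>, of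
  slope \<open>6 * u * v\<close>. The Cauchy-Schwarz inequality between them, over the
  \<open>2 * Q + 1\<close> shifts \<open>u\<close>, gives the leading factor.\<close>

lemma Weyl_cubic_inequality:
  "norm (\<Sum>x\<in>{1..int Q}. e (\<alpha> * of_int (x ^ 3))) ^ 4
    \<le> (2 * real Q + 1) * (\<Sum>u\<in>{- int Q..int Q}. \<Sum>v\<in>{- int Q..int Q}. linear_sum_bound Q (\<alpha> * of_int (6 * u * v)))"
proof -
  define I where "I u = {max 1 (1 - u)..min (int Q) (int Q - u)}" for u :: int
  define T where "T u = (\<Sum>x\<in>I u. e (\<alpha> * of_int ((x + u) ^ 3 - x ^ 3)))" for u
  define S where "S = (\<Sum>x\<in>{1..int Q}. e (\<alpha> * of_int (x ^ 3)))"
  have "(norm S)\<^sup>2 \<le> (\<Sum>u\<in>{- int Q..int Q}. norm (\<Sum>x\<in>I u. e (\<alpha> * of_int ((x + u) ^ 3)) * cnj (e (\<alpha> * of_int (x ^ 3)))))"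
    unfolding S_def I_def by (rule Weyl_differencing) simp
  also have "\<dots> = (\<Sum>u\<in>{- int Q..int Q}. norm (T u))"
    unfolding T_def by (intro sum.cong refl arg_cong[where f = norm])
      (simp add: cnj_e e_add[symmetric] algebra_simps)
  finally have S2: "(norm S)\<^sup>2 \<le> (\<Sum>u\<in>{- int Q..int Q}. norm (T u))" .
  have T2: "(norm (T u))\<^sup>2 \<le> (\<Sum>v\<in>{- int Q..int Q}. linear_sum_bound Q (\<alpha> * of_int (6 * u * v)))" for u
  proof -
    define J where "J v = {max (max 1 (1 - u)) (max 1 (1 - u) - v)..min (min (int Q) (int Q - u)) (min (int Q) (int Q - u) - v)}" for v
    have "(norm (T u))\<^sup>2 \<le> (\<Sum>v\<in>{- int Q..int Q}. norm (\<Sum>x\<in>J v.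
        e (\<alpha> * of_int ((x + v + u) ^ 3 - (x + v) ^ 3)) * cnj (e (\<alpha> * of_int ((x + u) ^ 3 - x ^ 3)))))"
      unfolding T_def I_def J_def by (rule Weyl_differencing) simp
    also have "\<dots> \<le> (\<Sum>v\<in>{- int Q..int Q}. linear_sum_bound Q (\<alpha> * of_int (6 * u * v)))"
    proof (rule sum_mono)
      fix v
      \<comment> \<open>The part of the second difference that is constant in \<open>x\<close>,
        namely \<open>3 * u * v * (u + v)\<close>, contributes a factor of modulus 1.\<close>
      have "(\<Sum>x\<in>J v. e (\<alpha> * of_int ((x + v + u) ^ 3 - (x + v) ^ 3)) * cnj (e (\<alpha> * of_int ((x + u) ^ 3 - x ^ 3))))
        = (\<Sum>x\<in>J v. e (\<alpha> * of_int (3 * u * v * (u + v))) * e (\<alpha> * of_int (6 * u * v) * of_int x))"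
        by (intro sum.cong refl) (simp add: cnj_e e_add[symmetric] algebra_simps power2_eq_square power3_eq_cube)
      also have "\<dots> = e (\<alpha> * of_int (3 * u * v * (u + v))) * (\<Sum>x\<in>J v. e (\<alpha> * of_int (6 * u * v) * of_int x))"
        by (simp add: sum_distrib_left)
      finally have "norm (\<Sum>x\<in>J v. e (\<alpha> * of_int ((x + v + u) ^ 3 - (x + v) ^ 3)) * cnj (e (\<alpha> * of_int ((x + u) ^ 3 - x ^ 3))))
        = norm (\<Sum>x\<in>J v. e (\<alpha> * of_int (6 * u * v) * of_int x))" by (simp add: norm_mult)
      also have "\<dots> \<le> linear_sum_bound Q (\<alpha> * of_int (6 * u * v))"
        unfolding J_def by (rule norm_linear_sum_le) linarith
      finally show "norm (\<Sum>x\<in>J v. e (\<alpha> * of_int ((x + v + u) ^ 3 - (x + v) ^ 3)) * cnj (e (\<alpha> * of_int ((x + u) ^ 3 - x ^ 3))))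
        \<le> linear_sum_bound Q (\<alpha> * of_int (6 * u * v))" .
    qed
    finally show ?thesis .
  qed
  have "norm S ^ 4 = ((norm S)\<^sup>2)\<^sup>2" by simp
  also have "\<dots> \<le> (\<Sum>u\<in>{- int Q..int Q}. norm (T u))\<^sup>2" using S2 by (intro power_mono) auto
  also have "\<dots> = (\<Sum>u\<in>{- int Q..int Q}. 1 * norm (T u))\<^sup>2" by simp
  also have "\<dots> \<le> (\<Sum>u\<in>{- int Q..int Q}. 1\<^sup>2) * (\<Sum>u\<in>{- int Q..int Q}. (norm (T u))\<^sup>2)"
    by (rule Cauchy_Schwarz_ineq_sum)
  also have "\<dots> \<le> (2 * real Q + 1) * (\<Sum>u\<in>{- int Q..int Q}. \<Sum>v\<in>{- int Q..int Q}. linear_sum_bound Q (\<alpha> * of_int (6 * u * v)))"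
  proof (rule mult_mono)
    show "(\<Sum>u\<in>{- int Q..int Q}. 1\<^sup>2) \<le> 2 * real Q + 1" by simp
    show "(\<Sum>u\<in>{- int Q..int Q}. (norm (T u))\<^sup>2)
      \<le> (\<Sum>u\<in>{- int Q..int Q}. \<Sum>v\<in>{- int Q..int Q}. linear_sum_bound Q (\<alpha> * of_int (6 * u * v)))"
      by (rule sum_mono) (rule T2)
  qed (auto intro: sum_nonneg)
  finally show ?thesis unfolding S_def .
qed

section \<open>Collecting the slopes \<open>6 * h * u * v\<close> and summing over linear
  phases\<close>

lemma card_signed_divisors_le:
  "card {u::int. u \<noteq> 0 \<and> nat \<bar>u\<bar> dvd n} \<le> 2 * card {d. d dvd n}" if "n > 0"
proof -
  have fin: "finite {d. d dvd n}" using that by simp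
  have "{u::int. u \<noteq> 0 \<and> nat \<bar>u\<bar> dvd n} \<subseteq> int ` {d. d dvd n} \<union> (\<lambda>d. - int d) ` {d. d dvd n}"
  proof
    fix u :: int assume u: "u \<in> {u. u \<noteq> 0 \<and> nat \<bar>u\<bar> dvd n}"
    have "u = int (nat \<bar>u\<bar>) \<or> u = - int (nat \<bar>u\<bar>)" by auto
    then show "u \<in> int ` {d. d dvd n} \<union> (\<lambda>d. - int d) ` {d. d dvd n}" using u by blast
  qed
  then have "card {u::int. u \<noteq> 0 \<and> nat \<bar>u\<bar> dvd n} \<le> card (int ` {d. d dvd n} \<union> (\<lambda>d. - int d) ` {d. d dvd n})"
    using fin by (intro card_mono) auto
  also have "\<dots> \<le> card (int ` {d. d dvd n}) + card ((\<lambda>d. - int d) ` {d. d dvd n})" by (rule card_Un_le)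
  also have "\<dots> \<le> card {d. d dvd n} + card {d. d dvd n}" using fin by (intro add_mono card_image_le)
  finally show ?thesis by simp
qed

lemma finite_signed_divisors:
  assumes "n > 0" shows "finite {u::int. u \<noteq> 0 \<and> nat \<bar>u\<bar> dvd n}"
proof (rule finite_subset)
  show "{u::int. u \<noteq> 0 \<and> nat \<bar>u\<bar> dvd n} \<subseteq> {- int n..int n}"
  proof
    fix u :: int assume "u \<in> {u. u \<noteq> 0 \<and> nat \<bar>u\<bar> dvd n}"
    then have "nat \<bar>u\<bar> \<le> n" using assms by (intro dvd_imp_le) auto
    then show "u \<in> {- int n..int n}" by auto
  qed
qed simp

text \<open>A value \<open>n\<close> of \<open>\<bar>6 * h * u * v\<bar>\<close> fixes
  \<open>u\<close> and \<open>v\<close> up to a choice of signed divisors, at most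
  \<open>2 * D\<close> each, and then determines \<open>h\<close>. So no \<open>n\<close> is hit
  more than \<open>4 * D\<^sup>2\<close> times.\<close>

lemma sum_nonzero_products_le:
  fixes V :: "nat \<Rightarrow> real"
  assumes D: "\<And>n. n \<in> {1..6 * H * Q\<^sup>2} \<Longrightarrow> real (card {d. d dvd n}) \<le> D"
    and V0: "\<And>n. V n \<ge> 0"
  shows "(\<Sum>(h,u,v)\<in>{1..H} \<times> ({- int Q..int Q} - {0}) \<times> ({- int Q..int Q} - {0}). V (nat \<bar>6 * int h * u * v\<bar>))
    \<le> 4 * D\<^sup>2 * (\<Sum>n=1..6 * H * Q\<^sup>2. V n)"
proof -
  let ?W = "{- int Q..int Q} - {0}"
  let ?S = "{1..H} \<times> ?W \<times> ?W"
  define g where "g = (\<lambda>(h::nat, u::int, v::int). nat \<bar>6 * int h * u * v\<bar>)"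
  have g: "g (h, u, v) = 6 * h * nat \<bar>u\<bar> * nat \<bar>v\<bar>" for h u v
    by (simp add: g_def abs_mult nat_mult_distrib)
  have sub: "g ` ?S \<subseteq> {1..6 * H * Q\<^sup>2}"
  proof
    fix n assume "n \<in> g ` ?S"
    then obtain h u v where t: "h \<in> {1..H}" "u \<in> ?W" "v \<in> ?W" "n = 6 * h * nat \<bar>u\<bar> * nat \<bar>v\<bar>"
      by (force simp: g)
    have "6 * h * nat \<bar>u\<bar> * nat \<bar>v\<bar> \<le> 6 * H * Q * Q" using t by (intro mult_le_mono) auto
    then show "n \<in> {1..6 * H * Q\<^sup>2}" using t by (auto simp: power2_eq_square mult_ac Suc_le_eq)
  qed
  have fib: "real (card {t \<in> ?S. g t = n}) \<le> 4 * D\<^sup>2" if n: "n \<in> {1..6 * H * Q\<^sup>2}" for n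
  proof -
    let ?d = "{u::int. u \<noteq> 0 \<and> nat \<bar>u\<bar> dvd n}"
    have "inj_on snd {t \<in> ?S. g t = n}"
      by (rule inj_onI) (auto simp: g)
    then have "card {t \<in> ?S. g t = n} = card (snd ` {t \<in> ?S. g t = n})" by (simp add: card_image)
    also have "\<dots> \<le> card (?d \<times> ?d)"
      using finite_signed_divisors[of n] n by (intro card_mono) (auto simp: g)
    also have "\<dots> \<le> (2 * card {d. d dvd n}) * (2 * card {d. d dvd n})"
      unfolding card_cartesian_product using n by (intro mult_le_mono card_signed_divisors_le) auto
    finally have "real (card {t \<in> ?S. g t = n}) \<le> real ((2 * card {d. d dvd n}) * (2 * card {d. d dvd n}))"
      by (rule of_nat_mono)
    also have "\<dots> = 4 * (real (card {d. d dvd n}))\<^sup>2" by (simp add: power2_eq_square)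
    also have "\<dots> \<le> 4 * D\<^sup>2" using D[OF n] by (intro mult_left_mono power_mono) auto
    finally show ?thesis .
  qed
  have "(\<Sum>(h,u,v)\<in>?S. V (nat \<bar>6 * int h * u * v\<bar>)) = (\<Sum>t\<in>?S. V (g t))"
    by (intro sum.cong) (auto simp: g_def)
  also have "\<dots> = (\<Sum>n=1..6 * H * Q\<^sup>2. \<Sum>t\<in>{t. t \<in> ?S \<and> g t = n}. V (g t))"
    using sum.group[OF _ _ sub, of "\<lambda>t. V (g t)"] by simp
  also have "\<dots> = (\<Sum>n=1..6 * H * Q\<^sup>2. real (card {t \<in> ?S. g t = n}) * V n)"
    by (intro sum.cong refl) simp
  also have "\<dots> \<le> (\<Sum>n=1..6 * H * Q\<^sup>2. 4 * D\<^sup>2 * V n)"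
    using fib V0 by (intro sum_mono mult_right_mono) auto
  finally show ?thesis by (simp add: sum_distrib_left)
qed

text \<open>Over a block of length \<open>r\<close>, replacing \<open>\<alpha>\<close> by
  \<open>b / r\<close> costs at most \<open>1 / r\<close>, and two points near
  \<open>\<beta>\<close> are within \<open>2 / r\<close> of each other modulo 1. Relative to one
  such point \<open>n0\<close>, \<open>b * (n - n0)\<close> is therefore congruent to one of the
  seven numbers from -3 to 3, and each is attained once since \<open>b\<close> is invertible modulo
  \<open>r\<close>.\<close>

lemma card_block_near_le:
  fixes \<alpha> :: real
  assumes cop: "coprime b r" and r: "r > 0" and app: "\<bar>\<alpha> - of_int b / of_int r\<bar> \<le> 1 / (of_int r)\<^sup>2"
  shows "card {n\<in>{c..<c + nat r}. int_dist (\<alpha> * real n - \<beta>) \<le> 1 / of_int r} \<le> 7"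
proof (cases "{n\<in>{c..<c + nat r}. int_dist (\<alpha> * real n - \<beta>) \<le> 1 / of_int r} = {}")
  case False
  let ?A = "{n\<in>{c..<c + nat r}. int_dist (\<alpha> * real n - \<beta>) \<le> 1 / of_int r}"
  obtain n0 where n0: "n0 \<in> ?A" using False by blast
  obtain k0 where k0: "int_dist (\<alpha> * real n0 - \<beta>) = \<bar>\<alpha> * real n0 - \<beta> - of_int k0\<bar>" by (rule int_dist_obtain)
  have "\<exists>t\<in>{-3..3}. r dvd b * (int n - int n0) - t" if n: "n \<in> ?A" for n
  proof -
    obtain k where k: "int_dist (\<alpha> * real n - \<beta>) = \<bar>\<alpha> * real n - \<beta> - of_int k\<bar>" by (rule int_dist_obtain)
    define d where "d = int n - int n0"
    define t where "t = b * d - r * (k - k0)"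
    have r0: "real_of_int r > 0" using r by simp
    have "\<bar>real_of_int d\<bar> \<le> of_int r" using n n0 by (auto simp: d_def)
    then have "\<bar>(of_int b / of_int r - \<alpha>) * of_int d\<bar> \<le> 1 / (of_int r)\<^sup>2 * of_int r"
      unfolding abs_mult using app r0 by (intro mult_mono) (auto simp: abs_minus_commute)
    then have 1: "\<bar>(of_int b / of_int r - \<alpha>) * of_int d\<bar> \<le> 1 / of_int r"
      using r0 by (simp add: power2_eq_square)
    have 2: "\<bar>(\<alpha> * real n - \<beta> - of_int k) - (\<alpha> * real n0 - \<beta> - of_int k0)\<bar> \<le> 2 / of_int r"
    proof -
      have "\<bar>\<alpha> * real n - \<beta> - of_int k\<bar> \<le> 1 / of_int r" "\<bar>\<alpha> * real n0 - \<beta> - of_int k0\<bar> \<le> 1 / of_int r"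
        using n n0 k k0 by auto
      moreover have "2 / real_of_int r = 1 / of_int r + 1 / of_int r" by simp
      ultimately show ?thesis by linarith
    qed
    have "of_int t / of_int r = of_int b / of_int r * of_int d - real_of_int (k - k0)"
      using r0 by (simp add: t_def field_simps)
    also have "\<dots> = (of_int b / of_int r - \<alpha>) * of_int d + ((\<alpha> * real n - \<beta> - of_int k) - (\<alpha> * real n0 - \<beta> - of_int k0))"
      by (simp add: d_def algebra_simps)
    finally have "\<bar>of_int t / of_int r\<bar> \<le> 1 / of_int r + 2 / real_of_int r" using 1 2 by linarith
    then have "\<bar>real_of_int t\<bar> \<le> 3" using r0 by (simp add: field_simps abs_divide)
    then have "t \<in> {-3..3}" by auto
    moreover have "r dvd b * d - t" by (simp add: t_def)
    ultimately show ?thesis unfolding d_def by blast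
  qed
  then have "\<forall>n\<in>?A. \<exists>t. t \<in> {-3..3} \<and> r dvd b * (int n - int n0) - t" by blast
  from bchoice[OF this] obtain g where
    "\<forall>n\<in>?A. g n \<in> {-3..3} \<and> r dvd b * (int n - int n0) - g n" by blast
  then have g: "g n \<in> {-3..3}" "r dvd b * (int n - int n0) - g n" if "n \<in> ?A" for n
    using that by blast+
  have "inj_on g ?A"
  proof (rule inj_onI)
    fix n m assume n: "n \<in> ?A" and m: "m \<in> ?A" and eq: "g n = g m"
    have "r dvd (b * (int n - int n0) - g n) - (b * (int m - int n0) - g m)"
      by (rule dvd_diff[OF g(2)[OF n] g(2)[OF m]])
    then have "r dvd b * (int n - int m)" using eq by (simp add: algebra_simps)
    then have "r dvd int n - int m" using cop by (simp add: coprime_commute coprime_dvd_mult_right_iff)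
    moreover have "\<bar>int n - int m\<bar> < r" using n m r by auto
    ultimately show "n = m" using dvd_imp_le_int[of "int n - int m" r] r by fastforce
  qed
  then have "card ?A \<le> card {-3..3::int}" using g(1) by (intro card_inj_on_le[where f = g] image_subsetI) auto
  then show ?thesis by simp
next
  case True
  show ?thesis unfolding True by simp
qed

lemma sum_blocks_le:
  fixes f :: "nat \<Rightarrow> real"
  assumes r: "r > 0" and f: "\<And>n. f n \<ge> 0" and B: "\<And>c. (\<Sum>n\<in>{c..<c + r}. f n) \<le> B" and B0: "B \<ge> 0"
  shows "(\<Sum>n=1..X. f n) \<le> (real X / real r + 1) * B"
proof -
  have X: "X < (X div r + 1) * r"
    using r by (metis add.commute dividend_less_times_div mult.commute mult_Suc_right plus_1_eq_Suc)
  have "(\<Sum>n=1..X. f n) \<le> sum f {..<(X div r + 1) * r}"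
    using f X by (intro sum_mono2) auto
  also have "\<dots> = (\<Sum>m<X div r + 1. sum f {m * r..<m * r + r})"
    by (simp only: sum.nat_group)
  also have "\<dots> \<le> (\<Sum>m<X div r + 1. B)" by (intro sum_mono B)
  also have "\<dots> = (real (X div r) + 1) * B" by (simp only: sum_constant card_lessThan of_nat_add of_nat_1)
  also have "\<dots> \<le> (real X / real r + 1) * B"
    using B0 of_nat_div_le_of_nat[of X r, where 'a = real] by (intro mult_right_mono) auto
  finally show ?thesis .
qed

text \<open>The range is cut into blocks of length \<open>r\<close>. Within a block a shell of width
  \<open>1 / r\<close> has two arcs with at most 7 points each, hence 14; summing
  \<open>r / k\<close> over the outer shells gives the logarithm.\<close>

lemma sum_linear_sum_bound_le:
  fixes \<alpha> :: real
  assumes cop: "coprime b r" and r: "r > 0" and app: "\<bar>\<alpha> - of_int b / of_int r\<bar> \<le> 1 / (of_int r)\<^sup>2"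
  shows "(\<Sum>n=1..X. linear_sum_bound Q (\<alpha> * real n))
    \<le> (real X / of_int r + 1) * (14 * (real Q + of_int r * (1 + ln (of_int r))))"
proof -
  have r0: "real_of_int r > 0" and r1: "real (nat r) = of_int r" and r2: "nat r > 0" using r by auto
  have l0: "ln (real_of_int r) \<ge> 0" using r by simp
  have "(\<Sum>n=1..X. linear_sum_bound Q (\<alpha> * real n))
    \<le> (real X / real (nat r) + 1) * (14 * (real Q + of_int r * (1 + ln (of_int r))))"
  proof (rule sum_blocks_le[OF r2 linear_sum_bound_nonneg])
    fix c
    have "(\<Sum>n\<in>{c..<c + nat r}. linear_sum_bound Q (\<alpha> * real n))
      \<le> 14 * (real Q + (1/2) / (1 / of_int r) ^ 1 * (\<Sum>k=1..nat \<lfloor>1 / (1 / real_of_int r)\<rfloor>. 1 / real k ^ 1))"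
    proof (rule sum_le_by_distance[where d = "\<lambda>n. int_dist (\<alpha> * real n)"])
      fix k :: nat
      have "card {n \<in> {c..<c + nat r}. real k / of_int r \<le> int_dist (\<alpha> * real n - 0)
          \<and> int_dist (\<alpha> * real n - 0) < real k / of_int r + 1 / of_int r} \<le> 2 * 7"
        by (intro card_distance_annulus_le card_block_near_le[OF cop r app]) simp
      moreover have "real k * (1 / real_of_int r) = real k / of_int r"
        "(real k + 1) * (1 / real_of_int r) = real k / of_int r + 1 / of_int r"
        by (simp_all add: add_divide_distrib)
      ultimately show "real (card {n \<in> {c..<c + nat r}. real k * (1 / real_of_int r) \<le> int_dist (\<alpha> * real n)
          \<and> int_dist (\<alpha> * real n) < (real k + 1) * (1 / real_of_int r)}) \<le> 14" by simp
    qed (use r0 linear_sum_bound_le linear_sum_bound_mult_le int_dist_le_half in auto)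
    also have "\<dots> = 14 * (real Q + (1/2) * of_int r * (\<Sum>k=1..nat r. 1 / real k))" using r0 by simp
    also have "\<dots> \<le> 14 * (real Q + (1/2) * of_int r * (1 + ln (of_int r)))"
      using sum_inverses_le[OF r2] r0 unfolding r1 by (intro mult_left_mono add_left_mono) auto
    also have "\<dots> \<le> 14 * (real Q + of_int r * (1 + ln (of_int r)))"
      using r0 l0 by (intro mult_left_mono add_left_mono mult_right_mono) auto
    finally show "(\<Sum>n\<in>{c..<c + nat r}. linear_sum_bound Q (\<alpha> * real n)) \<le> 14 * (real Q + of_int r * (1 + ln (of_int r)))" .
  next
    show "0 \<le> 14 * (real Q + of_int r * (1 + ln (of_int r)))" using r0 l0 by simp
  qed
  then show ?thesis unfolding r1 .
qed

definition cubic_sum :: "nat \<Rightarrow> real \<Rightarrow> complex" where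
  "cubic_sum Q \<alpha> = (\<Sum>x\<in>{1..int Q}. e (\<alpha> * of_int (x ^ 3)))"

lemma cubic_sum_minus: "norm (cubic_sum Q (- \<alpha>)) = norm (cubic_sum Q \<alpha>)"
proof -
  have "cubic_sum Q (- \<alpha>) = cnj (cubic_sum Q \<alpha>)" by (simp add: cubic_sum_def cnj_e)
  then show ?thesis by simp
qed

text \<open>Pairs with \<open>u * v = 0\<close> have slope 0 and are bounded trivially. All others
  are collected, together with \<open>h\<close>, into one sum of length
  \<open>6 * H * Q\<^sup>2\<close>; averaging over \<open>h\<close> thus spreads the incomplete
  block over \<open>H\<close> frequencies.\<close>

lemma sum_fourth_powers_cubic_sum_le:
  fixes \<alpha> :: real
  assumes cop: "coprime b r" and r: "r > 0" and app: "\<bar>\<alpha> - of_int b / of_int r\<bar> \<le> 1 / (of_int r)\<^sup>2"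
    and D: "\<And>n. n \<in> {1..6 * H * Q\<^sup>2} \<Longrightarrow> real (card {d. d dvd n}) \<le> D"
  shows "(\<Sum>h=1..H. norm (cubic_sum Q (\<alpha> * real h)) ^ 4)
    \<le> (2 * real Q + 1) * (2 * real H * (2 * real Q + 1) * real Q
        + 4 * D\<^sup>2 * ((6 * real H * (real Q)\<^sup>2 / of_int r + 1) * (14 * (real Q + of_int r * (1 + ln (of_int r))))))"
proof -
  define V where "V n = linear_sum_bound Q (\<alpha> * real n)" for n
  define U where "U = {- int Q..int Q}"
  define W where "W = U - {0}"
  have fin: "finite U" "finite W" by (simp_all add: U_def W_def)
  have cU: "card U = 2 * Q + 1" by (simp add: U_def)
  have cW: "card W = 2 * Q" using cU unfolding W_def by (simp add: U_def)
  have V: "linear_sum_bound Q ((\<alpha> * real h) * of_int (6 * u * v)) = V (nat \<bar>6 * int h * u * v\<bar>)" for h u v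
  proof -
    have "(\<alpha> * real h) * of_int (6 * u * v) = \<alpha> * of_int (6 * int h * u * v)" by simp
    then show ?thesis unfolding V_def by (metis linear_sum_bound_abs)
  qed
  \<comment> \<open>The two axes contain \<open>4 * Q + 1\<close> pairs, rounded up to
    \<open>2 * (2 * Q + 1)\<close>.\<close>
  have split: "(\<Sum>u\<in>U. \<Sum>v\<in>U. f u v) \<le> (\<Sum>(u,v)\<in>W \<times> W. f u v) + 2 * (2 * real Q + 1) * real Q"
    if f: "\<And>u v. f u v \<le> real Q" for f :: "int \<Rightarrow> int \<Rightarrow> real"
  proof -
    have sub: "W \<times> W \<subseteq> U \<times> U" by (auto simp: W_def)
    have "(\<Sum>u\<in>U. \<Sum>v\<in>U. f u v) = (\<Sum>(u,v)\<in>U \<times> U. f u v)" by (simp add: sum.cartesian_product)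
    also have "\<dots> = (\<Sum>(u,v)\<in>W \<times> W. f u v) + (\<Sum>(u,v)\<in>U \<times> U - W \<times> W. f u v)"
      using sum.subset_diff[OF sub] fin by (simp add: add.commute)
    also have "(\<Sum>(u,v)\<in>U \<times> U - W \<times> W. f u v) \<le> real (card (U \<times> U - W \<times> W)) * real Q"
      using f by (intro sum_bounded_above) auto
    also have "card (U \<times> U - W \<times> W) = (2 * Q + 1) * (2 * Q + 1) - (2 * Q) * (2 * Q)"
      using sub fin by (simp add: card_Diff_subset card_cartesian_product cU cW)
    also have "\<dots> = 4 * Q + 1" by simp
    also have "real (4 * Q + 1) * real Q \<le> 2 * (2 * real Q + 1) * real Q"
      by (intro mult_right_mono) auto
    finally show ?thesis by simp
  qed
  have "(\<Sum>h=1..H. norm (cubic_sum Q (\<alpha> * real h)) ^ 4)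
    \<le> (\<Sum>h=1..H. (2 * real Q + 1) * ((\<Sum>(u,v)\<in>W \<times> W. V (nat \<bar>6 * int h * u * v\<bar>)) + 2 * (2 * real Q + 1) * real Q))"
  proof (rule sum_mono)
    fix h
    have "norm (cubic_sum Q (\<alpha> * real h)) ^ 4
      \<le> (2 * real Q + 1) * (\<Sum>u\<in>U. \<Sum>v\<in>U. linear_sum_bound Q ((\<alpha> * real h) * of_int (6 * u * v)))"
      unfolding cubic_sum_def U_def by (rule Weyl_cubic_inequality)
    also have "\<dots> = (2 * real Q + 1) * (\<Sum>u\<in>U. \<Sum>v\<in>U. V (nat \<bar>6 * int h * u * v\<bar>))"
      by (simp only: V)
    also have "\<dots> \<le> (2 * real Q + 1) * ((\<Sum>(u,v)\<in>W \<times> W. V (nat \<bar>6 * int h * u * v\<bar>)) + 2 * (2 * real Q + 1) * real Q)"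
      by (intro mult_left_mono split) (auto simp: V_def linear_sum_bound_le)
    finally show "norm (cubic_sum Q (\<alpha> * real h)) ^ 4
      \<le> (2 * real Q + 1) * ((\<Sum>(u,v)\<in>W \<times> W. V (nat \<bar>6 * int h * u * v\<bar>)) + 2 * (2 * real Q + 1) * real Q)" .
  qed
  also have "\<dots> = (2 * real Q + 1) * ((\<Sum>h=1..H. \<Sum>(u,v)\<in>W \<times> W. V (nat \<bar>6 * int h * u * v\<bar>)) + 2 * real H * (2 * real Q + 1) * real Q)"
    by (simp add: sum_distrib_left[symmetric] sum.distrib)
  finally have le: "(\<Sum>h=1..H. norm (cubic_sum Q (\<alpha> * real h)) ^ 4) \<le> \<dots>" .
  have "(\<Sum>h=1..H. \<Sum>(u,v)\<in>W \<times> W. V (nat \<bar>6 * int h * u * v\<bar>))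
      = (\<Sum>(h,u,v)\<in>{1..H} \<times> W \<times> W. V (nat \<bar>6 * int h * u * v\<bar>))"
    by (simp add: sum.cartesian_product)
  also have "\<dots> \<le> 4 * D\<^sup>2 * (\<Sum>n=1..6 * H * Q\<^sup>2. V n)"
    unfolding W_def U_def by (rule sum_nonzero_products_le[OF D]) (auto simp: V_def linear_sum_bound_nonneg)
  also have "\<dots> \<le> 4 * D\<^sup>2 * ((real (6 * H * Q\<^sup>2) / of_int r + 1) * (14 * (real Q + of_int r * (1 + ln (of_int r)))))"
    unfolding V_def by (intro mult_left_mono sum_linear_sum_bound_le[OF cop r app]) simp
  also have "real (6 * H * Q\<^sup>2) = 6 * real H * (real Q)\<^sup>2" by simp
  finally have "(\<Sum>h=1..H. \<Sum>(u,v)\<in>W \<times> W. V (nat \<bar>6 * int h * u * v\<bar>)) + 2 * real H * (2 * real Q + 1) * real Q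
    \<le> 2 * real H * (2 * real Q + 1) * real Q
        + 4 * D\<^sup>2 * ((6 * real H * (real Q)\<^sup>2 / of_int r + 1) * (14 * (real Q + of_int r * (1 + ln (of_int r)))))"
    by linarith
  then show ?thesis by (rule order.trans[OF le mult_left_mono]) simp
qed

section \<open>Detecting near-integral values of \<open>\<alpha> * q ^ 3\<close>\<close>

lemma norm_sum_e_ge:
  assumes "int_dist \<theta> \<le> \<eta>" "real H * \<eta> \<le> 1/8"
  shows "norm (\<Sum>h<H. e (real h * \<theta>)) \<ge> real H / 2"
proof -
  obtain k where k: "int_dist \<theta> = \<bar>\<theta> - of_int k\<bar>" by (rule int_dist_obtain)
  define t where "t = \<theta> - of_int k"
  have et: "e (real h * \<theta>) = e (real h * t)" for h
  proof -
    have "real h * \<theta> = real h * t + of_int (int h * k)" by (simp add: t_def algebra_simps)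
    then show ?thesis by (simp only: e_add e_of_int mult_1_right)
  qed
  have ge: "1/2 \<le> Re (e (real h * t))" if "h < H" for h
  proof -
    have "\<bar>real h * t\<bar> \<le> real H * \<eta>"
      unfolding abs_mult using that assms(1) k by (intro mult_mono) (auto simp: t_def)
    \<comment> \<open>No phase exceeds \<open>1/8\<close>, so the angles stay below
      \<open>pi / 4\<close>; the weaker \<open>pi / 3\<close> is convenient because its cosine is
      \<open>1/2\<close>.\<close>
    then have "\<bar>2 * pi * (real h * t)\<bar> \<le> pi / 3"
      using assms(2) by (simp add: abs_mult)
    then have "cos (pi / 3) \<le> cos \<bar>2 * pi * (real h * t)\<bar>"
      by (intro cos_monotone_0_pi_le) auto
    then show ?thesis by (simp add: e_eq_cis cos_60)
  qed
  have "real H / 2 = (\<Sum>h<H. 1/2)" by simp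
  also have "\<dots> \<le> (\<Sum>h<H. Re (e (real h * t)))" using ge by (intro sum_mono) auto
  also have "\<dots> = Re (\<Sum>h<H. e (real h * \<theta>))" by (simp add: et)
  also have "\<dots> \<le> norm (\<Sum>h<H. e (real h * \<theta>))" by (rule complex_Re_le_cmod)
  finally show ?thesis .
qed

lemma sum_abs_diff_le:
  fixes s :: "nat \<Rightarrow> real"
  assumes s: "\<And>k. s k \<ge> 0" and h: "h < H"
  shows "(\<Sum>l<H. s (nat \<bar>int h - int l\<bar>)) \<le> s 0 + 2 * (\<Sum>k=1..H. s k)"
proof -
  have "{..<H} = {..<h} \<union> {h} \<union> {h<..<H}" using h by auto
  then have "(\<Sum>l<H. s (nat \<bar>int h - int l\<bar>))
      = (\<Sum>l<h. s (nat \<bar>int h - int l\<bar>)) + s 0 + (\<Sum>l\<in>{h<..<H}. s (nat \<bar>int h - int l\<bar>))"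
    by (subst \<open>{..<H} = _\<close>, subst sum.union_disjoint, simp, simp, force, subst sum.union_disjoint) auto
  also have "(\<Sum>l<h. s (nat \<bar>int h - int l\<bar>)) = (\<Sum>k\<in>(\<lambda>l. h - l) ` {..<h}. s k)"
    by (subst sum.reindex) (auto simp: inj_on_def of_nat_diff nat_diff_distrib intro!: sum.cong arg_cong[where f = s])
  also have "\<dots> \<le> (\<Sum>k=1..H. s k)" using h s by (intro sum_mono2) auto
  also have "(\<Sum>l\<in>{h<..<H}. s (nat \<bar>int h - int l\<bar>)) = (\<Sum>k\<in>(\<lambda>l. l - h) ` {h<..<H}. s k)"
    by (subst sum.reindex) (auto simp: inj_on_def intro!: sum.cong arg_cong[where f = s])
  also have "\<dots> \<le> (\<Sum>k=1..H. s k)" using h s by (intro sum_mono2) auto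
  finally show ?thesis by simp
qed

text \<open>The kernel \<open>\<bar>\<Sum>h<H. e (h * \<theta>)\<bar>\<^sup>2\<close> is at least \<open>H\<^sup>2 / 4\<close> when \<open>\<theta>\<close> is within
  \<open>1 / (8 * H)\<close> of an integer.\<close>

lemma card_near_cubes_le:
  fixes \<alpha> :: real
  assumes H: "H > 0" and \<eta>: "real H * \<eta> \<le> 1/8"
  shows "real (card {q\<in>{1..int Q}. int_dist (\<alpha> * of_int (q ^ 3)) \<le> \<eta>})
    \<le> 4 * real Q / real H + 8 / real H * (\<Sum>h=1..H. norm (cubic_sum Q (\<alpha> * real h)))"
proof -
  define A where "A = {q\<in>{1..int Q}. int_dist (\<alpha> * of_int (q ^ 3)) \<le> \<eta>}"
  define F where "F q = (\<Sum>h<H. e (real h * (\<alpha> * of_int (q ^ 3))))" for q :: int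
  define s where "s k = norm (cubic_sum Q (\<alpha> * real k))" for k :: nat
  have A: "A \<subseteq> {1..int Q}" by (auto simp: A_def)
  have "complex_of_real (\<Sum>q\<in>{1..int Q}. (norm (F q))\<^sup>2) = (\<Sum>q\<in>{1..int Q}. F q * cnj (F q))"
    by (simp only: of_real_sum complex_norm_square)
  also have "\<dots> = (\<Sum>q\<in>{1..int Q}. \<Sum>h<H. \<Sum>l<H. e ((\<alpha> * (real h - real l)) * of_int (q ^ 3)))"
    by (simp add: F_def sum_product cnj_e e_add[symmetric] algebra_simps)
  also have "\<dots> = (\<Sum>h<H. \<Sum>q\<in>{1..int Q}. \<Sum>l<H. e ((\<alpha> * (real h - real l)) * of_int (q ^ 3)))"
    by (rule sum.swap)
  also have "\<dots> = (\<Sum>h<H. \<Sum>l<H. cubic_sum Q (\<alpha> * (real h - real l)))"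
    unfolding cubic_sum_def by (intro sum.cong refl sum.swap)
  finally have eq: "complex_of_real (\<Sum>q\<in>{1..int Q}. (norm (F q))\<^sup>2) = (\<Sum>h<H. \<Sum>l<H. cubic_sum Q (\<alpha> * (real h - real l)))" .
  have ns: "norm (cubic_sum Q (\<alpha> * (real h - real l))) = s (nat \<bar>int h - int l\<bar>)" for h l
  proof (cases "l \<le> h")
    case True
    then have "real h - real l = real (nat \<bar>int h - int l\<bar>)" by linarith
    then show ?thesis by (simp only: s_def)
  next
    case False
    then have "\<alpha> * (real h - real l) = - (\<alpha> * real (nat \<bar>int h - int l\<bar>))" by (simp add: algebra_simps)
    then show ?thesis by (simp only: s_def cubic_sum_minus)
  qed
  have "real (card A) * (real H / 2)\<^sup>2 = (\<Sum>q\<in>A. (real H / 2)\<^sup>2)" by simp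
  also have "\<dots> \<le> (\<Sum>q\<in>A. (norm (F q))\<^sup>2)"
  proof (intro sum_mono power_mono)
    fix q assume "q \<in> A"
    then have "int_dist (\<alpha> * of_int (q ^ 3)) \<le> \<eta>" unfolding A_def by blast
    then show "real H / 2 \<le> norm (F q)" unfolding F_def by (rule norm_sum_e_ge[OF _ \<eta>])
  qed simp
  also have "\<dots> \<le> (\<Sum>q\<in>{1..int Q}. (norm (F q))\<^sup>2)" using A by (intro sum_mono2) auto
  also have "\<dots> = norm (complex_of_real (\<Sum>q\<in>{1..int Q}. (norm (F q))\<^sup>2))"
    by (simp only: norm_of_real) (simp add: sum_nonneg)
  also have "\<dots> \<le> (\<Sum>h<H. \<Sum>l<H. s (nat \<bar>int h - int l\<bar>))"
    unfolding eq ns[symmetric] by (intro order.trans[OF norm_sum] sum_mono norm_sum)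
  also have "\<dots> \<le> (\<Sum>h<H. s 0 + 2 * (\<Sum>k=1..H. s k))"
    by (intro sum_mono sum_abs_diff_le) (auto simp: s_def)
  also have "\<dots> = real H * (real Q + 2 * (\<Sum>k=1..H. s k))" by (simp add: s_def cubic_sum_def)
  finally have "real H * (real H / 4 * real (card A)) \<le> real H * (real Q + 2 * (\<Sum>k=1..H. s k))"
    by (simp add: power2_eq_square field_simps)
  then have "real H / 4 * real (card A) \<le> real Q + 2 * (\<Sum>k=1..H. s k)" using H by simp
  then have "real (card A) \<le> (4 * real Q + 8 * (\<Sum>k=1..H. s k)) / real H"
    using H by (simp add: field_simps)
  then show ?thesis unfolding A_def s_def by (simp add: add_divide_distrib)
qed

lemma power4_sum_le:
  fixes x :: "nat \<Rightarrow> real"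
  shows "(\<Sum>h=1..H. x h) ^ 4 \<le> real H ^ 3 * (\<Sum>h=1..H. x h ^ 4)"
proof -
  have "(\<Sum>h=1..H. x h)\<^sup>2 \<le> real H * (\<Sum>h=1..H. (x h)\<^sup>2)"
    using Cauchy_Schwarz_ineq_sum[of "\<lambda>_. 1" x "{1..H}"] by simp
  then have "((\<Sum>h=1..H. x h)\<^sup>2)\<^sup>2 \<le> (real H * (\<Sum>h=1..H. (x h)\<^sup>2))\<^sup>2"
    by (intro power_mono) auto
  also have "\<dots> = (real H)\<^sup>2 * (\<Sum>h=1..H. (x h)\<^sup>2)\<^sup>2" by (rule power_mult_distrib)
  also have "\<dots> \<le> (real H)\<^sup>2 * (real H * (\<Sum>h=1..H. ((x h)\<^sup>2)\<^sup>2))"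
    using Cauchy_Schwarz_ineq_sum[of "\<lambda>_. 1" "\<lambda>h. (x h)\<^sup>2" "{1..H}"] by (intro mult_left_mono) auto
  also have "\<dots> = real H ^ 3 * (\<Sum>h=1..H. ((x h)\<^sup>2)\<^sup>2)" by (simp add: power2_eq_square power3_eq_cube)
  finally show ?thesis by simp
qed

text \<open>The first summand is the diagonal term \<open>4 * Q / H\<close> of the detection, the
  second the mean of the cubic sums, obtained from their fourth moment by Hoelder's inequality. The
  hypothesis \<open>Q \<le> r\<close> lets \<open>r\<close> absorb \<open>Q\<close> in a block sum,
  and \<open>r * Q \<le> N\<close> controls the incomplete block.\<close>

lemma minor_arc_bound:
  fixes \<alpha> :: real
  assumes cop: "coprime b r" and app: "\<bar>\<alpha> - of_int b / of_int r\<bar> \<le> 1 / (of_int r)\<^sup>2"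
    and Q: "Q \<ge> 1" and QN: "8 * Q ^ 3 \<le> N" and r1: "int Q \<le> r" and r2: "of_int r * real Q \<le> real N"
    and D: "\<And>n. n \<in> {1..N} \<Longrightarrow> real (card {d. d dvd n}) \<le> D" and D1: "D \<ge> 1"
  shows "real (card {q\<in>{1..int Q}. int_dist (\<alpha> * of_int (q ^ 3)) \<le> real Q ^ 3 / real N})
    \<le> 64 * real Q ^ 4 / real N + 80 * (D\<^sup>2 * (1 + ln (real N))) * real Q powr (3/4)"
proof -
  \<comment> \<open>This is the largest \<open>H\<close> for which
    \<open>H * (Q ^ 3 / N) \<le> 1/8\<close>, as the detection requires. The floor costs at most a
    factor 2, whence \<open>N \<le> 16 * H * Q ^ 3\<close>.\<close>
  define H where "H = N div (8 * Q ^ 3)"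
  define \<Lambda> where "\<Lambda> = 1 + ln (real N)"
  define X where "X = (\<Sum>h=1..H. norm (cubic_sum Q (\<alpha> * real h)))"
  have q: "real Q \<ge> 1" using Q by simp
  have q3: "real Q ^ 3 \<ge> 1" using q by simp
  have r: "r > 0" using Q r1 by linarith
  have rq: "real Q \<le> of_int r" using r1 by (metis of_int_le_iff of_int_of_nat_eq)
  have N: "N > 0" using QN Q by (metis gr0I le_zero_eq mult_eq_0_iff not_one_le_zero power_eq_0_iff zero_neq_numeral)
  have rN: "of_int r \<le> real N"
  proof -
    have "of_int r * 1 \<le> of_int r * real Q" using r q by (intro mult_left_mono) auto
    then show ?thesis using r2 by simp
  qed
  have \<Lambda>: "\<Lambda> \<ge> 1" using N by (simp add: \<Lambda>_def)
  have D2: "D\<^sup>2 \<ge> 1" using D1 by simp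
  have DL: "D\<^sup>2 * \<Lambda> \<ge> 1" using D2 \<Lambda> mult_mono[of 1 "D\<^sup>2" 1 \<Lambda>] by simp
  have H1: "H \<ge> 1" using QN Q by (simp add: H_def div_greater_zero_iff Suc_le_eq)
  have HN: "H * (8 * Q ^ 3) \<le> N" by (simp add: H_def)
  have HN': "8 * (real H * real Q ^ 3) \<le> real N"
    using of_nat_mono[OF HN, where 'a = real] by (simp add: mult_ac)
  have NH: "real N \<le> 16 * (real H * real Q ^ 3)"
  proof -
    have "N < (H + 1) * (8 * Q ^ 3)"
    proof -
      have "N mod (8 * Q ^ 3) < 8 * Q ^ 3" using Q by (intro mod_less_divisor) simp
      then show ?thesis
        using div_mult_mod_eq[of N "8 * Q ^ 3"] unfolding H_def add_mult_distrib by linarith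
    qed
    also have "\<dots> \<le> (2 * H) * (8 * Q ^ 3)" using H1 by (intro mult_le_mono1) simp
    finally have "N \<le> 16 * (H * Q ^ 3)" by simp
    from of_nat_mono[OF this, where 'a = real] show ?thesis by simp
  qed
  \<comment> \<open>All slopes stay in the range where \<open>D\<close> bounds the number of
    divisors.\<close>
  have dom: "6 * H * Q\<^sup>2 \<le> N"
  proof -
    have "H * (6 * Q\<^sup>2) \<le> H * (8 * Q ^ 3)"
      using Q power_increasing[of 2 3 Q] by (intro mult_le_mono) auto
    from le_trans[OF this HN] show ?thesis by (simp add: mult_ac)
  qed
  have \<Lambda>r: "1 + ln (of_int r) \<le> \<Lambda>" using rN r N by (simp add: \<Lambda>_def)
  have lr: "ln (real_of_int r) \<ge> 0" using r by simp
  define R where "R = real_of_int r"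
  have R: "R > 0" "real Q \<le> R" "R * real Q \<le> real N" using r rq r2 by (auto simp: R_def)
  have X4: "(\<Sum>h=1..H. norm (cubic_sum Q (\<alpha> * real h)) ^ 4) \<le> 600 * (D\<^sup>2 * \<Lambda>) * real N"
  proof -
    have "(\<Sum>h=1..H. norm (cubic_sum Q (\<alpha> * real h)) ^ 4)
      \<le> (2 * real Q + 1) * (2 * real H * (2 * real Q + 1) * real Q
        + 4 * D\<^sup>2 * ((6 * real H * (real Q)\<^sup>2 / R + 1) * (14 * (real Q + R * (1 + ln R)))))"
      unfolding R_def by (rule sum_fourth_powers_cubic_sum_le[OF cop r app]) (use D dom in auto)
    also have "\<dots> \<le> (3 * real Q) * (2 * real H * (3 * real Q) * real Q
        + 4 * D\<^sup>2 * ((6 * real H * (real Q)\<^sup>2 / R + 1) * (14 * (2 * R * \<Lambda>))))"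
    proof (intro mult_mono add_mono mult_left_mono)
      have "R * 1 \<le> R * \<Lambda>" using R \<Lambda> by (intro mult_left_mono) auto
      then have "real Q \<le> R * \<Lambda>" using R(2) by linarith
      moreover have "R * (1 + ln R) \<le> R * \<Lambda>" using R \<Lambda>r unfolding R_def by (intro mult_left_mono) auto
      ultimately show "real Q + R * (1 + ln R) \<le> 2 * R * \<Lambda>" by simp
    qed (use q R lr \<Lambda> in \<open>auto simp: R_def\<close>)
    also have "\<dots> = 18 * (real H * real Q ^ 3) + 336 * (D\<^sup>2 * \<Lambda>) * (6 * (real H * real Q ^ 3) + R * real Q)"
      using R by (simp add: field_simps power2_eq_square power3_eq_cube)
    also have "\<dots> \<le> 18 * (real N / 8) + 336 * (D\<^sup>2 * \<Lambda>) * (6 * (real N / 8) + real N)"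
      using HN' R(3) DL by (intro add_mono mult_left_mono) auto
    also have "\<dots> \<le> 18 * (real N / 8) * (D\<^sup>2 * \<Lambda>) + 336 * (D\<^sup>2 * \<Lambda>) * (6 * (real N / 8) + real N)"
      using DL mult_left_mono[of 1 "D\<^sup>2 * \<Lambda>" "18 * (real N / 8)"] by (simp add: mult_ac)
    also have "\<dots> = (9/4 + 588) * (D\<^sup>2 * \<Lambda>) * real N" by (simp add: algebra_simps)
    also have "\<dots> \<le> 600 * (D\<^sup>2 * \<Lambda>) * real N" using DL by (intro mult_right_mono) auto
    finally show ?thesis .
  qed
  have h: "real H > 0" using H1 by simp
  have X0: "X \<ge> 0" by (auto simp: X_def intro: sum_nonneg)
  have "X ^ 4 \<le> real H ^ 3 * (600 * (D\<^sup>2 * \<Lambda>) * real N)"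
    unfolding X_def by (rule order.trans[OF power4_sum_le mult_left_mono[OF X4]]) simp
  also have "\<dots> \<le> real H ^ 3 * (600 * (D\<^sup>2 * \<Lambda>) * (16 * (real H * real Q ^ 3)))"
    using NH DL by (intro mult_left_mono) auto
  also have "\<dots> = 9600 * (D\<^sup>2 * \<Lambda>) * real Q ^ 3 * real H ^ 4"
    by (simp add: power_eq_if mult_ac)
  \<comment> \<open>The right side is made a perfect fourth power: \<open>9600 = 600 * 16\<close> is
    rounded up to \<open>10 ^ 4\<close>, and \<open>D\<^sup>2 * \<Lambda>\<close>, being at least 1,
    may be raised to its fourth power.\<close>
  also have "\<dots> \<le> 10000 * (D\<^sup>2 * \<Lambda>) ^ 4 * real Q ^ 3 * real H ^ 4"
  proof -
    have "D\<^sup>2 * \<Lambda> \<le> (D\<^sup>2 * \<Lambda>) ^ 4" using DL by (intro self_le_power) auto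
    then have "9600 * (D\<^sup>2 * \<Lambda>) \<le> 10000 * (D\<^sup>2 * \<Lambda>) ^ 4" using DL by linarith
    then show ?thesis by (intro mult_right_mono) auto
  qed
  also have "\<dots> = (10 * (D\<^sup>2 * \<Lambda>) * real Q powr (3/4) * real H) ^ 4"
  proof -
    have "(real Q powr (3/4)) ^ 4 = real Q ^ 3"
    proof -
      have "(real Q powr (3/4)) ^ 4 = real Q powr (3/4 * real 4)" using q by (intro powr_power[THEN trans]) auto
      also have "3/4 * real 4 = real 3" by simp
      also have "real Q powr real 3 = real Q ^ 3" using q by (intro powr_realpow) simp
      finally show ?thesis .
    qed
    then show ?thesis by (simp only: power_mult_distrib) simp
  qed
  finally have "X \<le> 10 * (D\<^sup>2 * \<Lambda>) * real Q powr (3/4) * real H"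
    using DL h by (intro power_le_imp_le_base[of X 3]) auto
  then have X: "8 / real H * X \<le> 80 * (D\<^sup>2 * \<Lambda>) * real Q powr (3/4)"
    using h by (simp add: field_simps)
  have "4 * real Q / real H \<le> 64 * real Q ^ 4 / real N"
    using NH h N q by (simp add: field_simps power_eq_if)
  moreover have "real (card {q\<in>{1..int Q}. int_dist (\<alpha> * of_int (q ^ 3)) \<le> real Q ^ 3 / real N})
    \<le> 4 * real Q / real H + 8 / real H * X"
    unfolding X_def using HN' N by (intro card_near_cubes_le) (use H1 in \<open>auto simp: field_simps\<close>)
  ultimately show ?thesis using X unfolding \<Lambda>_def by linarith
qed

section \<open>The major arcs\<close>

lemma card_le_fibres:
  assumes "finite S" "finite T" "f ` S \<subseteq> T"
    and "\<And>t. t \<in> T \<Longrightarrow> real (card {x\<in>S. f x = t}) \<le> B"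
  shows "real (card S) \<le> real (card T) * B"
proof -
  have "real (card S) = (\<Sum>x\<in>S. 1)" by simp
  also have "\<dots> = (\<Sum>t\<in>T. \<Sum>x\<in>{x. x \<in> S \<and> f x = t}. 1)"
    using sum.group[OF assms(1-3), of "\<lambda>_. 1::real"] by simp
  also have "\<dots> = (\<Sum>t\<in>T. real (card {x\<in>S. f x = t}))" by simp
  also have "\<dots> \<le> (\<Sum>t\<in>T. B)" by (intro sum_mono assms)
  finally show ?thesis by simp
qed

text \<open>Leaving out 0 keeps the count proportional to \<open>M / G\<close> with no additive 1,
  so that a divisor \<open>G > M\<close> contributes nothing.\<close>

lemma card_nonzero_multiples:
  fixes G M :: int
  assumes G: "G > 0" and M: "M \<ge> 0"
  shows "card {m\<in>{-M..M} - {0}. G dvd m} \<le> 2 * nat (M div G)"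
proof -
  let ?K = "{- (M div G)..M div G} - {0}"
  have "{m\<in>{-M..M} - {0}. G dvd m} \<subseteq> (\<lambda>k. G * k) ` ?K"
  proof
    fix m assume "m \<in> {m\<in>{-M..M} - {0}. G dvd m}"
    then obtain k where k: "m = G * k" "k \<noteq> 0" "- M \<le> G * k" "G * k \<le> M" by (auto simp: dvd_def)
    have "k \<le> M div G" using k(4) G zdiv_mono1[of "G * k" M G] by simp
    moreover have "(G * (- k)) div G \<le> M div G" using k(3) G by (intro zdiv_mono1) auto
    then have "- k \<le> M div G" using nonzero_mult_div_cancel_left[of G "- k"] G by simp
    ultimately show "m \<in> (\<lambda>k. G * k) ` ?K" using k by (intro image_eqI[of _ _ k]) auto
  qed
  then have "card {m\<in>{-M..M} - {0}. G dvd m} \<le> card ((\<lambda>k. G * k) ` ?K)" by (intro card_mono) auto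
  also have "\<dots> \<le> card ?K" by (rule card_image_le) simp
  also have "\<dots> = 2 * nat (M div G)" using pos_imp_zdiv_nonneg_iff[OF G, of M] M
    by (simp add: card_Diff_singleton_if nat_add_distrib)
  finally show ?thesis .
qed

text \<open>Write \<open>x = g * y\<close> and \<open>s = r / G\<close>. Comparison with one
  solution shows that \<open>y ^ 3\<close> is fixed modulo \<open>s\<close>, and \<open>y\<close> is
  a unit there, so it has at most \<open>P\<close> residues modulo \<open>s\<close>. Since
  \<open>y\<close> runs below \<open>r / g = (G / g) * s\<close>, each residue occurs at most
  \<open>G / g\<close> times.\<close>

lemma card_cubic_congruence_fixed_gcd:
  fixes b r g m :: int
  assumes cop: "coprime b r" and r: "r > 0" and g: "g > 0" "g dvd r"
    and P: "\<And>s c. s > 0 \<Longrightarrow> int s dvd r \<Longrightarrow> card (cube_roots s c) \<le> P"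
  defines "G \<equiv> gcd (g ^ 3) r"
  shows "card {x\<in>{0..<r}. gcd x r = g \<and> r dvd b * x ^ 3 + m} \<le> P * nat (G div g)"
proof (cases "{x\<in>{0..<r}. gcd x r = g \<and> r dvd b * x ^ 3 + m} = {}")
  case False
  let ?Y = "{x\<in>{0..<r}. gcd x r = g \<and> r dvd b * x ^ 3 + m}"
  obtain x0 where x0: "x0 \<in> ?Y" using False by blast
  have G0: "G > 0" using r by (simp add: G_def gcd_pos_int)
  have gG: "g dvd G" using g by (simp add: G_def)
  define s where "s = r div G"
  define k where "k = G div g"
  have rs: "r = G * s" by (simp add: s_def G_def)
  have Gk: "G = g * k" using gG by (simp add: k_def)
  have s0: "s > 0" using rs r G0 by (metis zero_less_mult_pos)
  have k0: "k > 0" using Gk g G0 by (metis zero_less_mult_pos)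
  \<comment> \<open>Cofactors of a gcd are coprime; this allows \<open>g ^ 3 div G\<close> to be
    cancelled from the congruence modulo \<open>s\<close>.\<close>
  have cg: "coprime (g ^ 3 div G) s"
    unfolding s_def G_def using r by (intro div_gcd_coprime) auto
  have g3: "g ^ 3 = G * (g ^ 3 div G)" by (simp add: G_def)
  have ex: "x = g * (x div g)" "coprime (x div g) s" if "x \<in> ?Y" for x
  proof -
    have gx: "gcd x r = g" using that by simp
    then have "g dvd x" by (metis gcd_dvd1)
    then show "x = g * (x div g)" by simp
    have "coprime (x div g) (r div g)"
      using div_gcd_coprime[of x r] r gx by auto
    moreover have "r div g = k * s" using rs Gk g by simp
    ultimately show "coprime (x div g) s" by simp
  qed
  have root: "(x div g) mod s \<in> cube_roots (nat s) ((x0 div g) ^ 3)" if x: "x \<in> ?Y" for x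
  proof -
    have "r dvd (b * x ^ 3 + m) - (b * x0 ^ 3 + m)" using x x0 by (intro dvd_diff) simp_all
    then have "r dvd b * (x ^ 3 - x0 ^ 3)" by (simp add: algebra_simps)
    then have "r dvd x ^ 3 - x0 ^ 3" using cop by (simp add: coprime_commute coprime_dvd_mult_right_iff)
    also have "x ^ 3 - x0 ^ 3 = g ^ 3 * ((x div g) ^ 3 - (x0 div g) ^ 3)"
      using ex(1)[OF x] ex(1)[OF x0] by (metis power_mult_distrib right_diff_distrib)
    also have "\<dots> = G * ((g ^ 3 div G) * ((x div g) ^ 3 - (x0 div g) ^ 3))" using g3 by (metis mult.assoc)
    finally have "s dvd (g ^ 3 div G) * ((x div g) ^ 3 - (x0 div g) ^ 3)" using rs G0 by simp
    then have "s dvd (x div g) ^ 3 - (x0 div g) ^ 3"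
      using cg by (simp add: coprime_commute coprime_dvd_mult_right_iff)
    then have "((x div g) mod s) ^ 3 mod s = (x0 div g) ^ 3 mod s"
      by (simp add: power_mod mod_eq_dvd_iff)
    then have "s dvd ((x div g) mod s) ^ 3 - (x0 div g) ^ 3" by (simp add: mod_eq_dvd_iff)
    then show ?thesis using s0 ex(2)[OF x] by (simp add: cube_roots_def)
  qed
  let ?f = "\<lambda>x. ((x div g) mod s, (x div g) div s)"
  have "inj_on ?f ?Y"
  proof (rule inj_onI)
    fix x y assume x: "x \<in> ?Y" and y: "y \<in> ?Y" and "?f x = ?f y"
    then have "x div g = y div g" by (metis mult_div_mod_eq prod.inject)
    then show "x = y" using ex(1)[OF x] ex(1)[OF y] by simp
  qed
  moreover have "?f ` ?Y \<subseteq> cube_roots (nat s) ((x0 div g) ^ 3) \<times> {0..<k}"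
  proof (rule image_subsetI, rule SigmaI)
    fix x assume x: "x \<in> ?Y"
    show "(x div g) mod s \<in> cube_roots (nat s) ((x0 div g) ^ 3)" by (rule root[OF x])
    have "g * (x div g) < g * (k * s)" using ex(1)[OF x] x rs Gk by (simp add: mult_ac)
    then have "x div g < k * s" using g by simp
    moreover have "x div g div s * s \<le> x div g"
      using s0 by (simp add: minus_mod_eq_div_mult[symmetric])
    ultimately have "x div g div s * s < k * s" by linarith
    then have "x div g div s < k" using s0 by simp
    moreover have "x div g div s \<ge> 0" using x g s0 by (simp add: pos_imp_zdiv_nonneg_iff)
    ultimately show "x div g div s \<in> {0..<k}" by simp
  qed
  ultimately have "card ?Y \<le> card (cube_roots (nat s) ((x0 div g) ^ 3) \<times> {0..<k})"
    by (intro card_inj_on_le) auto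
  also have "\<dots> = card (cube_roots (nat s) ((x0 div g) ^ 3)) * nat k" by (simp add: card_cartesian_product)
  also have "\<dots> \<le> P * nat k"
    using s0 rs by (intro mult_le_mono1 P) (auto simp: dvd_def mult.commute)
  finally show ?thesis unfolding k_def .
next
  case True
  show ?thesis unfolding True by simp
qed

text \<open>Here a common factor is compensated. For gcd \<open>g\<close> there may be
  \<open>P * (G / g)\<close> roots, but then \<open>G\<close> divides \<open>m\<close>, which leaves
  at most \<open>2 * (M div G)\<close> values of \<open>m\<close>. The product never exceeds
  \<open>2 * M * P\<close>, and each divisor of \<open>r\<close> contributes once.\<close>

lemma card_cubic_congruence_pairs:
  fixes b r M :: int
  assumes cop: "coprime b r" and r: "r > 0" and M: "M \<ge> 0"
    and P: "\<And>s c. s > 0 \<Longrightarrow> int s dvd r \<Longrightarrow> card (cube_roots s c) \<le> P"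
  shows "real (card {(m,x). m \<in> {-M..M} - {0} \<and> x \<in> {0..<r} \<and> r dvd b * x ^ 3 + m})
    \<le> real (card {d. d dvd nat r}) * (2 * of_int M * real P)"
proof -
  let ?T = "{(m,x). m \<in> {-M..M} - {0} \<and> x \<in> {0..<r} \<and> r dvd b * x ^ 3 + m}"
  have finT: "finite ?T" by (rule finite_subset[of _ "{-M..M} \<times> {0..<r}"]) auto
  show ?thesis
  proof (rule card_le_fibres[where f = "\<lambda>(m,x). nat (gcd x r)"])
    show "(\<lambda>(m,x). nat (gcd x r)) ` ?T \<subseteq> {d. d dvd nat r}"
      using r by (auto simp: nat_dvd_iff gcd_ge_0_int)
  next
    fix d assume "d \<in> {d. d dvd nat r}"
    then have d: "int d dvd r" "d > 0" using r by (auto simp: dvd_pos_nat int_dvd_int_iff[symmetric] intro: Nat.gr0I)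
    define g where "g = int d"
    define G where "G = gcd (g ^ 3) r"
    have g: "g > 0" "g dvd r" using d by (simp_all add: g_def)
    have G0: "G > 0" using r by (simp add: G_def gcd_pos_int)
    have gG: "g dvd G" using g by (simp add: G_def)
    let ?F = "{t\<in>?T. (case t of (m,x) \<Rightarrow> nat (gcd x r)) = d}"
    let ?m = "{m\<in>{-M..M} - {0}. G dvd m}"
    have F: "(m, x) \<in> ?F \<longleftrightarrow> m \<in> {-M..M} - {0} \<and> x \<in> {0..<r} \<and> gcd x r = g \<and> r dvd b * x ^ 3 + m" for m x
      using gcd_ge_0_int[of x r] by (auto simp: g_def)
    have "real (card ?F) \<le> real (card ?m) * real (P * nat (G div g))"
    proof (rule card_le_fibres[where f = fst])
      show "finite ?F" using finT by simp
      show "finite ?m" by (rule finite_subset[of _ "{-M..M}"]) auto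
      show "fst ` ?F \<subseteq> ?m"
      proof
        fix m assume "m \<in> fst ` ?F"
        then obtain x where x: "(m, x) \<in> ?F" by auto
        then have "g dvd x" unfolding F by (metis gcd_dvd1)
        then have "g ^ 3 dvd x ^ 3" by (rule dvd_power_same)
        then have "G dvd b * x ^ 3" unfolding G_def by (meson dvd_mult dvd_trans gcd_dvd1)
        moreover have "G dvd b * x ^ 3 + m" using x unfolding F G_def by (meson dvd_trans gcd_dvd2)
        ultimately have "G dvd m" using dvd_add_right_iff by blast
        then show "m \<in> ?m" using x unfolding F by simp
      qed
      fix m assume m: "m \<in> ?m"
      have "card {t \<in> ?F. fst t = m} \<le> card {x\<in>{0..<r}. gcd x r = g \<and> r dvd b * x ^ 3 + m}"
      proof (rule card_inj_on_le[where f = snd])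
        show "inj_on snd {t \<in> ?F. fst t = m}" by (auto simp: inj_on_def)
        show "snd ` {t \<in> ?F. fst t = m} \<subseteq> {x\<in>{0..<r}. gcd x r = g \<and> r dvd b * x ^ 3 + m}"
        proof
          fix x assume "x \<in> snd ` {t \<in> ?F. fst t = m}"
          then have "(m, x) \<in> ?F" by auto
          then show "x \<in> {x\<in>{0..<r}. gcd x r = g \<and> r dvd b * x ^ 3 + m}" unfolding F by simp
        qed
        show "finite {x\<in>{0..<r}. gcd x r = g \<and> r dvd b * x ^ 3 + m}"
          by (rule finite_subset[of _ "{0..<r}"]) auto
      qed
      also have "\<dots> \<le> P * nat (G div g)"
        unfolding G_def by (rule card_cubic_congruence_fixed_gcd[OF cop r g P])
      finally show "real (card {t \<in> ?F. fst t = m}) \<le> real (P * nat (G div g))" by (rule of_nat_mono)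
    qed
    also have "\<dots> \<le> real (2 * nat (M div G)) * real (P * nat (G div g))"
      by (intro mult_right_mono of_nat_mono card_nonzero_multiples G0 M) simp
    also have "\<dots> = 2 * (of_int (M div G) * of_int (G div g)) * real P"
      using M G0 g by (simp add: pos_imp_zdiv_nonneg_iff)
    also have "\<dots> \<le> 2 * of_int M * real P"
    proof -
      have "G div g * 1 \<le> G div g * g" using G0 g by (intro mult_left_mono) (auto simp: pos_imp_zdiv_nonneg_iff)
      then have "G div g \<le> G" using gG by simp
      then have "M div G * (G div g) \<le> M div G * G"
        using M G0 by (intro mult_left_mono) (auto simp: pos_imp_zdiv_nonneg_iff)
      also have "\<dots> \<le> M" using G0 by (simp add: div_times_less_eq_dividend minus_mod_eq_div_mult[symmetric])
      finally have "real_of_int (M div G) * of_int (G div g) \<le> of_int M"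
        by (metis of_int_le_iff of_int_mult)
      then show ?thesis by (intro mult_right_mono) auto
    qed
    finally show "real (card ?F) \<le> 2 * of_int M * real P" .
  qed (use finT r in auto)
qed

text \<open>The usual \<open>\<delta> / r + 1\<close>, where the 1 is absorbed because the window is
  at least one period long.\<close>

lemma card_residue_class_le:
  fixes E :: "int set" and \<delta> :: real
  assumes fin: "finite E" and r: "r > 0" and \<delta>: "of_int r \<le> \<delta>"
    and cong: "\<And>q q'. q \<in> E \<Longrightarrow> q' \<in> E \<Longrightarrow> r dvd q - q'"
    and near: "\<And>q q'. q \<in> E \<Longrightarrow> q' \<in> E \<Longrightarrow> of_int (q - q') \<le> \<delta>"
  shows "real (card E) \<le> 2 * \<delta> / of_int r"
proof (cases "E = {}")
  case False
  define q0 where "q0 = Min E"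
  have q0: "q0 \<in> E" "\<And>q. q \<in> E \<Longrightarrow> q0 \<le> q" using fin False by (auto simp: q0_def)
  have r0: "real_of_int r > 0" using r by simp
  have "card E \<le> card {0..\<lfloor>\<delta> / of_int r\<rfloor>}"
  proof (rule card_inj_on_le[where f = "\<lambda>q. (q - q0) div r"])
    show "inj_on (\<lambda>q. (q - q0) div r) E"
      by (rule inj_onI) (metis cong q0(1) diff_add_cancel dvd_div_mult_self)
    show "(\<lambda>q. (q - q0) div r) ` E \<subseteq> {0..\<lfloor>\<delta> / of_int r\<rfloor>}"
    proof (rule image_subsetI)
      fix q assume q: "q \<in> E"
      have "real_of_int ((q - q0) div r) = of_int (q - q0) / of_int r"
        using cong[OF q q0(1)] by (rule real_of_int_div)
      also have "\<dots> \<le> \<delta> / of_int r" using near[OF q q0(1)] r0 by (intro divide_right_mono) auto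
      finally have "(q - q0) div r \<le> \<lfloor>\<delta> / of_int r\<rfloor>" by (simp add: le_floor_iff)
      moreover have "(q - q0) div r \<ge> 0" using q0(2)[OF q] r by (simp add: pos_imp_zdiv_nonneg_iff)
      ultimately show "(q - q0) div r \<in> {0..\<lfloor>\<delta> / of_int r\<rfloor>}" by simp
    qed
  qed simp
  also have "\<dots> = nat (\<lfloor>\<delta> / of_int r\<rfloor> + 1)" by simp
  finally have "real (card E) \<le> real (nat (\<lfloor>\<delta> / of_int r\<rfloor> + 1))" by (rule of_nat_mono)
  also have "\<dots> \<le> \<delta> / of_int r + 1" using \<delta> r0 by (simp add: zero_le_divide_iff)
  also have "\<dots> \<le> 2 * \<delta> / of_int r" using \<delta> r0 by (simp add: field_simps)
  finally show ?thesis .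
qed (use r \<delta> in simp)

lemma card_cubic_congruence_short:
  fixes b r M :: int and S :: "(int \<times> int) set" and \<delta> :: real
  assumes cop: "coprime b r" and r: "r > 0" and M: "M \<ge> 0" and \<delta>: "of_int r \<le> \<delta>"
    and P: "\<And>s c. s > 0 \<Longrightarrow> int s dvd r \<Longrightarrow> card (cube_roots s c) \<le> P"
    and fin: "finite S"
    and S: "\<And>m q. (m, q) \<in> S \<Longrightarrow> m \<in> {-M..M} - {0} \<and> r dvd b * q ^ 3 + m"
    and near: "\<And>m q q'. (m, q) \<in> S \<Longrightarrow> (m, q') \<in> S \<Longrightarrow> of_int (q - q') \<le> \<delta>"
  shows "real (card S) \<le> 4 * (real (card {d. d dvd nat r}) * real P) * of_int M * (\<delta> / of_int r)"
proof -
  let ?T = "{(m,x). m \<in> {-M..M} - {0} \<and> x \<in> {0..<r} \<and> r dvd b * x ^ 3 + m}"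
  have finT: "finite ?T" by (rule finite_subset[of _ "{-M..M} \<times> {0..<r}"]) auto
  have r0: "real_of_int r > 0" using r by simp
  have "real (card S) \<le> real (card ?T) * (2 * \<delta> / of_int r)"
  proof (rule card_le_fibres[OF fin finT, where f = "\<lambda>(m,q). (m, q mod r)"])
    show "(\<lambda>(m,q). (m, q mod r)) ` S \<subseteq> ?T"
    proof
      fix t assume "t \<in> (\<lambda>(m,q). (m, q mod r)) ` S"
      then obtain m q where mq: "(m, q) \<in> S" "t = (m, q mod r)" by auto
      have "(b * (q mod r) ^ 3 + m) mod r = (b * q ^ 3 + m) mod r"
        by (rule mod_add_cong[OF mod_mult_cong[OF refl power_mod] refl])
      then have "r dvd b * (q mod r) ^ 3 + m" using S[OF mq(1)] by (metis dvd_eq_mod_eq_0)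
      then show "t \<in> ?T" using S[OF mq(1)] mq r by simp
    qed
    fix t assume "t \<in> ?T"
    obtain m x where t: "t = (m, x)" by (cases t)
    let ?E = "{q. (m, q) \<in> S \<and> q mod r = x}"
    have finE: "finite ?E" by (rule finite_subset[of _ "snd ` S"]) (use fin in force)+
    have "card {y \<in> S. (case y of (m, q) \<Rightarrow> (m, q mod r)) = t} \<le> card ?E"
      by (rule card_inj_on_le[where f = snd]) (use finE t in \<open>auto simp: inj_on_def\<close>)
    also have "real (card ?E) \<le> 2 * \<delta> / of_int r"
      by (rule card_residue_class_le[OF finE r \<delta>]) (use near in \<open>auto simp: mod_eq_dvd_iff[symmetric]\<close>)
    finally show "real (card {y \<in> S. (case y of (m, q) \<Rightarrow> (m, q mod r)) = t}) \<le> 2 * \<delta> / of_int r"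
      by simp
  qed
  also have "\<dots> \<le> (real (card {d. d dvd nat r}) * (2 * of_int M * real P)) * (2 * \<delta> / of_int r)"
    using r0 \<delta> by (intro mult_right_mono card_cubic_congruence_pairs[OF cop r M P]) auto
  finally show ?thesis by (simp add: mult_ac)
qed

text \<open>The numerator is any integer, so nearness is meant on the real line and not modulo 1.
  Coprimality to \<open>q\<close> is the same as to \<open>q ^ 3\<close>, so the fractions are in
  lowest terms.\<close>

definition near_fractions :: "nat \<Rightarrow> nat \<Rightarrow> real \<Rightarrow> (int \<times> int) set" where
  "near_fractions N Q \<alpha> = {(a, q). q \<in> {1..int Q} \<and> coprime a q \<and> \<bar>of_int a / of_int (q ^ 3) - \<alpha>\<bar> \<le> 1 / real N}"

lemma cube_le_imp_le:
  fixes x y t :: real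
  assumes "y ^ 3 \<le> (1 + t) * x ^ 3" "x \<ge> 0" "t \<ge> 0"
  shows "y \<le> (1 + t) * x"
proof -
  have "(1 + t) * x ^ 3 \<le> (1 + t) ^ 3 * x ^ 3"
    using assms by (intro mult_right_mono self_le_power) auto
  then have "y ^ 3 \<le> ((1 + t) * x) ^ 3" using assms by (simp add: power_mult_distrib)
  then show ?thesis using assms by (intro power_le_imp_le_base[of y 2]) auto
qed

text \<open>In the coordinates \<open>(m, q)\<close> nearness says that
  \<open>m / (r * q ^ 3)\<close> is within \<open>\<Delta>\<close> of \<open>z\<close>. This bounds
  \<open>m\<close> by \<open>M\<close> and, once \<open>z\<close> dominates \<open>\<Delta>\<close>,
  ties \<open>q ^ 3\<close> to \<open>m / (r * z)\<close>.\<close>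

lemma major_arc_bound:
  fixes \<alpha> :: real and b r :: int
  assumes cop: "coprime b r" and r: "r > 0" and N: "N > 0" and rQ: "r \<le> int Q"
    and app: "\<bar>\<alpha> - of_int b / of_int r\<bar> \<le> 2 * real Q / (of_int r * real N)"
    and P: "\<And>s c. s > 0 \<Longrightarrow> int s dvd r \<Longrightarrow> card (cube_roots s c) \<le> P"
  shows "real (card (near_fractions N Q \<alpha>)) \<le> 1 + 32 * (real (card {d. d dvd nat r}) * real P) * (real Q ^ 4 / real N)"
proof -
  define z where "z = \<alpha> - of_int b / of_int r"
  define \<Delta> where "\<Delta> = 1 / real N"
  define \<phi> where "\<phi> = (\<lambda>(a, q). (a * r - b * q ^ 3, q::int))"
  define S0 where "S0 = near_fractions N Q \<alpha>"
  define S where "S = {t \<in> \<phi> ` S0. fst t \<noteq> 0}"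
  define Y where "Y = real (card {d. d dvd nat r}) * real P"
  have \<Delta>: "\<Delta> > 0" using N by (simp add: \<Delta>_def)
  have r0: "real_of_int r > 0" using r by simp
  have Q0: "real Q > 0" using rQ r by simp
  have rQ': "of_int r \<le> real Q" using rQ by (metis of_int_le_iff of_int_of_nat_eq)
  have inj: "inj \<phi>" using r by (auto simp: \<phi>_def inj_def)
  have w: "\<bar>of_int m / (of_int r * of_int q ^ 3) - z\<bar> \<le> \<Delta>" "q \<ge> 1" "q \<le> int Q" "r dvd b * q ^ 3 + m"
    if mq: "(m, q) \<in> \<phi> ` S0" for m q
  proof -
    obtain a where a: "(a, q) \<in> S0" "m = a * r - b * q ^ 3" using mq by (auto simp: \<phi>_def)
    show q: "q \<ge> 1" "q \<le> int Q" using a by (auto simp: S0_def near_fractions_def)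
    show "r dvd b * q ^ 3 + m" using a by simp
    have "of_int m / (of_int r * of_int q ^ 3) = of_int a / real_of_int (q ^ 3) - of_int b / of_int r"
    proof -
      have "real_of_int m = of_int a * of_int r - of_int b * of_int q ^ 3" by (simp add: a(2))
      then show ?thesis using q r0 by (simp add: field_simps)
    qed
    then show "\<bar>of_int m / (of_int r * of_int q ^ 3) - z\<bar> \<le> \<Delta>"
      using a(1) unfolding S0_def near_fractions_def z_def \<Delta>_def by simp
  qed
  have mbound: "\<bar>real_of_int m\<bar> \<le> (\<bar>z\<bar> + \<Delta>) * (of_int r * real Q ^ 3)" if mq: "(m, q) \<in> \<phi> ` S0" for m q
  proof -
    have q: "of_int q > (0::real)" "of_int q \<le> real Q" using w(2,3)[OF mq] by linarith+
    have "\<bar>of_int m / (of_int r * of_int q ^ 3)\<bar> \<le> \<bar>z\<bar> + \<Delta>" using w(1)[OF mq] by linarith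
    then have "\<bar>real_of_int m\<bar> \<le> (\<bar>z\<bar> + \<Delta>) * (of_int r * of_int q ^ 3)"
      using q r0 by (simp add: abs_divide abs_mult field_simps)
    also have "\<dots> \<le> (\<bar>z\<bar> + \<Delta>) * (of_int r * real Q ^ 3)"
      using q r0 \<Delta> by (intro mult_left_mono power_mono) auto
    finally show ?thesis .
  qed
  define M where "M = \<lfloor>(\<bar>z\<bar> + \<Delta>) * (of_int r * real Q ^ 3)\<rfloor>"
  have M0: "M \<ge> 0" using \<Delta> r0 by (simp add: M_def)
  have Mle: "real_of_int M \<le> (\<bar>z\<bar> + \<Delta>) * (of_int r * real Q ^ 3)" by (simp add: M_def)
  have mM: "m \<in> {-M..M}" if mq: "(m, q) \<in> \<phi> ` S0" for m q
    using mbound[OF mq] unfolding M_def by (auto simp: le_floor_iff) linarith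
  have finI: "finite (\<phi> ` S0)"
  proof (rule finite_subset)
    show "\<phi> ` S0 \<subseteq> {-M..M} \<times> {1..int Q}" using mM w(2,3) by fastforce
  qed simp
  have finS: "finite S" using finI by (simp add: S_def)
  have SI: "(m, q) \<in> S \<Longrightarrow> (m, q) \<in> \<phi> ` S0" for m q by (simp add: S_def)
  have Y0: "Y \<ge> 0" by (simp add: Y_def)
  \<comment> \<open>If \<open>a * r = b * q ^ 3\<close> then both fractions are in lowest terms, so \<open>q ^ 3 = r\<close>.\<close>
  have diag: "card {t \<in> \<phi> ` S0. fst t = 0} \<le> 1"
  proof -
    have "x = y" if x: "x \<in> {t \<in> \<phi> ` S0. fst t = 0}" and y: "y \<in> {t \<in> \<phi> ` S0. fst t = 0}" for x y
    proof -
      have key: "\<exists>q. t = (0, q) \<and> q ^ 3 = r \<and> q \<ge> 1" if "t \<in> {t \<in> \<phi> ` S0. fst t = 0}" for t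
      proof -
        obtain a q where aq: "(a, q) \<in> S0" "t = (a * r - b * q ^ 3, q)" "a * r = b * q ^ 3"
          using \<open>t \<in> _\<close> by (auto simp: \<phi>_def)
        have c: "coprime a q" "q \<ge> 1" using aq(1) by (auto simp: S0_def near_fractions_def)
        have "q ^ 3 dvd a * r" using aq(3) by simp
        then have 1: "q ^ 3 dvd r" using c(1) by (simp add: coprime_commute coprime_dvd_mult_right_iff)
        have "r dvd b * q ^ 3" using aq(3) by (metis dvd_triv_right)
        then have "r dvd q ^ 3" using cop by (simp add: coprime_commute coprime_dvd_mult_right_iff)
        then have "q ^ 3 = r" using 1 r c(2) by (simp add: zdvd_antisym_nonneg)
        then show ?thesis using aq c by auto
      qed
      obtain q q' where q: "x = (0, q)" "q ^ 3 = r" "q \<ge> 1" "y = (0, q')" "q' ^ 3 = r" "q' \<ge> 1"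
        using key[OF x] key[OF y] by blast
      then have "q = q'" using power_eq_imp_eq_base[of q 3 q'] by simp
      then show "x = y" using q by simp
    qed
    then show ?thesis by (intro card_le_Suc0_iff_eq[THEN iffD2, simplified One_nat_def[symmetric]]) (use finI in auto)
  qed
  have "real (card S) \<le> 32 * Y * (real Q ^ 4 / real N)"
  \<comment> \<open>If \<open>z\<close> is no larger than \<open>2 * \<Delta>\<close>, a given
    \<open>m\<close> need not localise \<open>q\<close> and the window is all of
    \<open>{1..Q}\<close>, of length at least \<open>r\<close>; in return
    \<open>M \<le> 3 * \<Delta> * r * Q ^ 3\<close>. Otherwise
    \<open>M \<le> 2 * \<bar>z\<bar> * r * Q ^ 3\<close>, and 32 is
    \<open>4 * 2 * 4\<close>.\<close>
  proof (cases "\<bar>z\<bar> \<le> 2 * \<Delta>")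
    case True
    have "real (card S) \<le> 4 * Y * of_int M * (real Q / of_int r)"
      unfolding Y_def
    proof (rule card_cubic_congruence_short[OF cop r M0 rQ' P finS])
      show "m \<in> {-M..M} - {0} \<and> r dvd b * q ^ 3 + m" if "(m, q) \<in> S" for m q
        using mM[OF SI[OF that]] w(4)[OF SI[OF that]] that by (simp add: S_def)
      show "of_int (q - q') \<le> real Q" if "(m, q) \<in> S" "(m, q') \<in> S" for m q q'
        using w(2,3)[OF SI[OF that(1)]] w(2,3)[OF SI[OF that(2)]] by linarith
    qed
    also have "\<dots> \<le> 4 * Y * ((\<bar>z\<bar> + \<Delta>) * (of_int r * real Q ^ 3)) * (real Q / of_int r)"
      using Mle Y0 r0 Q0 by (intro mult_right_mono mult_left_mono) auto
    also have "\<dots> \<le> 4 * Y * ((3 * \<Delta>) * (of_int r * real Q ^ 3)) * (real Q / of_int r)"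
      using True Y0 r0 Q0 by (intro mult_right_mono mult_left_mono) auto
    also have "\<dots> = 12 * Y * (real Q ^ 4 / real N)"
      using r0 N by (simp add: \<Delta>_def field_simps power_eq_if)
    also have "\<dots> \<le> 32 * Y * (real Q ^ 4 / real N)" using Y0 by (intro mult_right_mono) auto
    finally show ?thesis .
  next
    case False
    then have z: "\<bar>z\<bar> > 2 * \<Delta>" by simp
    then have z0: "\<bar>z\<bar> > 0" using \<Delta> by linarith
    \<comment> \<open>With \<open>t = \<Delta> / \<bar>z\<bar>\<close>, the size of
      \<open>m / (r * q ^ 3)\<close> lies between \<open>(1 - t) * \<bar>z\<bar>\<close> and
      \<open>(1 + t) * \<bar>z\<bar>\<close>, so two values of \<open>q\<close> with the same
      \<open>m\<close> have ratio at most \<open>1 + 4 * t\<close>. The bound on \<open>z\<close>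
      from \<open>app\<close> makes this window longer than \<open>r\<close>.\<close>
    define \<delta> where "\<delta> = 4 * real Q * (\<Delta> / \<bar>z\<bar>)"
    have \<delta>: "of_int r \<le> \<delta>"
    proof -
      have "\<bar>z\<bar> * (of_int r * real N) \<le> 2 * real Q"
        using app r0 N by (simp add: z_def pos_le_divide_eq)
      moreover have "\<bar>z\<bar> * (of_int r * real N) \<ge> 0" using r0 by simp
      ultimately have "\<bar>z\<bar> * (of_int r * real N) \<le> 4 * real Q" by linarith
      then show ?thesis using z0 N by (simp add: \<delta>_def \<Delta>_def field_simps)
    qed
    have "real (card S) \<le> 4 * Y * of_int M * (\<delta> / of_int r)"
      unfolding Y_def
    proof (rule card_cubic_congruence_short[OF cop r M0 \<delta> P finS])
      show "m \<in> {-M..M} - {0} \<and> r dvd b * q ^ 3 + m" if "(m, q) \<in> S" for m q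
        using mM[OF SI[OF that]] w(4)[OF SI[OF that]] that by (simp add: S_def)
      show "of_int (q' - q) \<le> \<delta>" if S': "(m, q') \<in> S" and S: "(m, q) \<in> S" for m q q'
      proof -
        define t where "t = \<Delta> / \<bar>z\<bar>"
        have t: "0 \<le> t" "t \<le> 1/2" "\<Delta> = t * \<bar>z\<bar>" using \<Delta> z z0 by (auto simp: t_def field_simps)
        have q: "real_of_int q > 0" "real_of_int q \<le> real Q" "real_of_int q' > 0"
          using w(2,3)[OF SI[OF S]] w(2,3)[OF SI[OF S']] by linarith+
        define A where "A = \<bar>real_of_int m\<bar> / of_int r"
        have A1: "A \<le> (1 + t) * \<bar>z\<bar> * of_int q ^ 3"
        proof -
          have "\<bar>of_int m / (of_int r * of_int q ^ 3)\<bar> \<le> (1 + t) * \<bar>z\<bar>"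
            using w(1)[OF SI[OF S]] t(3) by (simp add: algebra_simps)
          then show ?thesis using q r0 by (simp add: A_def abs_divide abs_mult field_simps)
        qed
        have A2: "(1 - t) * \<bar>z\<bar> * of_int q' ^ 3 \<le> A"
        proof -
          have "(1 - t) * \<bar>z\<bar> \<le> \<bar>of_int m / (of_int r * of_int q' ^ 3)\<bar>"
          proof -
            have gen: "\<bar>z\<bar> - \<Delta> \<le> \<bar>x\<bar>" if "\<bar>x - z\<bar> \<le> \<Delta>" for x using that by linarith
            have "(1 - t) * \<bar>z\<bar> = \<bar>z\<bar> - \<Delta>" using t(3) by (simp add: algebra_simps)
            moreover have "\<bar>z\<bar> - \<Delta> \<le> \<bar>of_int m / (of_int r * of_int q' ^ 3)\<bar>"
              by (rule gen[OF w(1)[OF SI[OF S']]])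
            ultimately show ?thesis by simp
          qed
          then show ?thesis using q r0 by (simp add: A_def abs_divide abs_mult field_simps)
        qed
        have "\<bar>z\<bar> * ((1 - t) * of_int q' ^ 3) \<le> \<bar>z\<bar> * ((1 + t) * of_int q ^ 3)"
          using A1 A2 by (simp add: mult_ac)
        then have "(1 - t) * of_int q' ^ 3 \<le> (1 + t) * real_of_int q ^ 3" using z0 by simp
        also have "\<dots> \<le> ((1 - t) * (1 + 4 * t)) * real_of_int q ^ 3"
        proof (rule mult_right_mono)
          \<comment> \<open>The difference of the two sides is \<open>2 * t - 4 * t\<^sup>2\<close>,
            nonnegative exactly for \<open>t\<close> up to \<open>1/2\<close>; hence the case split
            at \<open>2 * \<Delta>\<close>.\<close>
          have "t * t \<le> t * (1/2)" using t by (intro mult_left_mono) auto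
          then show "1 + t \<le> (1 - t) * (1 + 4 * t)" by (simp add: algebra_simps)
        qed (use q in simp)
        finally have "(1 - t) * of_int q' ^ 3 \<le> (1 - t) * ((1 + 4 * t) * real_of_int q ^ 3)" by (simp add: mult_ac)
        then have "real_of_int q' ^ 3 \<le> (1 + 4 * t) * real_of_int q ^ 3" using t by simp
        then have "real_of_int q' \<le> (1 + 4 * t) * of_int q" by (rule cube_le_imp_le) (use q(1) t(1) in simp_all)
        then have "of_int (q' - q) \<le> 4 * t * of_int q" by (simp add: algebra_simps)
        also have "\<dots> \<le> 4 * t * real Q" using q t by (intro mult_left_mono) auto
        finally show ?thesis by (simp add: \<delta>_def t_def mult_ac)
      qed
    qed
    also have "\<dots> \<le> 4 * Y * ((\<bar>z\<bar> + \<Delta>) * (of_int r * real Q ^ 3)) * (\<delta> / of_int r)"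
      using Mle Y0 r0 \<delta> by (intro mult_right_mono mult_left_mono) auto
    also have "\<dots> \<le> 4 * Y * ((2 * \<bar>z\<bar>) * (of_int r * real Q ^ 3)) * (\<delta> / of_int r)"
      using z \<Delta> Y0 r0 \<delta> by (intro mult_right_mono mult_left_mono) auto
    also have "\<dots> = 32 * Y * (real Q ^ 4 / real N)"
      using r0 N z0 by (simp add: \<delta>_def \<Delta>_def field_simps power_eq_if)
    finally show ?thesis .
  qed
  moreover have "card S0 \<le> card S + 1"
  proof -
    have "card S0 = card (\<phi> ` S0)" using inj by (metis card_image inj_on_subset subset_UNIV)
    also have "\<phi> ` S0 = S \<union> {t \<in> \<phi> ` S0. fst t = 0}" by (auto simp: S_def)
    also have "card \<dots> \<le> card S + card {t \<in> \<phi> ` S0. fst t = 0}" by (rule card_Un_le)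
    finally show ?thesis using diag by linarith
  qed
  ultimately show ?thesis
    unfolding S0_def Y_def by linarith
qed

section \<open>Fractions with cubic denominators in short intervals\<close>

lemma card_int_interval_le:
  fixes u v :: real
  assumes "u \<le> v"
  shows "real (card {\<lceil>u\<rceil>..\<lfloor>v\<rfloor>}) \<le> v - u + 1"
proof -
  have "real (card {\<lceil>u\<rceil>..\<lfloor>v\<rfloor>}) = max 0 (of_int \<lfloor>v\<rfloor> - of_int \<lceil>u\<rceil> + 1)" by simp
  then show ?thesis using assms le_of_int_ceiling[of u] of_int_floor_le[of v] by linarith
qed

lemma near_fractions_trivial_bound:
  assumes N: "N > 0"
  shows "finite (near_fractions N Q \<alpha>)"
    "real (card (near_fractions N Q \<alpha>)) \<le> real Q * (2 * real Q ^ 3 / real N + 1)"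
proof -
  define I where "I q = {\<lceil>of_int (q ^ 3) * (\<alpha> - 1 / real N)\<rceil>..\<lfloor>of_int (q ^ 3) * (\<alpha> + 1 / real N)\<rfloor>}" for q :: int
  have sub: "near_fractions N Q \<alpha> \<subseteq> (\<lambda>(q, a). (a, q)) ` (SIGMA q:{1..int Q}. I q)"
  proof
    fix t assume t: "t \<in> near_fractions N Q \<alpha>"
    obtain a q where aq: "t = (a, q)" by (cases t)
    have q: "q \<in> {1..int Q}" and near: "\<bar>of_int a / of_int (q ^ 3) - \<alpha>\<bar> \<le> 1 / real N"
      using t by (auto simp: aq near_fractions_def)
    have q0: "real_of_int (q ^ 3) > 0" using q by simp
    have "\<alpha> - 1 / real N \<le> of_int a / of_int (q ^ 3)" "of_int a / of_int (q ^ 3) \<le> \<alpha> + 1 / real N"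
      using near by linarith+
    then have "of_int (q ^ 3) * (\<alpha> - 1 / real N) \<le> of_int a" "of_int a \<le> of_int (q ^ 3) * (\<alpha> + 1 / real N)"
      using q0 by (simp_all add: pos_le_divide_eq pos_divide_le_eq mult.commute)
    then have "a \<in> I q" by (simp only: I_def atLeastAtMost_iff ceiling_le_iff le_floor_iff)
    then show "t \<in> (\<lambda>(q, a). (a, q)) ` (SIGMA q:{1..int Q}. I q)" using q by (auto simp: aq)
  qed
  have fin: "finite (SIGMA q:{1..int Q}. I q)" by (auto simp: I_def)
  show "finite (near_fractions N Q \<alpha>)" using sub fin by (meson finite_imageI finite_subset)
  have "card (near_fractions N Q \<alpha>) \<le> card ((\<lambda>(q, a). (a, q)) ` (SIGMA q:{1..int Q}. I q))"
    using sub fin by (intro card_mono) auto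
  also have "\<dots> \<le> card (SIGMA q:{1..int Q}. I q)" using fin by (rule card_image_le)
  also have "\<dots> = (\<Sum>q\<in>{1..int Q}. card (I q))" by (rule card_SigmaI) (auto simp: I_def)
  finally have "real (card (near_fractions N Q \<alpha>)) \<le> real (\<Sum>q\<in>{1..int Q}. card (I q))" by (rule of_nat_mono)
  also have "\<dots> = (\<Sum>q\<in>{1..int Q}. real (card (I q)))" by simp
  also have "\<dots> \<le> (\<Sum>q\<in>{1..int Q}. 2 * real Q ^ 3 / real N + 1)"
  proof (rule sum_mono)
    fix q assume q: "q \<in> {1..int Q}"
    have q0: "real_of_int q \<ge> 0" "real_of_int q \<le> real Q" using q by auto
    then have q3: "real_of_int (q ^ 3) \<le> real Q ^ 3" "real_of_int (q ^ 3) \<ge> 0" by (simp_all add: power_mono)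
    have "real (card (I q)) \<le> of_int (q ^ 3) * (\<alpha> + 1 / real N) - of_int (q ^ 3) * (\<alpha> - 1 / real N) + 1"
      unfolding I_def using q3 N by (intro card_int_interval_le mult_left_mono) auto
    also have "\<dots> = 2 * of_int (q ^ 3) / real N + 1" by (simp add: algebra_simps)
    also have "\<dots> \<le> 2 * real Q ^ 3 / real N + 1" using q3 N by (intro add_right_mono divide_right_mono) auto
    finally show "real (card (I q)) \<le> 2 * real Q ^ 3 / real N + 1" .
  qed
  finally show "real (card (near_fractions N Q \<alpha>)) \<le> real Q * (2 * real Q ^ 3 / real N + 1)" by simp
qed

text \<open>Multiplication by \<open>q ^ 3\<close> puts the numerator within \<open>1/8\<close> of
  \<open>\<alpha> * q ^ 3\<close>, so each \<open>q\<close> carries at most one fraction.\<close>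

lemma card_near_fractions_le_card_near_cubes:
  assumes N: "8 * Q ^ 3 \<le> N" "N > 0"
  shows "card (near_fractions N Q \<alpha>) \<le> card {q\<in>{1..int Q}. int_dist (\<alpha> * of_int (q ^ 3)) \<le> real Q ^ 3 / real N}"
proof (rule card_inj_on_le[where f = snd])
  have N3: "real Q ^ 3 / real N \<le> 1/8"
    using of_nat_mono[OF N(1), where 'a = real] N(2) by (simp add: field_simps)
  have near: "\<bar>\<alpha> * of_int (q ^ 3) - of_int a\<bar> \<le> real Q ^ 3 / real N" "q \<in> {1..int Q}"
    if "(a, q) \<in> near_fractions N Q \<alpha>" for a q
  proof -
    show q: "q \<in> {1..int Q}" using that by (simp add: near_fractions_def)
    have q0: "real_of_int q \<ge> 0" "real_of_int q \<le> real Q" "real_of_int (q ^ 3) > 0" using q by auto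
    have "\<alpha> * of_int (q ^ 3) - of_int a = - (of_int (q ^ 3) * (of_int a / of_int (q ^ 3) - \<alpha>))"
      using q0 by (simp add: field_simps)
    then have "\<bar>\<alpha> * of_int (q ^ 3) - of_int a\<bar> = of_int (q ^ 3) * \<bar>of_int a / of_int (q ^ 3) - \<alpha>\<bar>"
      using q0(3) by (simp only: abs_minus_cancel abs_mult abs_of_pos)
    also have "\<dots> \<le> real Q ^ 3 * (1 / real N)"
      using that q0 by (intro mult_mono) (auto simp: near_fractions_def power_mono)
    finally show "\<bar>\<alpha> * of_int (q ^ 3) - of_int a\<bar> \<le> real Q ^ 3 / real N" by simp
  qed
  show "inj_on snd (near_fractions N Q \<alpha>)"
  proof (rule inj_onI)
    fix s t assume st: "s \<in> near_fractions N Q \<alpha>" "t \<in> near_fractions N Q \<alpha>" "snd s = snd t"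
    obtain a b q where ab: "s = (a, q)" "t = (b, q)" using st(3) by (cases s, cases t) auto
    have "\<bar>real_of_int a - of_int b\<bar> < 1"
      using near(1)[of a q] near(1)[of b q] st N3 unfolding ab by linarith
    then have "a = b" by linarith
    then show "s = t" unfolding ab by simp
  qed
  show "snd ` near_fractions N Q \<alpha> \<subseteq> {q\<in>{1..int Q}. int_dist (\<alpha> * of_int (q ^ 3)) \<le> real Q ^ 3 / real N}"
    using near int_dist_le order_trans by fastforce
  show "finite {q\<in>{1..int Q}. int_dist (\<alpha> * of_int (q ^ 3)) \<le> real Q ^ 3 / real N}"
    by (rule finite_subset[of _ "{1..int Q}"]) auto
qed

text \<open>Distinct fractions differ by at least \<open>1 / Q ^ 6\<close>, hence by
  \<open>1 / N\<close>. Offsets from \<open>\<alpha>\<close>, scaled by \<open>N\<close>, are thus 1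
  apart in \<open>[-1, 1]\<close> and have distinct floors; the floor 1 arises only at the right
  endpoint.\<close>

lemma card_near_fractions_small:
  assumes Q: "Q ^ 6 \<le> N" and N: "N > 0"
  shows "card (near_fractions N Q \<alpha>) \<le> 3"
proof -
  let ?f = "\<lambda>(a, q). \<lfloor>(of_int a / of_int (q ^ 3) - \<alpha>) * real N\<rfloor>"
  have "card (near_fractions N Q \<alpha>) \<le> card {-1..1::int}"
  proof (rule card_inj_on_le[where f = ?f])
    show "?f ` near_fractions N Q \<alpha> \<subseteq> {-1..1}"
    proof
      fix y assume "y \<in> ?f ` near_fractions N Q \<alpha>"
      then obtain a q where aq: "(a, q) \<in> near_fractions N Q \<alpha>" "y = \<lfloor>(of_int a / of_int (q ^ 3) - \<alpha>) * real N\<rfloor>" by auto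
      have "\<bar>of_int a / of_int (q ^ 3) - \<alpha>\<bar> * real N \<le> 1 / real N * real N"
        using aq(1) by (intro mult_right_mono) (simp_all add: near_fractions_def)
      then have "\<bar>(of_int a / of_int (q ^ 3) - \<alpha>) * real N\<bar> \<le> 1" using N by (simp add: abs_mult)
      then show "y \<in> {-1..1}" unfolding aq(2) by (simp add: abs_le_iff le_floor_iff floor_le_iff)
    qed
    show "inj_on ?f (near_fractions N Q \<alpha>)"
    proof (rule inj_onI, rule ccontr)
      fix s t assume st: "s \<in> near_fractions N Q \<alpha>" "t \<in> near_fractions N Q \<alpha>" "?f s = ?f t" "s \<noteq> t"
      obtain a q a' q' where aq: "s = (a, q)" "t = (a', q')" by (cases s, cases t)
      have q: "1 \<le> q" "q \<le> int Q" "coprime a q" "1 \<le> q'" "q' \<le> int Q" "coprime a' q'"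
        using st by (auto simp: aq near_fractions_def)
      define d where "d = a * q' ^ 3 - a' * q ^ 3"
      have "d \<noteq> 0"
      proof
        assume "d = 0"
        then have eq: "a * q' ^ 3 = a' * q ^ 3" by (simp add: d_def)
        have "q ^ 3 dvd a * q' ^ 3" using eq by simp
        then have 1: "q ^ 3 dvd q' ^ 3" using q(3) by (simp add: coprime_commute coprime_dvd_mult_right_iff)
        have "q' ^ 3 dvd a' * q ^ 3" using eq by (metis dvd_triv_right)
        then have "q' ^ 3 dvd q ^ 3" using q(6) by (simp add: coprime_commute coprime_dvd_mult_right_iff)
        then have "q ^ 3 = q' ^ 3" using 1 q by (simp add: zdvd_antisym_nonneg)
        then have "q = q'" using q power_eq_imp_eq_base[of q 3 q'] by simp
        then show False using eq q st(4) by (simp add: aq)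
      qed
      then have d1: "\<bar>real_of_int d\<bar> \<ge> 1" by linarith
      have qr: "0 < real_of_int q" "real_of_int q \<le> real Q" "0 < real_of_int q'" "real_of_int q' \<le> real Q"
        using q by linarith+
      have "of_int q ^ 3 * of_int q' ^ 3 \<le> real Q ^ 3 * real Q ^ 3"
        using qr by (intro mult_mono power_mono) auto
      also have "\<dots> = real (Q ^ 6)" by (simp add: power_add[symmetric])
      also have "\<dots> \<le> real N" using Q by (rule of_nat_mono)
      finally have den: "of_int q ^ 3 * of_int q' ^ 3 \<le> real N" .
      have "(of_int a / of_int (q ^ 3) - \<alpha>) * real N - (of_int a' / of_int (q' ^ 3) - \<alpha>) * real N
         = of_int d * (real N / (of_int q ^ 3 * of_int q' ^ 3))"
        using qr by (simp add: d_def field_simps)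
      moreover have "\<bar>of_int d * (real N / (of_int q ^ 3 * of_int q' ^ 3))\<bar> \<ge> 1 * 1"
        unfolding abs_mult using d1 den qr by (intro mult_mono) auto
      moreover have "\<lfloor>(of_int a / of_int (q ^ 3) - \<alpha>) * real N\<rfloor> = \<lfloor>(of_int a' / of_int (q' ^ 3) - \<alpha>) * real N\<rfloor>"
        using st(3) by (simp add: aq)
      ultimately show False by linarith
    qed
  qed simp
  then show ?thesis by simp
qed

lemma card_near_fractions_bound:
  assumes eps: "\<epsilon> > 0"
  shows "\<exists>C\<ge>1. \<forall>N Q \<alpha>. 1 \<le> Q \<longrightarrow> Q\<^sup>2 \<le> N \<longrightarrow>
    real (card (near_fractions N Q \<alpha>)) \<le> C * real N powr \<epsilon> * (real Q powr (3/4) + real Q ^ 4 / real N)"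
proof -
  \<comment> \<open>In the minor arcs the squared divisor bound uses two thirds of
    \<open>\<epsilon>\<close> and the logarithm the last; in the major arcs the divisor and cube
    root bounds use one third each.\<close>
  define \<eta> where "\<eta> = \<epsilon> / 3"
  have \<eta>: "\<eta> > 0" using eps by (simp add: \<eta>_def)
  obtain C1 where C1: "C1 \<ge> 1" "\<And>n. n > 0 \<Longrightarrow> real (card {d::nat. d dvd n}) \<le> C1 * real n powr \<eta>"
    using divisor_bound[OF \<eta>] by blast
  obtain C2 where C2: "C2 \<ge> 1" "\<And>n c. n > 0 \<Longrightarrow> real (card (cube_roots n c)) \<le> C2 * real n powr \<eta>"
    using cube_roots_bound[OF \<eta>] by blast
  define C where "C = 80 * C1\<^sup>2 * C2 * (1 + 1 / \<eta>)"
  have e1: "1 + 1 / \<eta> \<ge> 1" using \<eta> by simp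
  have C1s: "C1\<^sup>2 \<ge> 1" "C1 \<le> C1\<^sup>2" using C1(1) by (auto intro: self_le_power)
  have Cge: "C \<ge> 80 * C1\<^sup>2 * (1 + 1 / \<eta>)" "C \<ge> 80 * (C1 * C2)" "C \<ge> 80"
  proof -
    have "80 * C1\<^sup>2 * (1 + 1 / \<eta>) * 1 \<le> 80 * C1\<^sup>2 * (1 + 1 / \<eta>) * C2"
      using C1s e1 C2(1) by (intro mult_left_mono) auto
    then show 1: "C \<ge> 80 * C1\<^sup>2 * (1 + 1 / \<eta>)" by (simp add: C_def mult_ac)
    have "(80 * (C1 * C2)) * 1 \<le> (80 * (C1\<^sup>2 * C2)) * (1 + 1 / \<eta>)"
      using C1s e1 C1(1) C2(1) by (intro mult_mono mult_left_mono mult_right_mono) auto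
    then show "C \<ge> 80 * (C1 * C2)" by (simp add: C_def mult_ac)
    have "80 * 1 * 1 \<le> 80 * C1\<^sup>2 * (1 + 1 / \<eta>)" using C1s e1 by (intro mult_mono) auto
    then show "C \<ge> 80" using 1 by simp
  qed
  have "real (card (near_fractions N Q \<alpha>)) \<le> C * real N powr \<epsilon> * (real Q powr (3/4) + real Q ^ 4 / real N)"
    if Q: "1 \<le> Q" and QN: "Q\<^sup>2 \<le> N" for N Q \<alpha>
  proof -
    have "1 \<le> Q\<^sup>2" using Q by simp
    then have N: "N > 0" using QN by linarith
    have n1: "real N \<ge> 1" using N by simp
    have q1: "real Q \<ge> 1" using Q by simp
    define E where "E = real N powr \<eta>"
    have E: "E \<ge> 1" "real N powr \<epsilon> = E ^ 3" unfolding E_def \<eta>_def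
      using n1 eps by (auto simp: ge_one_powr_ge_zero powr_power)
    have E3: "E ^ 3 \<ge> 1" "E ^ 3 \<ge> E\<^sup>2" using E(1) by (auto intro: power_increasing)
    define A where "A = real Q powr (3/4)"
    define B where "B = real Q ^ 4 / real N"
    have A: "A \<ge> 1" using q1 by (simp add: A_def ge_one_powr_ge_zero)
    have B: "B \<ge> 0" by (simp add: B_def)
    have mono: "x \<le> C * E ^ 3 * (A + B)" if "x \<le> c * F * (A + B)" "c \<le> C" "0 \<le> F" "F \<le> E ^ 3" "0 \<le> c" for x c F
      using that A B Cge(3) by (elim order_trans) (intro mult_right_mono mult_mono, auto)
    have "real (card (near_fractions N Q \<alpha>)) \<le> C * E ^ 3 * (A + B)"
    proof (cases "8 * Q ^ 3 \<le> N")
      case False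
      \<comment> \<open>For such \<open>N\<close> the trivial count \<open>2 * B + Q\<close>
        suffices, because \<open>Q \<le> 8 * B\<close>.\<close>
      have "real N \<le> real (8 * Q ^ 3)" using False by (intro of_nat_mono) simp
      then have "real Q * real N \<le> real Q * (8 * real Q ^ 3)" by (intro mult_left_mono) auto
      then have "real Q \<le> 8 * B" using N by (simp add: B_def field_simps power_eq_if)
      have "real (card (near_fractions N Q \<alpha>)) \<le> real Q * (2 * real Q ^ 3 / real N + 1)"
        by (rule near_fractions_trivial_bound[OF N])
      also have "\<dots> = 2 * B + real Q" by (simp add: B_def algebra_simps power_eq_if)
      also have "\<dots> \<le> 80 * 1 * (A + B)" using \<open>real Q \<le> 8 * B\<close> A B by simp
      finally show ?thesis by (rule mono) (use Cge E3 in auto)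
    next
      case True
      \<comment> \<open>Rounding down secures \<open>r * Q \<le> N\<close> for the minor arcs; the
        reverse bound \<open>N \<le> 2 * Q * T\<close> accounts for the 2 in the hypothesis of
        \<open>major_arc_bound\<close>.\<close>
      define T where "T = N div Q"
      have QQ: "Q \<le> N" using QN Q power_increasing[of 1 2 Q] by simp
      have T: "T > 0" using QQ Q by (simp add: T_def div_greater_zero_iff)
      have TQ: "T * Q \<le> N" by (simp add: T_def)
      have NT: "real N \<le> 2 * real Q * real T"
      proof -
        have "N mod Q < Q" using Q by simp
        moreover have "N = T * Q + N mod Q" by (simp add: T_def)
        moreover have "Q \<le> T * Q" using T by simp
        ultimately have "N \<le> T * Q + T * Q" by linarith
        then have "N \<le> 2 * Q * T" by (simp add: mult_ac)
        from of_nat_mono[OF this, where 'a = real] show ?thesis by simp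
      qed
      obtain b r where br: "coprime b r" "0 < r" "r \<le> int T" "\<bar>of_int r * \<alpha> - of_int b\<bar> < 1 / real T"
        using Dirichlet_approx_coprime[OF T, of \<alpha>] by metis
      have r0: "real_of_int r > 0" using br by simp
      have rT: "real_of_int r \<le> real T" using br(3) by linarith
      have "\<alpha> - of_int b / of_int r = (of_int r * \<alpha> - of_int b) / of_int r" using r0 by (simp add: field_simps)
      then have "\<bar>\<alpha> - of_int b / of_int r\<bar> = \<bar>of_int r * \<alpha> - of_int b\<bar> / of_int r"
        using r0 by (simp add: abs_divide)
      also have "\<dots> \<le> (1 / real T) / of_int r" using br(4) r0 by (intro divide_right_mono) auto
      finally have app: "\<bar>\<alpha> - of_int b / of_int r\<bar> \<le> 1 / (real T * of_int r)" by simp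
      have rN: "nat r \<le> N"
      proof -
        have "nat r \<le> T" using br by simp
        also have "T \<le> N" by (simp add: T_def)
        finally show ?thesis .
      qed
      have powN: "real n powr \<eta> \<le> E" if "n \<le> N" for n
        unfolding E_def using that \<eta> by (intro powr_mono2) auto
      show ?thesis
      proof (cases "r \<le> int Q")
        case rQ: True
        define P where "P = nat \<lfloor>C2 * E\<rfloor>"
        have P: "card (cube_roots s c) \<le> P" if "s > 0" "int s dvd r" for s c
        proof -
          have "int s \<le> r" using that br(2) by (intro zdvd_imp_le)
          then have "s \<le> N" using rN by linarith
          have "real (card (cube_roots s c)) \<le> C2 * real s powr \<eta>" using C2(2) that by blast
          also have "\<dots> \<le> C2 * E" using C2(1) powN[OF \<open>s \<le> N\<close>] by (intro mult_left_mono) auto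
          finally show ?thesis by (simp add: P_def le_nat_floor)
        qed
        have PE: "real P \<le> C2 * E" using C2(1) E(1) by (simp add: P_def)
        have dE: "real (card {d. d dvd nat r}) \<le> C1 * E"
          using C1(2)[of "nat r"] br(2) powN[OF rN] C1(1) by (smt (verit) mult_left_mono zero_less_nat_eq)
        have "1 / (real T * of_int r) \<le> 2 * real Q / (of_int r * real N)"
          using NT r0 T N by (simp add: field_simps)
        then have "\<bar>\<alpha> - of_int b / of_int r\<bar> \<le> 2 * real Q / (of_int r * real N)" using app by linarith
        from major_arc_bound[OF br(1,2) N rQ this P]
        have "real (card (near_fractions N Q \<alpha>)) \<le> 1 + 32 * (real (card {d. d dvd nat r}) * real P) * B"
          by (simp add: B_def)
        also have "\<dots> \<le> 1 + 32 * ((C1 * E) * (C2 * E)) * B"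
          using dE PE B C1(1) C2(1) E(1) by (intro add_left_mono mult_right_mono mult_left_mono mult_mono) auto
        also have "\<dots> = 1 + (32 * (C1 * C2)) * E\<^sup>2 * B" by (simp add: power2_eq_square)
        also have "\<dots> \<le> (80 * (C1 * C2)) * E\<^sup>2 * (A + B)"
        proof -
          have c: "C1 * C2 \<ge> 1" using C1(1) C2(1) mult_mono[of 1 C1 1 C2] by simp
          have e: "E\<^sup>2 \<ge> 1" using E(1) by simp
          have "1 \<le> (C1 * C2) * E\<^sup>2" using c e mult_mono[of 1 "C1 * C2" 1 "E\<^sup>2"] by simp
          then have ca: "1 \<le> (C1 * C2) * E\<^sup>2 * A" using A mult_mono[of 1 "(C1 * C2) * E\<^sup>2" 1 A] by simp
          have "0 \<le> (C1 * C2) * E\<^sup>2 * B" using c B C1(1) C2(1) by (intro mult_nonneg_nonneg) auto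
          then show ?thesis using ca by (simp add: algebra_simps)
        qed
        finally show ?thesis by (rule mono) (use Cge E3 C1(1) C2(1) in auto)
      next
        case rQ: False
        have app2: "\<bar>\<alpha> - of_int b / of_int r\<bar> \<le> 1 / (of_int r)\<^sup>2"
        proof -
          have "1 / (real T * of_int r) \<le> 1 / (of_int r * of_int r)"
            using rT r0 T by (intro frac_le mult_right_mono) auto
          then show ?thesis using app by (simp add: power2_eq_square)
        qed
        have rQN: "of_int r * real Q \<le> real N"
        proof -
          have "of_int r * real Q \<le> real T * real Q" using rT by (intro mult_right_mono) auto
          also have "\<dots> \<le> real N" using of_nat_mono[OF TQ, where 'a = real] by simp
          finally show ?thesis .
        qed
        have D: "real (card {d. d dvd n}) \<le> C1 * E" if "n \<in> {1..N}" for n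
          using C1(2)[of n] powN[of n] C1(1) that by (smt (verit) mult_left_mono atLeastAtMost_iff less_le_trans zero_less_one)
        have "C1 * E \<ge> 1" using C1(1) E(1) mult_mono[of 1 C1 1 E] by simp
        then have "real (card {q\<in>{1..int Q}. int_dist (\<alpha> * of_int (q ^ 3)) \<le> real Q ^ 3 / real N})
          \<le> 64 * real Q ^ 4 / real N + 80 * ((C1 * E)\<^sup>2 * (1 + ln (real N))) * real Q powr (3/4)"
          using rQ by (intro minor_arc_bound[OF br(1) app2 Q True _ rQN D]) auto
        moreover have "real (card (near_fractions N Q \<alpha>))
          \<le> real (card {q\<in>{1..int Q}. int_dist (\<alpha> * of_int (q ^ 3)) \<le> real Q ^ 3 / real N})"
          by (intro of_nat_mono card_near_fractions_le_card_near_cubes True N)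
        ultimately have "real (card (near_fractions N Q \<alpha>)) \<le> 64 * B + 80 * ((C1 * E)\<^sup>2 * (1 + ln (real N))) * A"
          by (simp add: A_def B_def)
        also have "\<dots> \<le> 64 * B + 80 * ((C1 * E)\<^sup>2 * ((1 + 1 / \<eta>) * E)) * A"
        proof -
          have "ln (real N) \<le> E / \<eta>" unfolding E_def using n1 \<eta> by (rule ln_powr_bound)
          then have "1 + ln (real N) \<le> (1 + 1 / \<eta>) * E" using E(1) by (simp add: algebra_simps)
          then show ?thesis using A by (intro add_left_mono mult_right_mono mult_left_mono) auto
        qed
        also have "\<dots> = 64 * B + (80 * C1\<^sup>2 * (1 + 1 / \<eta>)) * E ^ 3 * A"
          by (simp add: power_mult_distrib power2_eq_square power3_eq_cube)
        also have "\<dots> \<le> (80 * C1\<^sup>2 * (1 + 1 / \<eta>)) * E ^ 3 * (A + B)"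
        proof -
          have "80 * 1 * 1 * 1 \<le> 80 * C1\<^sup>2 * (1 + 1 / \<eta>) * E ^ 3"
            using C1s e1 E3 by (intro mult_mono) auto
          then have "80 * B \<le> 80 * C1\<^sup>2 * (1 + 1 / \<eta>) * E ^ 3 * B" using B by (intro mult_right_mono) auto
          then show ?thesis using B by (simp only: distrib_left)
        qed
        finally show ?thesis by (rule mono) (use Cge E3 E(1) e1 in auto)
      qed
    qed
    then show ?thesis using E(2) by (simp add: A_def B_def)
  qed
  moreover have "C \<ge> 1" using Cge(3) by simp
  ultimately show ?thesis by blast
qed

section \<open>Transfer to the sieve and comparison of exponents\<close>

lemma cubic_large_sieve_le:
  fixes a :: "int \<Rightarrow> complex"
  assumes N: "N > 0" and K: "\<And>\<alpha>. card (near_fractions N Q \<alpha>) \<le> K"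
  shows "(\<Sum>q = 1..Q. \<Sum>b | b \<in> {1..q^3} \<and> coprime b q.
      (norm (\<Sum>n = M+1..M + int N. a n * e (real b / real (q^3) * real_of_int n)))\<^sup>2)
    \<le> 9 * real K * real N * (\<Sum>n = M+1..M + int N. (norm (a n))\<^sup>2)"
proof -
  define X where "X = (SIGMA q:{1..Q}. {b. b \<in> {1..q^3} \<and> coprime b q})"
  define \<theta> where "\<theta> = (\<lambda>(q::nat, b::nat). real b / real (q^3))"
  have finX: "finite X" by (auto simp: X_def)
  have "card {i\<in>X. int_dist (\<theta> i - \<beta>) \<le> 1 / real N} \<le> K" for \<beta>
  proof -
    \<comment> \<open>The sieve counts modulo 1. Subtracting the integer nearest to
      \<open>\<theta> (q, b) - \<beta>\<close> moves the fraction beside \<open>\<beta>\<close> and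
      changes its numerator by a multiple of \<open>q ^ 3\<close>, which keeps it coprime to
      \<open>q\<close>.\<close>
    let ?g = "\<lambda>(q::nat, b::nat). (int b - round (\<theta> (q, b) - \<beta>) * int q ^ 3, int q)"
    have "card {i\<in>X. int_dist (\<theta> i - \<beta>) \<le> 1 / real N} \<le> card (near_fractions N Q \<beta>)"
    proof (rule card_inj_on_le[where f = ?g])
      show "finite (near_fractions N Q \<beta>)" by (rule near_fractions_trivial_bound[OF N])
      show "?g ` {i\<in>X. int_dist (\<theta> i - \<beta>) \<le> 1 / real N} \<subseteq> near_fractions N Q \<beta>"
      proof
        fix t assume "t \<in> ?g ` {i\<in>X. int_dist (\<theta> i - \<beta>) \<le> 1 / real N}"
        then obtain q b where qb: "(q, b) \<in> X" "int_dist (\<theta> (q, b) - \<beta>) \<le> 1 / real N" "t = ?g (q, b)" by auto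
        define k where "k = round (\<theta> (q, b) - \<beta>)"
        have q: "q \<in> {1..Q}" "coprime b q" using qb(1) by (auto simp: X_def)
        have t: "t = (int b - k * int q ^ 3, int q)" using qb(3) by (simp add: k_def)
        have "coprime (int b - k * int q ^ 3) (int q)"
        proof (rule coprimeI)
          fix c assume c: "c dvd int b - k * int q ^ 3" "c dvd int q"
          have cq: "c dvd k * int q ^ 3" using c(2) by (simp add: power3_eq_cube)
          have "c dvd int b" using dvd_add[OF c(1) cq] by simp
          moreover have "coprime (int b) (int q)" using q by simp
          ultimately show "is_unit c" using c(2) by (meson coprime_common_divisor)
        qed
        moreover have "of_int (int b - k * int q ^ 3) / of_int (int q ^ 3) - \<beta> = \<theta> (q, b) - \<beta> - of_int k"
          using q by (simp add: \<theta>_def field_simps)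
        then have "\<bar>of_int (int b - k * int q ^ 3) / of_int (int q ^ 3) - \<beta>\<bar> \<le> 1 / real N"
          using qb(2) unfolding int_dist_def k_def by simp
        ultimately show "t \<in> near_fractions N Q \<beta>" using q by (simp add: t near_fractions_def)
      qed
      show "inj_on ?g {i\<in>X. int_dist (\<theta> i - \<beta>) \<le> 1 / real N}"
      proof (rule inj_onI)
        fix s t assume st: "s \<in> {i\<in>X. int_dist (\<theta> i - \<beta>) \<le> 1 / real N}" "t \<in> {i\<in>X. int_dist (\<theta> i - \<beta>) \<le> 1 / real N}" "?g s = ?g t"
        obtain q b q' b' where c: "s = (q, b)" "t = (q', b')" by (cases s, cases t)
        have qq: "q = q'" using st(3) by (simp add: c)
        define k where "k = round (\<theta> (q, b) - \<beta>) - round (\<theta> (q, b') - \<beta>)"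
        have "int b - int b' = k * int q ^ 3" using st(3) by (simp add: c qq k_def algebra_simps)
        then have "int (q ^ 3) dvd int b - int b'" by simp
        \<comment> \<open>The numerators form one complete residue system modulo
          \<open>q ^ 3\<close>, so shifts by different integers cannot make two of them
          collide.\<close>
        moreover have "b \<in> {1..q^3}" "b' \<in> {1..q^3}" using st(1,2) by (auto simp: c X_def qq)
        then have "\<bar>int b - int b'\<bar> < int (q ^ 3)" unfolding atLeastAtMost_iff by linarith
        ultimately have "b = b'" using dvd_imp_le_int[of "int b - int b'" "int (q ^ 3)"] by fastforce
        then show "s = t" by (simp add: c qq)
      qed
    qed
    then show ?thesis using K[of \<beta>] by linarith
  qed
  from large_sieve[OF finX N this, where a = a and M = M]
  have "(\<Sum>i\<in>X. (norm (\<Sum>n=M+1..M+int N. a n * e (\<theta> i * of_int n)))\<^sup>2)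
    \<le> 9 * real K * real N * (\<Sum>n=M+1..M+int N. (norm (a n))\<^sup>2)" .
  moreover have "(\<Sum>i\<in>X. (norm (\<Sum>n=M+1..M+int N. a n * e (\<theta> i * of_int n)))\<^sup>2)
    = (\<Sum>q = 1..Q. \<Sum>b | b \<in> {1..q^3} \<and> coprime b q.
      (norm (\<Sum>n = M+1..M + int N. a n * e (real b / real (q^3) * real_of_int n)))\<^sup>2)"
    unfolding X_def \<theta>_def by (subst sum.Sigma) (auto intro!: sum.cong)
  ultimately show ?thesis by simp
qed

text \<open>Since \<open>6/5 - 3/4 = 9/20\<close>, the first term asks for
  \<open>N powr (1/10) \<le> Q powr (9/20)\<close>, and \<open>7/24 * 9/20 = 21/160\<close> exceeds
  \<open>1/10\<close>.\<close>

lemma large_range_estimate: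
  fixes N Q :: real
  assumes "1 \<le> N" "N powr (7/24) \<le> Q"
  shows "N * (Q powr (3/4) + Q ^ 4 / N) \<le> Q ^ 4 + N powr (9/10) * Q powr (6/5)"
proof -
  have Q: "Q > 0" using assms by (smt (verit) powr_gt_zero)
  have "N powr (1/10) \<le> N powr (7/24 * (9/20))" using assms by (intro powr_mono) auto
  also have "\<dots> = (N powr (7/24)) powr (9/20)" by (simp add: powr_powr)
  also have "\<dots> \<le> Q powr (9/20)" using assms by (intro powr_mono2) auto
  finally have "N powr (9/10) * N powr (1/10) * Q powr (3/4) \<le> N powr (9/10) * Q powr (9/20) * Q powr (3/4)"
    by (intro mult_right_mono mult_left_mono) auto
  also have "N powr (9/10) * N powr (1/10) = N" using assms by (simp add: powr_add[symmetric])
  also have "N powr (9/10) * Q powr (9/20) * Q powr (3/4) = N powr (9/10) * Q powr (6/5)"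
    by (simp add: mult.assoc powr_add[symmetric])
  finally show ?thesis using assms by (simp add: algebra_simps)
qed

text \<open>Since \<open>4 - 6/7 = 22/7\<close>, the second term asks for
  \<open>Q powr (22/7) \<le> N\<close>, and \<open>7/24 * 22/7 = 22/24\<close> is below 1.\<close>

lemma small_range_estimate:
  fixes N Q :: real
  assumes "1 \<le> N" "1 \<le> Q" "Q \<le> N powr (7/24)"
  shows "Q powr (3/4) + Q ^ 4 / N \<le> 2 * Q powr (6/7)"
proof -
  have "Q powr (22/7) \<le> (N powr (7/24)) powr (22/7)" using assms by (intro powr_mono2) auto
  also have "\<dots> = N powr (22/24)" by (simp add: powr_powr)
  also have "\<dots> \<le> N powr 1" using assms by (intro powr_mono) auto
  finally have "Q powr (22/7) * Q powr (6/7) \<le> N * Q powr (6/7)" using assms by (intro mult_right_mono) auto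
  also have "Q powr (22/7) * Q powr (6/7) = Q powr (real 4)" by (simp add: powr_add[symmetric])
  also have "\<dots> = Q ^ 4" using assms by (intro powr_realpow) auto
  finally have "Q ^ 4 / N \<le> Q powr (6/7)" using assms by (simp add: divide_le_eq mult.commute)
  moreover have "Q powr (3/4) \<le> Q powr (6/7)" using assms by (intro powr_mono) auto
  ultimately show ?thesis by linarith
qed

theorem theorem2:
  fixes \<epsilon> :: real
  assumes "\<epsilon> > 0"
  shows "\<exists>C>0. \<forall>(M::int) (N::nat) (Q::real) (a::int \<Rightarrow> complex).
    1 \<le> Q \<and> Q \<le> real N powr (1/2) \<longrightarrow>
      (let Z = (\<Sum>n = M+1..M + int N. (norm (a n))\<^sup>2);
           S = (\<Sum>q = 1..nat \<lfloor>Q\<rfloor>. \<Sum>b | b \<in> {1..q^3} \<and> coprime b q.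
                  (norm (\<Sum>n = M+1..M + int N. a n * e (real b / real (q^3) * real_of_int n)))\<^sup>2)
       in (real N powr (7/24) \<le> Q \<longrightarrow>
             S \<le> C * (real N powr \<epsilon> * (Q^4 + real N powr (9/10) * Q powr (6/5)) * Z)) \<and>
          (Q < real N powr (7/24) \<longrightarrow>
             S \<le> C * (real N * Q powr (6/7 + \<epsilon>) * Z)))"
proof -
  \<comment> \<open>The exponent \<open>\<epsilon> / 6\<close> is made for the case
    \<open>N < R ^ 6\<close>, where
    \<open>N powr (\<epsilon>/6) \<le> Q powr \<epsilon>\<close>.\<close>
  obtain C where C: "C \<ge> 1" "\<And>N Q \<alpha>. 1 \<le> Q \<Longrightarrow> Q\<^sup>2 \<le> N \<Longrightarrow>
      real (card (near_fractions N Q \<alpha>)) \<le> C * real N powr (\<epsilon>/6) * (real Q powr (3/4) + real Q ^ 4 / real N)"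
    using card_near_fractions_bound[of "\<epsilon>/6"] assms by auto
  \<comment> \<open>27 is 9 from the sieve times the at most 3 fractions when
    \<open>R ^ 6 \<le> N\<close>; the other cases need \<open>9 * C\<close> and
    \<open>18 * C\<close>.\<close>
  have main: "(real N powr (7/24) \<le> Q \<longrightarrow> S \<le> (27 * C) * (real N powr \<epsilon> * (Q^4 + real N powr (9/10) * Q powr (6/5)) * Z)) \<and>
      (Q < real N powr (7/24) \<longrightarrow> S \<le> (27 * C) * (real N * Q powr (6/7 + \<epsilon>) * Z))"
    if Q: "1 \<le> Q" "Q \<le> real N powr (1/2)"
      and Z_def: "Z = (\<Sum>n = M+1..M + int N. (norm (a n))\<^sup>2)"
      and S_def: "S = (\<Sum>q = 1..nat \<lfloor>Q\<rfloor>. \<Sum>b | b \<in> {1..q^3} \<and> coprime b q.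
                  (norm (\<Sum>n = M+1..M + int N. a n * e (real b / real (q^3) * real_of_int n)))\<^sup>2)"
    for M N Q a Z S
  proof -
    define R where "R = nat \<lfloor>Q\<rfloor>"
    have R: "1 \<le> R" "real R \<le> Q" using Q by (auto simp: R_def le_nat_floor)
    have N: "N > 0" using Q by (cases "N = 0") auto
    have n1: "real N \<ge> 1" using N by simp
    have Z: "Z \<ge> 0" unfolding Z_def by (intro sum_nonneg) simp
    have RN: "R\<^sup>2 \<le> N"
    proof -
      have "real R ^ 2 \<le> (real N powr (1/2)) ^ 2" using R Q by (intro power_mono) auto
      also have "\<dots> = real N" using N by (simp add: powr_half_sqrt)
      finally show ?thesis by (metis of_nat_le_iff of_nat_power)
    qed
    define A where "A = Q powr (3/4) + Q ^ 4 / real N"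
    define K where "K = nat \<lfloor>C * real N powr (\<epsilon>/6) * A\<rfloor>"
    have A0: "A \<ge> 0" using Q by (simp add: A_def)
    have CA0: "C * real N powr (\<epsilon>/6) * A \<ge> 0" using C(1) A0 by (intro mult_nonneg_nonneg) auto
    have KC: "real K \<le> C * real N powr (\<epsilon>/6) * A" using CA0 by (simp add: K_def)
    have "card (near_fractions N R \<alpha>) \<le> K" for \<alpha>
    proof -
      have "real (card (near_fractions N R \<alpha>)) \<le> C * real N powr (\<epsilon>/6) * (real R powr (3/4) + real R ^ 4 / real N)"
        using C(2) R(1) RN by blast
      also have "\<dots> \<le> C * real N powr (\<epsilon>/6) * A"
        unfolding A_def using C(1) R Q
        by (intro mult_left_mono add_mono powr_mono2 divide_right_mono power_mono) auto
      finally show ?thesis by (simp add: K_def le_nat_floor)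
    qed
    then have "S \<le> 9 * real K * real N * Z"
      unfolding S_def Z_def R_def[symmetric] by (rule cubic_large_sieve_le[OF N])
    also have "\<dots> \<le> 9 * (C * real N powr (\<epsilon>/6) * A) * real N * Z"
      using KC Z by (intro mult_right_mono mult_left_mono) auto
    finally have SA: "S \<le> 9 * C * (real N powr (\<epsilon>/6) * (real N * A) * Z)" by (simp add: mult_ac)
    show ?thesis
    proof (intro conjI impI)
      assume big: "real N powr (7/24) \<le> Q"
      define B where "B = Q^4 + real N powr (9/10) * Q powr (6/5)"
      have "real N * A \<le> B" unfolding A_def B_def by (rule large_range_estimate[OF n1 big])
      moreover have "real N powr (\<epsilon>/6) \<le> real N powr \<epsilon>" using n1 assms by (intro powr_mono) auto
      ultimately have "real N powr (\<epsilon>/6) * (real N * A) * Z \<le> real N powr \<epsilon> * B * Z"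
        using A0 Z by (intro mult_right_mono mult_mono) auto
      then have "9 * C * (real N powr (\<epsilon>/6) * (real N * A) * Z) \<le> 9 * C * (real N powr \<epsilon> * B * Z)"
        using C(1) by (intro mult_left_mono) auto
      also have "\<dots> \<le> 27 * C * (real N powr \<epsilon> * B * Z)"
        using C(1) Z Q by (intro mult_right_mono) (auto simp: B_def)
      finally have "9 * C * (real N powr (\<epsilon>/6) * (real N * A) * Z) \<le> 27 * C * (real N powr \<epsilon> * B * Z)" .
      then show "S \<le> (27 * C) * (real N powr \<epsilon> * (Q^4 + real N powr (9/10) * Q powr (6/5)) * Z)"
        using SA unfolding B_def by linarith
    next
      assume small: "Q < real N powr (7/24)"
      show "S \<le> (27 * C) * (real N * Q powr (6/7 + \<epsilon>) * Z)"
      proof (cases "R ^ 6 \<le> N")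
        case True
        have "S \<le> 9 * real 3 * real N * Z"
          unfolding S_def Z_def R_def[symmetric]
          by (rule cubic_large_sieve_le[OF N card_near_fractions_small[OF True N]])
        also have "\<dots> = 27 * (real N * 1 * Z)" by simp
        also have "\<dots> \<le> (27 * C) * (real N * Q powr (6/7 + \<epsilon>) * Z)"
          using C(1) Z Q assms by (intro mult_mono mult_right_mono mult_left_mono) (auto simp: ge_one_powr_ge_zero)
        finally show ?thesis .
      next
        case False
        have "real N \<le> real (R ^ 6)" using False by (intro of_nat_mono) simp
        also have "\<dots> \<le> Q ^ 6" using R by (simp add: power_mono)
        finally have "real N powr (\<epsilon>/6) \<le> (Q ^ 6) powr (\<epsilon>/6)" using assms by (intro powr_mono2) auto
        also have "Q ^ 6 = Q powr real 6" using Q by (intro powr_realpow[symmetric]) simp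
        also have "(Q powr real 6) powr (\<epsilon>/6) = Q powr \<epsilon>" by (simp only: powr_powr) simp
        finally have NE: "real N powr (\<epsilon>/6) \<le> Q powr \<epsilon>" .
        have "A \<le> 2 * Q powr (6/7)" unfolding A_def using small_range_estimate[OF n1 Q(1)] small by simp
        then have "real N * A \<le> real N * (2 * Q powr (6/7))" by (intro mult_left_mono) auto
        then have "real N powr (\<epsilon>/6) * (real N * A) \<le> Q powr \<epsilon> * (real N * (2 * Q powr (6/7)))"
          by (rule mult_mono[OF NE]) (use A0 in auto)
        then have "real N powr (\<epsilon>/6) * (real N * A) * Z \<le> Q powr \<epsilon> * (real N * (2 * Q powr (6/7))) * Z"
          using Z by (rule mult_right_mono)
        also have "\<dots> = 2 * (real N * Q powr (6/7 + \<epsilon>) * Z)" by (simp add: powr_add)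
        finally have "9 * C * (real N powr (\<epsilon>/6) * (real N * A) * Z) \<le> 9 * C * (2 * (real N * Q powr (6/7 + \<epsilon>) * Z))"
          using C(1) by (intro mult_left_mono) auto
        also have "\<dots> = 18 * C * (real N * Q powr (6/7 + \<epsilon>) * Z)" by simp
        also have "\<dots> \<le> 27 * C * (real N * Q powr (6/7 + \<epsilon>) * Z)"
          using C(1) Z by (intro mult_right_mono) auto
        finally show ?thesis using SA by linarith
      qed
    qed
  qed
  have "27 * C > 0" using C(1) by simp
  with main show ?thesis unfolding Let_def by (intro exI[of _ "27 * C"]) blast
qed

end
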